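(* Let $\rho_1,\sigma_1\in\mathcal{S}(\mathcal{H}_1)$ and $\rho_2,\sigma_2\in\mathcal{S}(\mathcal{H}_2)$ with $\mathrm{supp}(\rho_1)\subseteq\mathrm{supp}(\sigma_1)$ or $\mathrm{supp}(\rho_2)\subseteq\mathrm{supp}(\sigma_2)$, let $r>0$, and assume $\rho_2$ is a pure state. Then $$E^d_{sc}(\rho_1,\sigma_1,\rho_2,\sigma_2,r)=\sup_{\beta\ge1}\frac{\beta-1}{\beta}\Big\{rD_{1/\beta}(\rho_2\|\sigma_2)-D^*_\beta(\rho_1\|\sigma_1)\Big\}.$$
   Context: $\mathcal{S}(\mathcal{H})$ denotes the set of density operators on a finite-dimensional Hilbert space $\mathcal{H}$; logarithms are base 2. Fidelity $F(\rho,\sigma)=\|\sqrt\rho\sqrt\sigma\|_1$, trace distance $d(\rho,\sigma)=\frac12\|\rho-\sigma\|_1$. For rate $r>0$ (with $nr$ understood as an integer), $\epsilon^{d,r}(n)=\min\{d(\mathcal{E}_n(\rho_1^{\otimes n}),\rho_2^{\otimes nr}):\mathcal{E}_n \text{ a quantum channel with } \mathcal{E}_n(\sigma_1^{\otimes n})=\sigma_2^{\otimes nr}\}$ and $E^d_{sc}=\lim_{n\to\infty}-\frac1n\log(1-\epsilon^{d,r}(n))$ (existence of the limit is part of the claim). The sandwiched Rényi divergence is $D^*_\beta(\rho\|\sigma)=\frac{1}{\beta-1}\log\operatorname{Tr}(\sigma^{\frac{1-\beta}{2\beta}}\rho\sigma^{\frac{1-\beta}{2\beta}})^\beta$ (for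 $\beta>1$ and $\mathrm{supp}(\rho)\subseteq\mathrm{supp}(\sigma)$, otherwise $+\infty$), and the Petz Rényi divergence for $\alpha\in(0,1)$ is $D_\alpha(\rho\|\sigma)=\frac{1}{\alpha-1}\log\operatorname{Tr}\rho^\alpha\sigma^{1-\alpha}$ if $\mathrm{supp}(\rho)\not\perp\mathrm{supp}(\sigma)$, otherwise $+\infty$; at $\beta=1$ (order 1) both equal the Umegaki relative entropy $D(\rho\|\sigma)=\operatorname{Tr}\rho(\log\rho-\log\sigma)$. *)

theory Defs
  imports "HOL-Analysis.Analysis" "Jordan_Normal_Form.Matrix"
begin

text \<open>A Hilbert space of dimension d is C^d; operators are d x d complex matrices
  (type complex mat, with carrier_mat d d).\<close>

definition adj :: "complex mat \<Rightarrow> complex mat" where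
  "adj A = mat (dim_col A) (dim_row A) (\<lambda>(i,j). cnj (A $$ (j,i)))"

definition mtrace :: "complex mat \<Rightarrow> complex" where
  "mtrace A = (\<Sum>i<dim_row A. A $$ (i,i))"

definition cinner :: "complex vec \<Rightarrow> complex vec \<Rightarrow> complex" where
  "cinner v w = (\<Sum>i<dim_vec v. cnj (v $ i) * w $ i)"

definition hermitian :: "nat \<Rightarrow> complex mat \<Rightarrow> bool" where
  "hermitian n A \<longleftrightarrow> A \<in> carrier_mat n n \<and> adj A = A"

definition psd :: "nat \<Rightarrow> complex mat \<Rightarrow> bool" where
  "psd n A \<longleftrightarrow> hermitian n A \<and> (\<forall>v \<in> carrier_vec n. 0 \<le> Re (cinner v (A *\<^sub>v v)))"

definition density :: "nat \<Rightarrow> complex mat \<Rightarrow> bool" where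
  "density n A \<longleftrightarrow> psd n A \<and> mtrace A = 1"

definition pure_state :: "nat \<Rightarrow> complex mat \<Rightarrow> bool" where
  "pure_state n A \<longleftrightarrow> (\<exists>\<psi> \<in> carrier_vec n. cinner \<psi> \<psi> = 1 \<and>
      A = mat n n (\<lambda>(i,j). \<psi> $ i * cnj (\<psi> $ j)))"

definition unitary :: "nat \<Rightarrow> complex mat \<Rightarrow> bool" where
  "unitary n U \<longleftrightarrow> U \<in> carrier_mat n n \<and> adj U * U = 1\<^sub>m n"

definition diag_of :: "nat \<Rightarrow> (nat \<Rightarrow> complex) \<Rightarrow> complex mat" where
  "diag_of n d = mat n n (\<lambda>(i,j). if i = j then d i else 0)"

text \<open>Functional calculus for Hermitian matrices via a spectral decomposition
  A = U diag(d) U^*: f(A) = U diag(f(d)) U^*.  (Independent of the decomposition.)\<close>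
definition mfun :: "(real \<Rightarrow> real) \<Rightarrow> complex mat \<Rightarrow> complex mat" where
  "mfun f A = (SOME B. \<exists>U d. unitary (dim_row A) U \<and>
      A = U * diag_of (dim_row A) (\<lambda>i. complex_of_real (d i)) * adj U \<and>
      B = U * diag_of (dim_row A) (\<lambda>i. complex_of_real (f (d i))) * adj U)"

text \<open>Matrix powers of PSD matrices; powers are taken on the support
  (0 powr a = 0, so negative powers are generalized inverses).\<close>
definition mpow :: "real \<Rightarrow> complex mat \<Rightarrow> complex mat" where
  "mpow a A = mfun (\<lambda>x. x powr a) A"

definition mlog :: "complex mat \<Rightarrow> complex mat" where
  "mlog A = mfun (\<lambda>x. if x > 0 then log 2 x else 0) A"

definition supp :: "complex mat \<Rightarrow> complex vec set" where
  "supp A = {A *\<^sub>v v | v. v \<in> carrier_vec (dim_col A)}"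

definition supp_orth :: "complex mat \<Rightarrow> complex mat \<Rightarrow> bool" where
  "supp_orth A B \<longleftrightarrow> (\<forall>x \<in> supp A. \<forall>y \<in> supp B. cinner x y = 0)"

definition trace_norm :: "complex mat \<Rightarrow> real" where
  "trace_norm X = Re (mtrace (mfun sqrt (adj X * X)))"

definition tdist :: "complex mat \<Rightarrow> complex mat \<Rightarrow> real" where
  "tdist A B = trace_norm (A - B) / 2"

definition rel_ent :: "complex mat \<Rightarrow> complex mat \<Rightarrow> ereal" where
  "rel_ent \<rho> \<sigma> = (if supp \<rho> \<subseteq> supp \<sigma>
      then ereal (Re (mtrace (\<rho> * (mlog \<rho> - mlog \<sigma>)))) else \<infinity>)"

text \<open>Sandwiched Renyi divergence D*_beta, for beta > 1; order 1 is Umegaki.\<close>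
definition sandwiched :: "real \<Rightarrow> complex mat \<Rightarrow> complex mat \<Rightarrow> ereal" where
  "sandwiched \<beta> \<rho> \<sigma> = (if \<beta> = 1 then rel_ent \<rho> \<sigma>
     else if supp \<rho> \<subseteq> supp \<sigma>
      then ereal (1 / (\<beta> - 1) * log 2 (Re (mtrace (mpow \<beta>
              (mpow ((1 - \<beta>) / (2 * \<beta>)) \<sigma> * \<rho> * mpow ((1 - \<beta>) / (2 * \<beta>)) \<sigma>)))))
      else \<infinity>)"

text \<open>Petz Renyi divergence D_alpha for alpha in (0,1); order 1 is Umegaki.\<close>
definition petz :: "real \<Rightarrow> complex mat \<Rightarrow> complex mat \<Rightarrow> ereal" where
  "petz \<alpha> \<rho> \<sigma> = (if \<alpha> = 1 then rel_ent \<rho> \<sigma>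
     else if \<not> supp_orth \<rho> \<sigma>
      then ereal (1 / (\<alpha> - 1) * log 2 (Re (mtrace (mpow \<alpha> \<rho> * mpow (1 - \<alpha>) \<sigma>))))
      else \<infinity>)"

definition kron :: "complex mat \<Rightarrow> complex mat \<Rightarrow> complex mat" where
  "kron A B = mat (dim_row A * dim_row B) (dim_col A * dim_col B)
     (\<lambda>(i,j). A $$ (i div dim_row B, j div dim_col B) * B $$ (i mod dim_row B, j mod dim_col B))"

fun tpow :: "nat \<Rightarrow> complex mat \<Rightarrow> complex mat" where
  "tpow 0 A = 1\<^sub>m 1"
| "tpow (Suc k) A = kron A (tpow k A)"

text \<open>Block (a,a') of size m x m of a (k*m) x (k*m) matrix (C^k tensor C^m ordering).\<close>
definition blk :: "nat \<Rightarrow> complex mat \<Rightarrow> nat \<Rightarrow> nat \<Rightarrow> complex mat" where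
  "blk m X a a' = mat m m (\<lambda>(b,b'). X $$ (a * m + b, a' * m + b'))"

text \<open>id_k tensor Phi applied to a (k*din) x (k*din) matrix.\<close>
definition ampl :: "nat \<Rightarrow> nat \<Rightarrow> nat \<Rightarrow> (complex mat \<Rightarrow> complex mat) \<Rightarrow> complex mat \<Rightarrow> complex mat" where
  "ampl k din dout \<Phi> X = mat (k * dout) (k * dout)
     (\<lambda>(i,j). \<Phi> (blk din X (i div dout) (j div dout)) $$ (i mod dout, j mod dout))"

definition channel :: "nat \<Rightarrow> nat \<Rightarrow> (complex mat \<Rightarrow> complex mat) \<Rightarrow> bool" where
  "channel din dout \<Phi> \<longleftrightarrow>
     (\<forall>X \<in> carrier_mat din din. \<Phi> X \<in> carrier_mat dout dout) \<and>
     (\<forall>X \<in> carrier_mat din din. \<forall>Y \<in> carrier_mat din din. \<Phi> (X + Y) = \<Phi> X + \<Phi> Y) \<and>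
     (\<forall>X \<in> carrier_mat din din. \<forall>c. \<Phi> (c \<cdot>\<^sub>m X) = c \<cdot>\<^sub>m \<Phi> X) \<and>
     (\<forall>X \<in> carrier_mat din din. mtrace (\<Phi> X) = mtrace X) \<and>
     (\<forall>k X. psd (k * din) X \<longrightarrow> psd (k * dout) (ampl k din dout \<Phi> X))"

text \<open>Output block length: nr is read as floor(n r).\<close>
definition outlen :: "real \<Rightarrow> nat \<Rightarrow> nat" where
  "outlen r n = nat \<lfloor>real n * r\<rfloor>"

definition eps_d :: "nat \<Rightarrow> nat \<Rightarrow> complex mat \<Rightarrow> complex mat \<Rightarrow> complex mat \<Rightarrow> complex mat
    \<Rightarrow> real \<Rightarrow> nat \<Rightarrow> real" where
  "eps_d d1 d2 \<rho>1 \<sigma>1 \<rho>2 \<sigma>2 r n =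
     Inf {tdist (\<Phi> (tpow n \<rho>1)) (tpow (outlen r n) \<rho>2) | \<Phi>.
            channel (d1 ^ n) (d2 ^ outlen r n) \<Phi> \<and>
            \<Phi> (tpow n \<sigma>1) = tpow (outlen r n) \<sigma>2}"

definition sc_term :: "nat \<Rightarrow> nat \<Rightarrow> complex mat \<Rightarrow> complex mat \<Rightarrow> complex mat \<Rightarrow> complex mat
    \<Rightarrow> real \<Rightarrow> nat \<Rightarrow> ereal" where
  "sc_term d1 d2 \<rho>1 \<sigma>1 \<rho>2 \<sigma>2 r n =
     (let e = eps_d d1 d2 \<rho>1 \<sigma>1 \<rho>2 \<sigma>2 r n in
      if e = 1 then \<infinity> else ereal (- (1 / real n) * log 2 (1 - e)))"

end

theory Submission
  imports Defs "Jordan_Normal_Form.Schur_Decomposition" "HOL-Real_Asymp.Real_Asymp"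
begin

text \<open>With \<open>s = (\<beta> - 1) / \<beta>\<close> and \<open>\<rho>2 = |\<psi>><\<psi>|\<close>, the term for \<open>\<beta>\<close> is minus the logarithm of
  \<open><\<psi>|\<sigma>2^s|\<psi>>^r\<close> times the Schatten \<open>\<beta>\<close>-norm of \<open>\<sigma>1^(-s/2) \<rho>1 \<sigma>1^(-s/2)\<close>. Since \<open>\<rho>2\<close> is pure, \<open>1 - d\<close> and the overlap
  \<open><\<psi>|E(\<rho>1)|\<psi>>\<close> agree up to a factor 2, so the optimal overlap has to be determined up to factors
  that are subexponential in \<open>n\<close>.

  A tensor power of \<open>\<sigma>\<close> has only polynomially many distinct eigenvalues. Pinching therefore costs a
  polynomial factor only, and makes the first (resp. second) state diagonal in an eigenbasis of \<open>\<sigma>\<close>.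

  Converse: split the pinched input into the level sets of \<open>i \<mapsto> <\<psi>|E(|i><i|)|\<psi>>\<close>. A level set of
  \<open>\<sigma>1\<close>-weight \<open>a\<close> has \<open>\<rho>1\<close>-weight at most \<open>N a^s\<close> by Hoelder, and its normalised output \<open>\<tau>\<close> satisfies \<open>a \<tau> \<le> \<sigma>2\<close>,
  whence \<open><\<psi>|\<tau>|\<psi>>\<close> is at most \<open>a^(-s) <\<psi>|\<sigma>2^s|\<psi>>\<close> up to a polynomial factor. The product is independent of \<open>a\<close>.

  Achievability: measure a test (a dyadic level set of the likelihood ratio) and prepare the
  normalised projection of \<open>\<psi>\<close> onto an eigenspace of \<open>\<sigma>2\<close>. For \<open>\<rho>1\<close>-weight \<open>b\<close>, \<open>\<sigma>1\<close>-weight \<open>a\<close>,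
  overlap \<open>w\<close> and eigenvalue \<open>l\<close> this gives the overlap \<open>min (b w) (b w l / a)\<close>, up to a factor 2. For each fixed \<open>s\<close> some pair attains the optimum;
  a minimax argument on \<open>[0,1]\<close> yields two pairs whose mixture over blocks is optimal for all \<open>s\<close> at once.\<close>

section \<open>Matrices and the spectral theorem\<close>

text \<open>The obstacle is that the two directions have different shapes. With
  \<open>x = log (b w)\<close> and \<open>y = log (b w l / a)\<close>, a test/output pair achieves
  \<open>min x y\<close>, whereas the converse for a fixed \<open>s\<close> only controls the mean
  \<open>(1 - s) x + s y\<close>. A pair that attains the bound for one \<open>s\<close> may have
  one of \<open>x\<close>, \<open>y\<close> far too small, and tensor powers of a single pair keep
  that defect. Both numbers are additive over tensor products, though, so different pairs may serve
  different blocks. Two of them suffice because every pair is a line over the interval of all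
  \<open>s\<close>: a falling and a rising line that are both high enough at a common
  \<open>s\<close> have a horizontal mixture.

  Additivity would be lost if the minimum were taken block by block; the numbers \<open>x\<close>
  and \<open>y\<close> are therefore carried separately, and a channel is built only once, for the
  whole mixture. The term for \<open>\<beta> = 1\<close> is 0, matching the fact that the sequence
  is never negative. Degenerate supports give the limits 0 and \<infinity> and are handled without
  the exponential estimates.\<close>

declare assoc_mult_mat [simp del]

text \<open>The carrier premises of \<open>assoc_mult_mat\<close> leave intermediate dimensions to
  be guessed. Equations between dimensions can be evaluated by the simplifier, which then normalises
  all products to the right.\<close>

lemma mat_assoc:
  "dim_col A = dim_row B \<Longrightarrow> dim_col B = dim_row C \<Longrightarrow> A * B * C = A * (B * C)"
  by (rule assoc_mult_mat) auto

lemma adj_dim [simp]: "dim_row (adj A) = dim_col A" "dim_col (adj A) = dim_row A"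
  by (auto simp: adj_def)

lemma adj_carrier [simp]: "A \<in> carrier_mat n m \<Longrightarrow> adj A \<in> carrier_mat m n"
  by (auto simp: adj_def)

lemma adj_index [simp]: "i < dim_col A \<Longrightarrow> j < dim_row A \<Longrightarrow> adj A $$ (i,j) = cnj (A $$ (j,i))"
  by (simp add: adj_def)

lemma adj_adj [simp]: "adj (adj A) = A"
  by (rule eq_matI) auto

lemma mat_mult_index:
  "A \<in> carrier_mat n k \<Longrightarrow> B \<in> carrier_mat k m \<Longrightarrow> i < n \<Longrightarrow> j < m \<Longrightarrow>
    (A * B) $$ (i,j) = (\<Sum>l<k. A $$ (i,l) * B $$ (l,j))"
  by (simp add: scalar_prod_def atLeast0LessThan)

lemma mat_vec_index:
  "A \<in> carrier_mat n k \<Longrightarrow> v \<in> carrier_vec k \<Longrightarrow> i < n \<Longrightarrow> (A *\<^sub>v v) $ i = (\<Sum>l<k. A $$ (i,l) * v $ l)"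
  by (simp add: scalar_prod_def atLeast0LessThan)

lemma adj_mult: "dim_col A = dim_row B \<Longrightarrow> adj (A * B) = adj B * adj A"
  by (rule eq_matI) (auto simp: scalar_prod_def mult.commute)

lemma adj_one [simp]: "adj (1\<^sub>m n) = 1\<^sub>m n"
  by (rule eq_matI) auto

lemma adj_add: "A \<in> carrier_mat n m \<Longrightarrow> B \<in> carrier_mat n m \<Longrightarrow> adj (A + B) = adj A + adj B"
  by (rule eq_matI) auto

lemma adj_minus: "A \<in> carrier_mat n m \<Longrightarrow> B \<in> carrier_mat n m \<Longrightarrow> adj (A - B) = adj A - adj B"
  by (rule eq_matI) auto

lemma adj_smult: "adj (c \<cdot>\<^sub>m A) = cnj c \<cdot>\<^sub>m adj A"
  by (rule eq_matI) auto

lemma diag_of_carrier [simp]: "diag_of n d \<in> carrier_mat n n"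
  and diag_of_dim [simp]: "dim_row (diag_of n d) = n" "dim_col (diag_of n d) = n"
  and diag_of_index [simp]: "i < n \<Longrightarrow> j < n \<Longrightarrow> diag_of n d $$ (i,j) = (if i = j then d i else 0)"
  by (auto simp: diag_of_def)

lemma diag_of_mult_index:
  assumes "A \<in> carrier_mat n m" "i < n" "j < m"
  shows "(diag_of n d * A) $$ (i,j) = d i * A $$ (i,j)"
proof -
  have "(diag_of n d * A) $$ (i,j) = (\<Sum>l<n. diag_of n d $$ (i,l) * A $$ (l,j))"
    using assms by (intro mat_mult_index[of _ n n _ m]) auto
  also have "\<dots> = (\<Sum>l<n. (if l = i then d i * A $$ (i,j) else 0))"
    using assms by (intro sum.cong) auto
  finally show ?thesis using assms by simp
qed

lemma mult_diag_of_index: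
  assumes "A \<in> carrier_mat m n" "i < m" "j < n"
  shows "(A * diag_of n d) $$ (i,j) = A $$ (i,j) * d j"
proof -
  have "(A * diag_of n d) $$ (i,j) = (\<Sum>l<n. A $$ (i,l) * diag_of n d $$ (l,j))"
    using assms by (intro mat_mult_index[of _ m n _ n]) auto
  also have "\<dots> = (\<Sum>l<n. (if l = j then A $$ (i,j) * d j else 0))"
    using assms by (intro sum.cong) auto
  finally show ?thesis using assms by simp
qed

lemma diag_of_mult: "diag_of n a * diag_of n b = diag_of n (\<lambda>i. a i * b i)"
  by (rule eq_matI) (auto simp: diag_of_mult_index[where n=n and m=n] simp del: index_mult_mat(1))

lemma diag_of_cong: "(\<And>i. i < n \<Longrightarrow> a i = b i) \<Longrightarrow> diag_of n a = diag_of n b"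
  by (rule eq_matI) auto

lemma adj_diag_of: "adj (diag_of n d) = diag_of n (\<lambda>i. cnj (d i))"
  by (rule eq_matI) auto

lemma adj_diag_of_real [simp]:
  "adj (diag_of n (\<lambda>i. complex_of_real (d i))) = diag_of n (\<lambda>i. complex_of_real (d i))"
  by (simp add: adj_diag_of)

lemma diag_of_one: "diag_of n (\<lambda>_. 1) = 1\<^sub>m n"
  by (rule eq_matI) auto

lemma mtrace_carrier: "A \<in> carrier_mat n m \<Longrightarrow> mtrace A = (\<Sum>i<n. A $$ (i,i))"
  by (simp add: mtrace_def)

lemma mtrace_diag_of [simp]: "mtrace (diag_of n d) = (\<Sum>i<n. d i)"
  by (simp add: mtrace_def)

lemma mtrace_add: "A \<in> carrier_mat n n \<Longrightarrow> B \<in> carrier_mat n n \<Longrightarrow> mtrace (A + B) = mtrace A + mtrace B"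
  by (auto simp: mtrace_def sum.distrib)

lemma mtrace_minus: "A \<in> carrier_mat n n \<Longrightarrow> B \<in> carrier_mat n n \<Longrightarrow> mtrace (A - B) = mtrace A - mtrace B"
  by (auto simp: mtrace_def sum_subtractf)

lemma mtrace_smult: "A \<in> carrier_mat n n \<Longrightarrow> mtrace (c \<cdot>\<^sub>m A) = c * mtrace A"
  by (auto simp: mtrace_def sum_distrib_left)

lemma mtrace_mult:
  assumes "A \<in> carrier_mat n m" "B \<in> carrier_mat m n"
  shows "mtrace (A * B) = (\<Sum>i<n. \<Sum>j<m. A $$ (i,j) * B $$ (j,i))"
  using assms by (simp add: mtrace_def mat_mult_index[OF assms] del: index_mult_mat(1))

lemma mtrace_comm:
  assumes "A \<in> carrier_mat n m" "B \<in> carrier_mat m n"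
  shows "mtrace (A * B) = mtrace (B * A)"
  unfolding mtrace_mult[OF assms] mtrace_mult[OF assms(2,1)]
  by (subst sum.swap) (simp add: mult.commute)

lemma mtrace_cong_unitary:
  assumes "unitary n U" "A \<in> carrier_mat n n"
  shows "mtrace (U * A * adj U) = mtrace A"
proof -
  have U: "U \<in> carrier_mat n n" "adj U * U = 1\<^sub>m n" using assms by (auto simp: unitary_def)
  have "mtrace (U * A * adj U) = mtrace (adj U * (U * A))"
    using U assms by (intro mtrace_comm[where n=n and m=n]) auto
  also have "adj U * (U * A) = (adj U * U) * A"
    by (rule assoc_mult_mat[symmetric]) (use U assms in auto)
  finally show ?thesis using U assms by simp
qed

lemma cinner_carrier: "v \<in> carrier_vec n \<Longrightarrow> cinner v w = (\<Sum>i<n. cnj (v $ i) * w $ i)"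
  by (simp add: cinner_def)

lemma cinner_mat:
  assumes "A \<in> carrier_mat n m" "v \<in> carrier_vec n" "w \<in> carrier_vec m"
  shows "cinner v (A *\<^sub>v w) = (\<Sum>i<n. \<Sum>j<m. cnj (v $ i) * A $$ (i,j) * w $ j)"
  using assms by (simp add: cinner_carrier mat_vec_index[OF assms(1,3)] sum_distrib_left mult.assoc
     del: index_mult_mat_vec)

lemma cinner_self: "v \<in> carrier_vec n \<Longrightarrow> cinner v v = complex_of_real (\<Sum>i<n. (cmod (v $ i))\<^sup>2)"
  by (simp add: cinner_carrier complex_norm_square mult.commute del: of_real_power)

lemma cinner_adj:
  assumes "A \<in> carrier_mat n m" "v \<in> carrier_vec n" "w \<in> carrier_vec m"
  shows "cinner (adj A *\<^sub>v v) w = cinner v (A *\<^sub>v w)"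
proof -
  have "cinner (adj A *\<^sub>v v) w = (\<Sum>j<m. \<Sum>i<n. cnj (v $ i) * A $$ (i,j) * w $ j)"
    using assms
    by (subst cinner_carrier[of _ m])
      (auto intro!: carrier_vecI simp add: mat_vec_index[of "adj A" m n] sum_distrib_left sum_distrib_right
       mult_ac simp del: index_mult_mat_vec intro!: sum.cong)
  then show ?thesis unfolding cinner_mat[OF assms] by (subst sum.swap) simp
qed

section \<open>Unitary matrices\<close>

lemma unitaryD:
  assumes "unitary n U"
  shows "U \<in> carrier_mat n n" "adj U * U = 1\<^sub>m n" "U * adj U = 1\<^sub>m n"
proof -
  show *: "U \<in> carrier_mat n n" "adj U * U = 1\<^sub>m n" using assms by (auto simp: unitary_def)
  show "U * adj U = 1\<^sub>m n"
    by (rule mat_mult_left_right_inverse[OF _ _ *(2)]) (use * in auto)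
qed

lemma unitary_cancel:
  assumes "unitary n U" "dim_row X = n"
  shows "adj U * (U * X) = X" "U * (adj U * X) = X"
proof -
  note U = unitaryD[OF assms(1)]
  have "adj U * U * X = adj U * (U * X)" "U * adj U * X = U * (adj U * X)"
    using carrier_matD[OF U(1)] assms(2) by (auto intro!: mat_assoc)
  then show "adj U * (U * X) = X" "U * (adj U * X) = X"
    using assms(2) by (simp_all add: U)
qed

lemma unitary_mult:
  assumes "unitary n U" "unitary n V"
  shows "unitary n (U * V)"
proof -
  note U = unitaryD[OF assms(1)] and V = unitaryD[OF assms(2)]
  have "adj (U * V) * (U * V) = adj V * (adj U * (U * V))"
    using carrier_matD[OF U(1)] carrier_matD[OF V(1)] by (simp add: adj_mult mat_assoc)
  then show ?thesis using U(1) V by (simp add: unitary_def unitary_cancel[OF assms(1)])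
qed

lemma unitary_one: "unitary n (1\<^sub>m n)"
  by (simp add: unitary_def)

lemma unitary_cols_norm:
  assumes "unitary n U" "k < n"
  shows "(\<Sum>i<n. (cmod (U $$ (i,k)))\<^sup>2) = 1"
proof -
  note U = unitaryD[OF assms(1)]
  have "(adj U * U) $$ (k,k) = (\<Sum>i<n. cnj (U $$ (i,k)) * U $$ (i,k))"
    using U assms by (subst mat_mult_index[of _ n n _ n]) auto
  also have "\<dots> = complex_of_real (\<Sum>i<n. (cmod (U $$ (i,k)))\<^sup>2)"
    by (simp add: complex_norm_square mult.commute del: of_real_power)
  finally have "complex_of_real (\<Sum>i<n. (cmod (U $$ (i,k)))\<^sup>2) = 1" using U assms by simp
  then show ?thesis using of_real_eq_1_iff by blast
qed

lemma unitary_adj: "unitary n U \<Longrightarrow> unitary n (adj U)"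
  by (frule unitaryD(1), drule unitaryD(3)) (simp add: unitary_def)

lemma unitary_rows_norm:
  assumes "unitary n U" "k < n"
  shows "(\<Sum>i<n. (cmod (U $$ (k,i)))\<^sup>2) = 1"
  using unitary_cols_norm[OF unitary_adj[OF assms(1)] assms(2)] unitaryD[OF assms(1)] assms(2) by simp

text \<open>Gram-Schmidt on a basis beginning with \<open>v\<close> keeps \<open>v\<close> in front
  but only orthogonalises; dividing each column by its norm \<open>sqrt (s j)\<close> gives a
  unitary. The factor \<open>c\<close> is the one from this normalisation.\<close>

lemma unitary_completion:
  fixes v :: "complex vec"
  assumes v: "v \<in> carrier_vec n" and v0: "v \<noteq> 0\<^sub>v n"
  shows "\<exists>W c. unitary n W \<and> col W 0 = c \<cdot>\<^sub>v v"
proof -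
  have n: "n \<noteq> 0" using v v0 by (metis carrier_vecD vec_of_dim_0)
  define b where "b = basis_completion v"
  define ws where "ws = gram_schmidt n b"
  interpret cof_vec_space n "TYPE(complex)" .
  from basis_completion[OF v v0, folded b_def]
  have dist_b: "distinct b" and indep: "\<not> lin_dep (set b)" and b: "set b \<subseteq> carrier_vec n"
    and hdb: "hd b = v" and len_b: "length b = n" by auto
  from hdb len_b n obtain vs where bv: "b = v # vs" by (cases b, auto)
  from gram_schmidt_result[OF b dist_b indep refl, folded ws_def]
  have ws: "set ws \<subseteq> carrier_vec n" "corthogonal ws" "length ws = n" by (auto simp: len_b)
  from gram_schmidt_hd[OF v, of vs, folded bv] have hdws: "hd ws = v" unfolding ws_def .
  define s where "s j = (\<Sum>i<n. (cmod (ws ! j $ i))\<^sup>2)" for j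
  have wc: "ws ! j \<in> carrier_vec n" if "j < n" for j using ws that by auto
  have inner: "(\<Sum>l<n. cnj (ws ! i $ l) * ws ! j $ l) = (if i = j then complex_of_real (s i) else 0)"
    if "i < n" "j < n" for i j
  proof (cases "i = j")
    case True then show ?thesis
      by (simp add: s_def complex_norm_square mult.commute del: of_real_power)
  next
    case False
    have "ws ! j \<bullet>c ws ! i = 0" using corthogonalD[OF ws(2)] False that ws(3) by auto
    then have "(\<Sum>l<n. ws ! j $ l * cnj (ws ! i $ l)) = 0"
      using wc[of i] wc[of j] that by (simp add: scalar_prod_def atLeast0LessThan)
    then show ?thesis using False by (simp add: mult.commute)
  qed
  have spos: "s i > 0" if "i < n" for i
  proof -
    have "ws ! i \<bullet>c ws ! i \<noteq> 0" using corthogonalD[OF ws(2)] that ws(3) by auto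
    then have "(\<Sum>l<n. ws ! i $ l * cnj (ws ! i $ l)) \<noteq> 0"
      using wc[of i] that by (simp add: scalar_prod_def atLeast0LessThan)
    then have "s i \<noteq> 0" using inner[of i i] that by (simp add: mult.commute)
    moreover have "s i \<ge> 0" by (auto simp: s_def intro: sum_nonneg)
    ultimately show ?thesis by simp
  qed
  define W where "W = mat n n (\<lambda>(i,j). ws ! j $ i / complex_of_real (sqrt (s j)))"
  have W: "W \<in> carrier_mat n n" by (simp add: W_def)
  have "adj W * W = 1\<^sub>m n"
  proof (rule eq_matI)
    fix i j assume ij: "i < dim_row (1\<^sub>m n :: complex mat)" "j < dim_col (1\<^sub>m n :: complex mat)"
    then have ij: "i < n" "j < n" by auto
    have "(adj W * W) $$ (i,j) = (\<Sum>l<n. cnj (ws ! i $ l) * ws ! j $ l) / (sqrt (s i) * sqrt (s j))"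
      using ij W by (subst mat_mult_index[of _ n n _ n]) (auto simp: W_def sum_divide_distrib intro!: sum.cong)
    also have "\<dots> = 1\<^sub>m n $$ (i,j)"
    proof -
      have "complex_of_real (sqrt (s j)) * complex_of_real (sqrt (s j)) = complex_of_real (s j)"
        using spos[of j] ij by (simp flip: of_real_mult)
      then show ?thesis unfolding inner[OF ij] using ij spos[of j] by simp
    qed
    finally show "(adj W * W) $$ (i,j) = 1\<^sub>m n $$ (i,j)" .
  qed (use W in auto)
  then have "unitary n W" using W by (simp add: unitary_def)
  moreover have "col W 0 = complex_of_real (1 / sqrt (s 0)) \<cdot>\<^sub>v v"
  proof (rule eq_vecI)
    have "ws ! 0 = v" using hdws ws(3) n by (metis hd_conv_nth length_0_conv)
    then show "col W 0 $ i = (complex_of_real (1 / sqrt (s 0)) \<cdot>\<^sub>v v) $ i"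
      if "i < dim_vec (complex_of_real (1 / sqrt (s 0)) \<cdot>\<^sub>v v)" for i
      using that n v by (simp add: W_def)
  qed (use W v in auto)
  ultimately show ?thesis by blast
qed

section \<open>Diagonalisation of Hermitian matrices\<close>

lemma hermitianD: "hermitian n A \<Longrightarrow> A \<in> carrier_mat n n" "hermitian n A \<Longrightarrow> adj A = A"
  by (auto simp: hermitian_def)

lemma hermitian_congruence:
  assumes "hermitian n A" "M \<in> carrier_mat n m"
  shows "hermitian m (adj M * A * M)"
proof -
  note A = hermitianD[OF assms(1)]
  have "adj (adj M * A * M) = adj M * A * M"
    using A assms by (simp add: adj_mult mat_assoc)
  moreover have "adj M * A * M \<in> carrier_mat m m" by (rule carrier_matI) (use assms in auto)
  ultimately show ?thesis by (simp add: hermitian_def)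
qed

lemma hermitian_index: "hermitian n A \<Longrightarrow> i < n \<Longrightarrow> j < n \<Longrightarrow> A $$ (j,i) = cnj (A $$ (i,j))"
  by (metis adj_index carrier_matD hermitian_def)

text \<open>Deflation: an eigenvector, available because the characteristic polynomial splits over
  the complex numbers, becomes the leading column of a unitary \<open>W\<close>. In that basis a 1
  by 1 block splits off, and the induction hypothesis diagonalises the rest.\<close>

theorem spectral_theorem:
  "hermitian n A \<Longrightarrow> \<exists>U d. unitary n U \<and> A = U * diag_of n (\<lambda>i. complex_of_real (d i)) * adj U"
proof (induction n arbitrary: A)
  case 0
  then show ?case
    by (intro exI[of _ "1\<^sub>m 0"] exI[of _ "\<lambda>_. 0"]) (auto simp: unitary_one hermitian_def)
next
  case (Suc n)
  note A = hermitianD[OF Suc.prems]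
  obtain as where as: "char_poly A = (\<Prod>a\<leftarrow>as. [:- a, 1:])" "length as = Suc n"
    using char_poly_factorized[OF A(1)] by auto
  then obtain e es where "as = e # es" by (cases as) auto
  then have "eigenvalue A e"
    unfolding eigenvalue_root_char_poly[OF A(1)] as by simp
  then obtain v where v: "v \<in> carrier_vec (Suc n)" "v \<noteq> 0\<^sub>v (Suc n)" "A *\<^sub>v v = e \<cdot>\<^sub>v v"
    using A unfolding eigenvalue_def eigenvector_def by auto
  obtain W c where W: "unitary (Suc n) W" and col: "col W 0 = c \<cdot>\<^sub>v v"
    using unitary_completion[OF v(1,2)] by blast
  note Wu = unitaryD[OF W]
  define B where "B = adj W * A * W"
  have Bh: "hermitian (Suc n) B" unfolding B_def by (rule hermitian_congruence[OF Suc.prems Wu(1)])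
  have Bc: "B \<in> carrier_mat (Suc n) (Suc n)" using Bh by (rule hermitianD)
  have AW: "A *\<^sub>v col W 0 = e \<cdot>\<^sub>v col W 0"
    unfolding col using v A by (simp add: mult_mat_vec smult_smult_assoc mult.commute)
  have B0: "B $$ (i,0) = (if i = 0 then e else 0)" if "i < Suc n" for i
  proof -
    have "B $$ (i,0) = (adj W * (A * W)) $$ (i,0)"
      unfolding B_def using Wu A by (simp add: mat_assoc)
    also have "\<dots> = (\<Sum>l<Suc n. adj W $$ (i,l) * (A * W) $$ (l,0))"
      using Wu A that by (subst mat_mult_index[of _ "Suc n" "Suc n" _ "Suc n"]) auto
    also have "\<dots> = (\<Sum>l<Suc n. e * (adj W $$ (i,l) * W $$ (l,0)))"
    proof (intro sum.cong refl)
      fix l assume l: "l \<in> {..<Suc n}"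
      have "(A * W) $$ (l,0) = (A *\<^sub>v col W 0) $ l" using l A Wu by simp
      also have "\<dots> = e * W $$ (l,0)" unfolding AW using l Wu by simp
      finally show "adj W $$ (i,l) * (A * W) $$ (l,0) = e * (adj W $$ (i,l) * W $$ (l,0))" by simp
    qed
    also have "\<dots> = e * (adj W * W) $$ (i,0)"
      using Wu A that by (subst mat_mult_index[of _ "Suc n" "Suc n" _ "Suc n"]) (auto simp: sum_distrib_left algebra_simps)
    finally show ?thesis using Wu that by simp
  qed
  have e: "e = complex_of_real (Re e)"
    using hermitian_index[OF Bh, of 0 0] B0[of 0] by (simp add: complex_eq_iff)
  define C where "C = mat n n (\<lambda>(i,j). B $$ (Suc i, Suc j))"
  have Ch: "hermitian n C"
    unfolding hermitian_def
  proof (intro conjI eq_matI)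
    fix i j assume "i < dim_row C" "j < dim_col C"
    then have ij: "i < n" "j < n" by (auto simp: C_def)
    show "adj C $$ (i,j) = C $$ (i,j)"
      using ij hermitian_index[OF Bh, of "Suc j" "Suc i"] by (simp add: C_def)
  qed (auto simp: C_def)
  obtain P d where P: "unitary n P" and C: "C = P * diag_of n (\<lambda>i. complex_of_real (d i)) * adj P"
    using Suc.IH[OF Ch] by blast
  note Pu = unitaryD[OF P]
  let ?fb = "\<lambda>x Y. four_block_mat (mat 1 1 (\<lambda>_. x)) (0\<^sub>m 1 n) (0\<^sub>m n 1) Y :: complex mat"
  have fbm: "?fb x X * ?fb y Y = ?fb (x * y) (X * Y)" if "X \<in> carrier_mat n n" "Y \<in> carrier_mat n n" for x y X Y
    using that by (subst mult_four_block_mat[of _ 1 1 _ n _ n _ _ 1 _ n])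
      (auto intro!: cong_four_block_mat eq_matI simp: scalar_prod_def)
  have fba: "adj (?fb x X) = ?fb (cnj x) (adj X)" if "X \<in> carrier_mat n n" for x X
    using that by (intro eq_matI) auto
  have fb1: "?fb 1 (1\<^sub>m n) = 1\<^sub>m (Suc n)"
    by (intro eq_matI) auto
  define d' where "d' i = (case i of 0 \<Rightarrow> Re e | Suc j \<Rightarrow> d j)" for i
  have fbd: "?fb e (diag_of n (\<lambda>i. complex_of_real (d i))) = diag_of (Suc n) (\<lambda>i. complex_of_real (d' i))"
    using e by (intro eq_matI) (auto simp: d'_def split: nat.split)
  \<comment> \<open>Self-adjointness turns the vanishing rest of column 0 into a vanishing rest of
    row 0; without it the matrix would only be block triangular.\<close>
  have B: "B = ?fb e C"
  proof (rule eq_matI)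
    fix i j assume "i < dim_row (?fb e C)" "j < dim_col (?fb e C)"
    then have ij: "i < Suc n" "j < Suc n" by (auto simp: C_def)
    show "B $$ (i,j) = ?fb e C $$ (i,j)"
    proof (cases "i = 0")
      case True
      have "B $$ (0,j) = (if j = 0 then e else 0)"
        using hermitian_index[OF Bh, of j 0] B0[of j] ij e by (simp split: if_splits)
      then show ?thesis using ij True by (auto simp: C_def)
    next
      case False
      then show ?thesis using B0[of i] ij by (cases j; cases i) (auto simp: C_def)
    qed
  qed (use Bc in \<open>auto simp: C_def\<close>)
  define V where "V = ?fb 1 P"
  have V: "unitary (Suc n) V"
    unfolding unitary_def V_def using Pu fb1 fbm[of "adj P" P 1 1] fba[of P 1] by auto
  have Vc: "V \<in> carrier_mat (Suc n) (Suc n)" using unitaryD[OF V] by simp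
  let ?D = "diag_of (Suc n) (\<lambda>i. complex_of_real (d' i))"
  have BV: "B = V * ?D * adj V"
    using fbm[of P "diag_of n (\<lambda>i. complex_of_real (d i))" 1 e]
      fbm[of "P * diag_of n (\<lambda>i. complex_of_real (d i))" "adj P" e 1] Pu(1)
    unfolding B C V_def fba[OF Pu(1)] fbd[symmetric] by simp
  have "A = W * B * adj W"
    unfolding B_def using Wu(1) A(1) by (simp add: mat_assoc Wu(3) unitary_cancel[OF W])
  also have "\<dots> = (W * V) * ?D * adj (W * V)"
    unfolding BV using Wu(1) Vc
    by (simp add: adj_mult mat_assoc)
  finally show ?case using unitary_mult[OF W V] by blast
qed

section \<open>Functional calculus and positive matrices\<close>

abbreviation rdiag :: "nat \<Rightarrow> (nat \<Rightarrow> real) \<Rightarrow> complex mat" where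
  "rdiag n d \<equiv> diag_of n (\<lambda>i. complex_of_real (d i))"

text \<open>Eigenbasis and eigenvalues are explicit arguments, so that simultaneous diagonalisation
  is expressed by using the same \<open>U\<close> twice. No order is imposed on \<open>d\<close>,
  and repeated values are allowed.\<close>

definition specdec :: "nat \<Rightarrow> complex mat \<Rightarrow> complex mat \<Rightarrow> (nat \<Rightarrow> real) \<Rightarrow> bool" where
  "specdec n A U d \<longleftrightarrow> unitary n U \<and> A = U * rdiag n d * adj U"

lemma specdecD:
  assumes "specdec n A U d"
  shows "unitary n U" "A = U * rdiag n d * adj U" "A \<in> carrier_mat n n" "U \<in> carrier_mat n n"
    "dim_row A = n" "dim_col A = n" "dim_row U = n" "dim_col U = n" "adj A = A" "hermitian n A"
proof -
  show 1: "unitary n U" "A = U * rdiag n d * adj U" using assms by (auto simp: specdec_def)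
  show U: "U \<in> carrier_mat n n" by (rule unitaryD[OF 1(1)])
  then show 2: "dim_row U = n" "dim_col U = n" by auto
  show 3: "dim_row A = n" "dim_col A = n" using 1 2 by simp_all
  then show "A \<in> carrier_mat n n" by auto
  show "adj A = A" using 2 by (simp add: 1(2) adj_mult mat_assoc)
  then show "hermitian n A" using 3 by (auto simp: hermitian_def)
qed

lemma hermitian_specdec: "hermitian n A \<Longrightarrow> \<exists>U d. specdec n A U d"
  using spectral_theorem by (auto simp: specdec_def)

lemma specdec_cong: "specdec n A U d \<Longrightarrow> (\<And>i. i < n \<Longrightarrow> d i = e i) \<Longrightarrow> specdec n A U e"
  using diag_of_cong[of n "\<lambda>i. complex_of_real (d i)" "\<lambda>i. complex_of_real (e i)"]
  by (auto simp: specdec_def)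

lemma unitary_conj_inv:
  assumes "unitary n U" "B \<in> carrier_mat n n"
  shows "U * (adj U * B * U) * adj U = B" "adj U * (U * B * adj U) * U = B"
proof -
  note U = unitaryD[OF assms(1)]
  have d: "dim_row U = n" "dim_col U = n" "dim_row B = n" "dim_col B = n" using U assms by auto
  show "U * (adj U * B * U) * adj U = B" "adj U * (U * B * adj U) * U = B"
    using d assms by (simp_all add: mat_assoc U unitary_cancel[OF assms(1)])
qed

text \<open>\<open>mfun\<close> picks some decomposition, so independence of the choice is needed.
  For two decompositions the unitary \<open>W = adj V * U\<close> intertwines the diagonals:
  \<open>W $$ (i,j)\<close> vanishes unless \<open>d j = e i\<close>. Hence \<open>W\<close> also
  intertwines the diagonals after \<open>f\<close> has been applied.\<close>

lemma mfun_specdec: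
  assumes A: "specdec n A U d"
  shows "mfun f A = U * rdiag n (\<lambda>i. f (d i)) * adj U"
proof -
  note AD = specdecD[OF A]
  have "B = U * rdiag n (\<lambda>i. f (d i)) * adj U"
    if ex: "\<exists>V e. unitary n V \<and> A = V * rdiag n e * adj V \<and> B = V * rdiag n (\<lambda>i. f (e i)) * adj V" for B
  proof -
    from ex obtain V e where V: "unitary n V" "A = V * rdiag n e * adj V"
      "B = V * rdiag n (\<lambda>i. f (e i)) * adj V" by blast
    note VD = unitaryD[OF V(1)]
    have d: "dim_row V = n" "dim_col V = n" using VD by auto
    define W where "W = adj V * U"
    have Wd: "W \<in> carrier_mat n n" unfolding W_def using AD(7,8) d by auto
    note c1 = unitary_cancel[OF V(1)] and c2 = unitary_cancel[OF AD(1)]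
    have "W * rdiag n d = adj V * (A * U)"
      using AD(7,8) d by (simp add: W_def AD(2) mat_assoc unitaryD[OF AD(1)])
    also have "\<dots> = rdiag n e * W"
      using AD(7,8) d by (simp add: W_def V(2) mat_assoc c1)
    finally have WD: "W * rdiag n d = rdiag n e * W" .
    have ent: "W $$ (i,j) * d j = e i * W $$ (i,j)" if "i < n" "j < n" for i j
      using arg_cong[OF WD, of "\<lambda>X. X $$ (i,j)"] that
      by (simp only: mult_diag_of_index[OF Wd that] diag_of_mult_index[OF Wd that])
    have "W * rdiag n (\<lambda>i. f (d i)) = rdiag n (\<lambda>i. f (e i)) * W"
    proof (rule eq_matI)
      fix i j assume "i < dim_row (rdiag n (\<lambda>i. f (e i)) * W)" "j < dim_col (rdiag n (\<lambda>i. f (e i)) * W)"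
      then have ij: "i < n" "j < n" using Wd by auto
      have "W $$ (i,j) = 0 \<or> d j = e i" using ent[OF ij] by (simp add: mult.commute)
      then show "(W * rdiag n (\<lambda>i. f (d i))) $$ (i,j) = (rdiag n (\<lambda>i. f (e i)) * W) $$ (i,j)"
        unfolding mult_diag_of_index[OF Wd ij] diag_of_mult_index[OF Wd ij] by auto
    qed (use Wd in auto)
    then have "V * (W * rdiag n (\<lambda>i. f (d i))) * adj U = V * (rdiag n (\<lambda>i. f (e i)) * W) * adj U" by simp
    moreover have "V * (W * rdiag n (\<lambda>i. f (d i))) * adj U = U * rdiag n (\<lambda>i. f (d i)) * adj U"
      using AD(7,8) d by (simp add: W_def mat_assoc c1)
    moreover have "V * (rdiag n (\<lambda>i. f (e i)) * W) * adj U = B"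
      using AD(7,8) d by (simp add: W_def V(3) mat_assoc unitaryD[OF AD(1)])
    ultimately show ?thesis by simp
  qed
  moreover have "\<exists>B. \<exists>V e. unitary n V \<and> A = V * rdiag n e * adj V \<and> B = V * rdiag n (\<lambda>i. f (e i)) * adj V"
    using AD by blast
  ultimately show ?thesis unfolding mfun_def AD(5) by (rule someI2_ex[rotated])
qed

lemma specdec_mfun: "specdec n A U d \<Longrightarrow> specdec n (mfun f A) U (\<lambda>i. f (d i))"
  using specdecD(1) by (auto simp: mfun_specdec specdec_def)

lemma specdec_mpow: "specdec n A U d \<Longrightarrow> specdec n (mpow a A) U (\<lambda>i. d i powr a)"
  unfolding mpow_def by (rule specdec_mfun)

section \<open>Positive semidefinite matrices\<close>

lemma psdD:
  assumes "psd n A"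
  shows "hermitian n A" "A \<in> carrier_mat n n" "dim_row A = n" "dim_col A = n" "adj A = A"
    "v \<in> carrier_vec n \<Longrightarrow> 0 \<le> Re (cinner v (A *\<^sub>v v))"
  using assms by (auto simp: psd_def hermitian_def)

lemma psdI:
  "hermitian n A \<Longrightarrow> (\<And>v. v \<in> carrier_vec n \<Longrightarrow> 0 \<le> Re (cinner v (A *\<^sub>v v))) \<Longrightarrow> psd n A"
  by (auto simp: psd_def)

lemma mat_vec_assoc:
  "dim_col A = dim_row B \<Longrightarrow> dim_col B = dim_vec v \<Longrightarrow> (A * B) *\<^sub>v v = A *\<^sub>v (B *\<^sub>v v)"
  by (rule assoc_mult_mat_vec) (auto intro: carrier_vecI)

lemma cinner_congruence:
  assumes "A \<in> carrier_mat n n" "M \<in> carrier_mat n m" "v \<in> carrier_vec m"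
  shows "cinner v ((adj M * A * M) *\<^sub>v v) = cinner (M *\<^sub>v v) (A *\<^sub>v (M *\<^sub>v v))"
proof -
  have c: "M *\<^sub>v v \<in> carrier_vec n" using assms by (intro carrier_vecI) auto
  have "(adj M * A * M) *\<^sub>v v = adj M *\<^sub>v (A *\<^sub>v (M *\<^sub>v v))"
    using assms by (simp add: mat_vec_assoc)
  moreover have "cinner (adj (adj M) *\<^sub>v v) (A *\<^sub>v (M *\<^sub>v v)) = cinner v (adj M *\<^sub>v (A *\<^sub>v (M *\<^sub>v v)))"
    using assms c by (intro cinner_adj[of _ m n]) auto
  ultimately show ?thesis by simp
qed

lemma psd_congruence:
  assumes "psd n A" "M \<in> carrier_mat n m"
  shows "psd m (adj M * A * M)"
proof (rule psdI)
  show "hermitian m (adj M * A * M)" by (rule hermitian_congruence[OF psdD(1)[OF assms(1)] assms(2)])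
  show "0 \<le> Re (cinner v ((adj M * A * M) *\<^sub>v v))" if "v \<in> carrier_vec m" for v
    unfolding cinner_congruence[OF psdD(2)[OF assms(1)] assms(2) that]
    using assms that by (intro psdD(6)[OF assms(1)] carrier_vecI) auto
qed

lemma psd_congruence': "psd n A \<Longrightarrow> M \<in> carrier_mat m n \<Longrightarrow> psd m (M * A * adj M)"
  using psd_congruence[of n A "adj M" m] by simp

lemma psd_unitary_iff:
  assumes "unitary n U" "B \<in> carrier_mat n n"
  shows "psd n (U * B * adj U) \<longleftrightarrow> psd n B" "psd n (adj U * B * U) \<longleftrightarrow> psd n B"
  using psd_congruence[of n _ U n] psd_congruence'[of n _ U n]
    unitary_conj_inv[OF assms] unitaryD(1)[OF assms(1)] by metis+

lemma cinner_rdiag: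
  assumes "v \<in> carrier_vec n"
  shows "Re (cinner v (rdiag n d *\<^sub>v v)) = (\<Sum>i<n. d i * (cmod (v $ i))\<^sup>2)"
proof -
  have "cinner v (rdiag n d *\<^sub>v v) = (\<Sum>i<n. \<Sum>j<n. cnj (v $ i) * rdiag n d $$ (i,j) * v $ j)"
    using assms by (intro cinner_mat) auto
  also have "\<dots> = (\<Sum>i<n. \<Sum>j<n. if j = i then cnj (v $ i) * d i * v $ i else 0)"
    by (intro sum.cong refl) auto
  also have "\<dots> = (\<Sum>i<n. complex_of_real (d i * (cmod (v $ i))\<^sup>2))"
    by (intro sum.cong refl) (simp add: complex_norm_square mult_ac del: of_real_power)
  also have "\<dots> = complex_of_real (\<Sum>i<n. d i * (cmod (v $ i))\<^sup>2)" by simp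
  finally show ?thesis by (metis Re_complex_of_real)
qed

lemma hermitian_rdiag: "hermitian n (rdiag n d)"
  by (simp add: hermitian_def)

lemma cinner_unit_vec:
  assumes "A \<in> carrier_mat n n" "i < n"
  shows "cinner (unit_vec n i) (A *\<^sub>v unit_vec n i) = A $$ (i,i)"
proof -
  have "cinner (unit_vec n i) (A *\<^sub>v unit_vec n i) =
    (\<Sum>k<n. \<Sum>l<n. cnj (unit_vec n i $ k) * A $$ (k,l) * unit_vec n i $ l)"
    using assms by (intro cinner_mat) auto
  also have "\<dots> = (\<Sum>k<n. \<Sum>l<n. if l = i then (if k = i then A $$ (i,i) else 0) else 0)"
    using assms by (intro sum.cong refl) auto
  also have "\<dots> = A $$ (i,i)" using assms by simp
  finally show ?thesis .
qed

lemma psd_diag: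
  assumes "psd n A" "i < n"
  shows "0 \<le> Re (A $$ (i,i))" "A $$ (i,i) = complex_of_real (Re (A $$ (i,i)))"
proof -
  show "0 \<le> Re (A $$ (i,i))"
    using psdD(6)[OF assms(1), of "unit_vec n i"] cinner_unit_vec[OF psdD(2)[OF assms(1)] assms(2)] by simp
  show "A $$ (i,i) = complex_of_real (Re (A $$ (i,i)))"
    using hermitian_index[OF psdD(1)[OF assms(1)] assms(2) assms(2)] by (simp add: complex_eq_iff)
qed

lemma psd_rdiag: "psd n (rdiag n d) \<longleftrightarrow> (\<forall>i<n. 0 \<le> d i)"
proof
  assume "psd n (rdiag n d)" from psd_diag(1)[OF this] show "\<forall>i<n. 0 \<le> d i" by simp
next
  assume "\<forall>i<n. 0 \<le> d i"
  then show "psd n (rdiag n d)"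
    by (intro psdI hermitian_rdiag) (auto simp: cinner_rdiag intro!: sum_nonneg mult_nonneg_nonneg)
qed

lemma psd_specdec: "specdec n A U d \<Longrightarrow> psd n A \<longleftrightarrow> (\<forall>i<n. 0 \<le> d i)"
  using specdecD(1,2)[of n A U d] by (metis diag_of_carrier psd_rdiag psd_unitary_iff(1))

lemma psd_obtain: "psd n A \<Longrightarrow> \<exists>U d. specdec n A U d \<and> (\<forall>i<n. 0 \<le> d i)"
  using hermitian_specdec[OF psdD(1)] psd_specdec by blast

lemma hermitian_add: "hermitian n A \<Longrightarrow> hermitian n B \<Longrightarrow> hermitian n (A + B)"
  by (auto simp: hermitian_def adj_add)

lemma hermitian_minus: "hermitian n A \<Longrightarrow> hermitian n B \<Longrightarrow> hermitian n (A - B)"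
  by (auto simp: hermitian_def adj_minus)

lemma hermitian_smult: "hermitian n A \<Longrightarrow> hermitian n (complex_of_real c \<cdot>\<^sub>m A)"
  by (auto simp: hermitian_def adj_smult)

lemma cinner_add_right: "dim_vec w = dim_vec v \<Longrightarrow> dim_vec u = dim_vec v \<Longrightarrow> cinner v (w + u) = cinner v w + cinner v u"
  by (simp add: cinner_def sum.distrib algebra_simps)

lemma cinner_minus_right: "dim_vec w = dim_vec v \<Longrightarrow> dim_vec u = dim_vec v \<Longrightarrow> cinner v (w - u) = cinner v w - cinner v u"
  by (simp add: cinner_def sum_subtractf algebra_simps)

lemma cinner_smult_right: "dim_vec w = dim_vec v \<Longrightarrow> cinner v (c \<cdot>\<^sub>v w) = c * cinner v w"
  by (simp add: cinner_def sum_distrib_left mult_ac)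

lemma cinner_mat_add:
  assumes "A \<in> carrier_mat n n" "B \<in> carrier_mat n n" "v \<in> carrier_vec n"
  shows "cinner v ((A + B) *\<^sub>v v) = cinner v (A *\<^sub>v v) + cinner v (B *\<^sub>v v)"
  using assms by (simp add: add_mult_distrib_mat_vec cinner_add_right)

lemma cinner_mat_minus:
  assumes "A \<in> carrier_mat n n" "B \<in> carrier_mat n n" "v \<in> carrier_vec n"
  shows "cinner v ((A - B) *\<^sub>v v) = cinner v (A *\<^sub>v v) - cinner v (B *\<^sub>v v)"
  using assms by (simp add: minus_mult_distrib_mat_vec cinner_minus_right)

lemma cinner_mat_smult:
  assumes "A \<in> carrier_mat n n" "v \<in> carrier_vec n"
  shows "cinner v ((c \<cdot>\<^sub>m A) *\<^sub>v v) = c * cinner v (A *\<^sub>v v)"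
proof -
  have "(c \<cdot>\<^sub>m A) *\<^sub>v v = c \<cdot>\<^sub>v (A *\<^sub>v v)" using assms by (intro eq_vecI) auto
  then show ?thesis using assms by (simp add: cinner_smult_right)
qed

lemma psd_add: "psd n A \<Longrightarrow> psd n B \<Longrightarrow> psd n (A + B)"
  by (intro psdI hermitian_add) (auto simp: psdD cinner_mat_add[OF psdD(2) psdD(2)])

lemma psd_smult: "psd n A \<Longrightarrow> 0 \<le> c \<Longrightarrow> psd n (complex_of_real c \<cdot>\<^sub>m A)"
  by (intro psdI hermitian_smult) (auto simp: psdD cinner_mat_smult[OF psdD(2)])

lemma psd_one: "psd n (1\<^sub>m n)"
  using psd_rdiag[of n "\<lambda>_. 1"] by (simp add: diag_of_one)

text \<open>By cyclicity only the diagonal of \<open>B\<close> in an eigenbasis of \<open>A\<close>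
  enters. Positivity of traces of products and the weights of spectral tests are both read off from
  this formula.\<close>

lemma mtrace_specdec_mult:
  assumes "specdec n A U d" "B \<in> carrier_mat n n"
  shows "mtrace (A * B) = (\<Sum>i<n. d i * (adj U * B * U) $$ (i,i))"
proof -
  note AD = specdecD[OF assms(1)]
  have "A * B = U * (rdiag n d * (adj U * B))"
    using AD(7,8) assms(2) by (simp add: AD(2) mat_assoc)
  also have "mtrace \<dots> = mtrace ((rdiag n d * (adj U * B)) * U)"
    using AD(7,8) assms(2) by (intro mtrace_comm[of _ n n]) auto
  also have "(rdiag n d * (adj U * B)) * U = rdiag n d * (adj U * B * U)"
    using AD(7,8) assms(2) by (simp add: mat_assoc)
  also have "mtrace \<dots> = (\<Sum>i<n. (rdiag n d * (adj U * B * U)) $$ (i,i))"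
    by (rule mtrace_carrier[of _ n n]) (use AD(7,8) assms(2) in auto)
  also have "\<dots> = (\<Sum>i<n. d i * (adj U * B * U) $$ (i,i))"
  proof (intro sum.cong refl)
    fix i assume "i \<in> {..<n}"
    then show "(rdiag n d * (adj U * B * U)) $$ (i,i) = d i * (adj U * B * U) $$ (i,i)"
      by (intro diag_of_mult_index[of _ n n]) (use AD(7,8) in auto)
  qed
  finally show ?thesis .
qed

lemma mtrace_specdec: "specdec n A U d \<Longrightarrow> mtrace A = complex_of_real (\<Sum>i<n. d i)"
  using mtrace_cong_unitary[of n U "rdiag n d"] specdecD(1,2)[of n A U d] by simp

lemma psd_mtrace_mult:
  assumes "psd n A" "psd n B"
  shows "0 \<le> Re (mtrace (A * B))"
proof -
  obtain U d where U: "specdec n A U d" "\<forall>i<n. 0 \<le> d i" using psd_obtain[OF assms(1)] by blast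
  have "psd n (adj U * B * U)" using psd_congruence[OF assms(2) specdecD(4)[OF U(1)]] .
  then show ?thesis
    unfolding mtrace_specdec_mult[OF U(1) psdD(2)[OF assms(2)]]
    using U(2) by (auto intro!: sum_nonneg mult_nonneg_nonneg simp: psd_diag(1))
qed

lemma psd_mtrace: "psd n A \<Longrightarrow> 0 \<le> Re (mtrace A)" "psd n A \<Longrightarrow> mtrace A = complex_of_real (Re (mtrace A))"
  by (auto simp: mtrace_carrier[OF psdD(2)] psd_diag(1) intro!: sum_nonneg)
    (metis (mono_tags, lifting) psd_diag(2) lessThan_iff of_real_sum sum.cong)

lemma mtrace_mult_minus:
  assumes "A \<in> carrier_mat n n" "B \<in> carrier_mat n n" "C \<in> carrier_mat n n"
  shows "mtrace (C * (A - B)) = mtrace (C * A) - mtrace (C * B)"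
  using assms by (simp add: mult_minus_distrib_mat[of C n n A n B] mtrace_minus[of _ n])

lemma mtrace_mult_add:
  assumes "A \<in> carrier_mat n n" "B \<in> carrier_mat n n" "C \<in> carrier_mat n n"
  shows "mtrace (C * (A + B)) = mtrace (C * A) + mtrace (C * B)"
  using assms by (simp add: mult_add_distrib_mat[of C n n A n B] mtrace_add[of _ n])

lemma mtrace_mult_smult:
  assumes "A \<in> carrier_mat n n" "C \<in> carrier_mat n n"
  shows "mtrace (C * (c \<cdot>\<^sub>m A)) = c * mtrace (C * A)"
  using assms by (simp add: mult_smult_distrib[of C n n A n] mtrace_smult[of _ n])

lemma psd_mtrace_mono:
  assumes "psd n C" "psd n (B - A)" "A \<in> carrier_mat n n" "B \<in> carrier_mat n n"
  shows "Re (mtrace (C * A)) \<le> Re (mtrace (C * B))"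
  using psd_mtrace_mult[OF assms(1,2)] mtrace_mult_minus[OF assms(4,3) psdD(2)[OF assms(1)]] by simp

section \<open>Tensor products\<close>

lemma sum_div_mod:
  fixes f :: "nat \<Rightarrow> nat \<Rightarrow> 'a::comm_monoid_add"
  shows "(\<Sum>i<n*m. f (i div m) (i mod m)) = (\<Sum>a<n. \<Sum>b<m. f a b)"
proof -
  have "(\<Sum>a<n. \<Sum>b<m. f a b) = (\<Sum>(a,b)\<in>{..<n}\<times>{..<m}. f a b)"
    by (simp add: sum.cartesian_product)
  also have "\<dots> = (\<Sum>i<n*m. f (i div m) (i mod m))"
  proof (rule sum.reindex_bij_witness[of _ "\<lambda>i. (i div m, i mod m)" "\<lambda>(a,b). a * m + b"])
    fix p assume p: "p \<in> {..<n}\<times>{..<m}"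
    then have "fst p * m + snd p < Suc (fst p) * m" by auto
    also have "\<dots> \<le> n * m" using p by (intro mult_le_mono1) auto
    finally show "(case p of (a,b) \<Rightarrow> a * m + b) \<in> {..<n*m}" by (simp add: case_prod_beta)
  qed (auto simp: less_mult_imp_div_less intro!: mod_less_divisor Nat.gr0I)
  finally show ?thesis by simp
qed

lemma kron_dim [simp]: "dim_row (kron A B) = dim_row A * dim_row B" "dim_col (kron A B) = dim_col A * dim_col B"
  by (auto simp: kron_def)

lemma kron_carrier: "A \<in> carrier_mat n m \<Longrightarrow> B \<in> carrier_mat k l \<Longrightarrow> kron A B \<in> carrier_mat (n*k) (m*l)"
  by (rule carrier_matI) auto

lemma kron_index [simp]:
  "i < dim_row A * dim_row B \<Longrightarrow> j < dim_col A * dim_col B \<Longrightarrow>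
    kron A B $$ (i,j) = A $$ (i div dim_row B, j div dim_col B) * B $$ (i mod dim_row B, j mod dim_col B)"
  by (simp add: kron_def)

lemma div_mod_less:
  "i < n * m \<Longrightarrow> i div m < (n::nat)" "i < n * m \<Longrightarrow> i mod m < m"
  by (auto simp: less_mult_imp_div_less intro!: mod_less_divisor Nat.gr0I)

lemma kron_mult:
  assumes "dim_col A = dim_row C" "dim_col B = dim_row D"
  shows "kron A B * kron C D = kron (A * C) (B * D)"
proof (rule eq_matI)
  fix i j assume "i < dim_row (kron (A * C) (B * D))" "j < dim_col (kron (A * C) (B * D))"
  then have i: "i < dim_row A * dim_row B" and j: "j < dim_col C * dim_col D" by auto
  note im = div_mod_less[OF i] and jm = div_mod_less[OF j]
  have "(kron A B * kron C D) $$ (i,j) =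
    (\<Sum>l<dim_row C * dim_row D. (A $$ (i div dim_row B, l div dim_row D) * C $$ (l div dim_row D, j div dim_col D))
      * (B $$ (i mod dim_row B, l mod dim_row D) * D $$ (l mod dim_row D, j mod dim_col D)))"
    using i j assms by (simp add: scalar_prod_def atLeast0LessThan mult_ac)
  also have "\<dots> = (\<Sum>a<dim_row C. \<Sum>b<dim_row D. (A $$ (i div dim_row B, a) * C $$ (a, j div dim_col D))
      * (B $$ (i mod dim_row B, b) * D $$ (b, j mod dim_col D)))"
    by (rule sum_div_mod)
  also have "\<dots> = kron (A * C) (B * D) $$ (i,j)"
    using i j im jm assms
    by (simp add: scalar_prod_def atLeast0LessThan sum_distrib_left sum_distrib_right)
      (rule sum.swap)
  finally show "(kron A B * kron C D) $$ (i,j) = kron (A * C) (B * D) $$ (i,j)" .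
qed auto

lemma adj_kron: "adj (kron A B) = kron (adj A) (adj B)"
  by (rule eq_matI) (auto simp: div_mod_less)

lemma kron_diag_of: "kron (diag_of n a) (diag_of m b) = diag_of (n*m) (\<lambda>i. a (i div m) * b (i mod m))"
  by (rule eq_matI) (auto simp: div_mod_less, metis div_mult_mod_eq)

lemma kron_one: "kron (1\<^sub>m n) (1\<^sub>m m) = 1\<^sub>m (n*m)"
  using kron_diag_of[of n "\<lambda>_. 1" m "\<lambda>_. 1"] by (simp add: diag_of_one)

lemma unitary_kron:
  assumes "unitary n U" "unitary m V" shows "unitary (n*m) (kron U V)"
  using unitaryD[OF assms(1)] unitaryD[OF assms(2)]
  by (simp add: unitary_def adj_kron kron_mult kron_one kron_carrier)

lemma specdec_kron:
  assumes "specdec n A U d" "specdec m B V e"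
  shows "specdec (n*m) (kron A B) (kron U V) (\<lambda>i. d (i div m) * e (i mod m))"
proof -
  note A = specdecD[OF assms(1)] and B = specdecD[OF assms(2)]
  have "kron A B = kron U V * kron (rdiag n d) (rdiag m e) * adj (kron U V)"
    using A(7,8) B(7,8) by (simp add: A(2) B(2) adj_kron kron_mult)
  then show ?thesis using unitary_kron[OF A(1) B(1)] by (simp add: specdec_def kron_diag_of)
qed

lemma mtrace_kron:
  assumes "A \<in> carrier_mat n n" "B \<in> carrier_mat m m"
  shows "mtrace (kron A B) = mtrace A * mtrace B"
proof -
  have "mtrace (kron A B) = (\<Sum>i<n*m. A $$ (i div m, i div m) * B $$ (i mod m, i mod m))"
    using assms by (simp add: mtrace_def)
  also have "\<dots> = (\<Sum>a<n. \<Sum>b<m. A $$ (a,a) * B $$ (b,b))"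
    by (rule sum_div_mod)
  finally show ?thesis using assms by (simp add: mtrace_def sum_product)
qed

lemma kron_assoc: "kron (kron A B) C = kron A (kron B C)"
proof (rule eq_matI)
  fix i j assume "i < dim_row (kron A (kron B C))" "j < dim_col (kron A (kron B C))"
  then have i: "i < dim_row A * dim_row B * dim_row C" and j: "j < dim_col A * dim_col B * dim_col C"
    by (auto simp: mult.assoc)
  have aux: "k div (b * c) = k div c div b" "(k mod (b * c)) div c = k div c mod b" "(k mod (b * c)) mod c = k mod c"
    if "k < a * b * c" for k a b c :: nat
  proof -
    have c: "c > 0" using that by (intro Nat.gr0I) auto
    show "k div (b * c) = k div c div b" by (metis div_mult2_eq mult.commute)
    have "k mod (b * c) = c * (k div c mod b) + k mod c" by (metis mod_mult2_eq mult.commute)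
    then show "(k mod (b * c)) div c = k div c mod b" "(k mod (b * c)) mod c = k mod c" using c by simp_all
  qed
  have b: "i mod (dim_row B * dim_row C) < dim_row B * dim_row C" "j mod (dim_col B * dim_col C) < dim_col B * dim_col C"
    using i j div_mod_less(2)[of i "dim_row A" "dim_row B * dim_row C"]
      div_mod_less(2)[of j "dim_col A" "dim_col B * dim_col C"] by (auto simp: mult.assoc)
  show "kron (kron A B) C $$ (i,j) = kron A (kron B C) $$ (i,j)"
    using i j b div_mod_less[OF i] div_mod_less[OF j] aux[OF i] aux[OF j] by (simp add: mult.assoc)
qed (auto simp: mult.assoc)

lemma kron_one_left: "kron (1\<^sub>m 1) A = A"
proof (rule eq_matI)
  fix i j assume "i < dim_row A" "j < dim_col A"
  then show "kron (1\<^sub>m 1) A $$ (i,j) = A $$ (i,j)" by simp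
qed auto

lemma kron_minus_left:
  assumes "A \<in> carrier_mat n n" "B \<in> carrier_mat n n"
  shows "kron (A - B) C = kron A C - kron B C"
  by (rule eq_matI) (use assms in \<open>auto simp: div_mod_less algebra_simps\<close>)

lemma kron_minus_right:
  assumes "A \<in> carrier_mat n n" "B \<in> carrier_mat n n"
  shows "kron C (A - B) = kron C A - kron C B"
  by (rule eq_matI) (use assms in \<open>auto simp: div_mod_less algebra_simps\<close>)

lemma kron_smult: "kron (a \<cdot>\<^sub>m A) (b \<cdot>\<^sub>m B) = (a * b) \<cdot>\<^sub>m kron A B"
  by (rule eq_matI) (auto simp: div_mod_less)

lemma psd_kron:
  assumes "psd n A" "psd m B" shows "psd (n*m) (kron A B)"
proof -
  obtain U d where U: "specdec n A U d" "\<forall>i<n. 0 \<le> d i" using psd_obtain[OF assms(1)] by blast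
  obtain V e where V: "specdec m B V e" "\<forall>i<m. 0 \<le> e i" using psd_obtain[OF assms(2)] by blast
  show ?thesis using psd_specdec[OF specdec_kron[OF U(1) V(1)]] U(2) V(2) by (auto simp: div_mod_less)
qed

text \<open>Telescoping into \<open>kron (B - A) D + kron A (D - C)\<close> shows which of the four
  matrices have to be positive.\<close>

lemma psd_kron_mono:
  assumes "psd n A" "psd m D" "psd n (B - A)" "psd m (D - C)" "B \<in> carrier_mat n n" "C \<in> carrier_mat m m"
  shows "psd (n*m) (kron B D - kron A C)"
proof -
  have "kron B D - kron A C = kron (B - A) D + kron A (D - C)"
    unfolding kron_minus_left[OF assms(5) psdD(2)[OF assms(1)]] kron_minus_right[OF psdD(2)[OF assms(2)] assms(6)]
    using psdD(3,4)[OF assms(1)] psdD(3,4)[OF assms(2)] assms(5,6) by (intro eq_matI) auto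
  then show ?thesis using psd_add[OF psd_kron[OF assms(3,2)] psd_kron[OF assms(1,4)]] by simp
qed

lemma mpow_psd: "psd n A \<Longrightarrow> psd n (mpow a A)"
  using psd_obtain[of n A] psd_specdec[OF specdec_mpow] by fastforce

lemma mpow_kron:
  assumes "psd n A" "psd m B" shows "mpow a (kron A B) = kron (mpow a A) (mpow a B)"
proof -
  obtain U d where U: "specdec n A U d" "\<forall>i<n. 0 \<le> d i" using psd_obtain[OF assms(1)] by blast
  obtain V e where V: "specdec m B V e" "\<forall>i<m. 0 \<le> e i" using psd_obtain[OF assms(2)] by blast
  have "specdec (n*m) (mpow a (kron A B)) (kron U V) (\<lambda>i. (d (i div m) * e (i mod m)) powr a)"
    by (rule specdec_mpow[OF specdec_kron[OF U(1) V(1)]])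
  then have "specdec (n*m) (mpow a (kron A B)) (kron U V) (\<lambda>i. d (i div m) powr a * e (i mod m) powr a)"
    by (rule specdec_cong) (auto simp: powr_mult U V div_mod_less)
  then show ?thesis
    using specdec_kron[OF specdec_mpow[OF U(1), of a] specdec_mpow[OF V(1), of a]] by (simp add: specdec_def)
qed

lemma psd_mtrace_mult_real:
  assumes "psd n A" "psd n B"
  shows "mtrace (A * B) = complex_of_real (Re (mtrace (A * B)))"
proof -
  obtain U d where U: "specdec n A U d" using psd_obtain[OF assms(1)] by blast
  have "psd n (adj U * B * U)" using psd_congruence[OF assms(2) specdecD(4)[OF U(1)]] .
  then have "mtrace (A * B) = (\<Sum>i<n. complex_of_real (d i * Re ((adj U * B * U) $$ (i,i))))"
    unfolding mtrace_specdec_mult[OF U psdD(2)[OF assms(2)]]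
    using psd_diag(2) by (intro sum.cong) (auto simp: mult.commute)
  also have "\<dots> = complex_of_real (\<Sum>i<n. d i * Re ((adj U * B * U) $$ (i,i)))" by simp
  finally show ?thesis by (metis Re_complex_of_real)
qed

section \<open>Tensor powers and their spectra\<close>

lemma tpow_dim [simp]: "dim_row (tpow n A) = dim_row A ^ n" "dim_col (tpow n A) = dim_col A ^ n"
  by (induction n) auto

lemma tpow_carrier: "A \<in> carrier_mat d d \<Longrightarrow> tpow n A \<in> carrier_mat (d^n) (d^n)"
  by (rule carrier_matI) auto

lemma tpow_add: "tpow (m + n) A = kron (tpow m A) (tpow n A)"
  by (induction m) (auto simp: kron_one_left[simplified] kron_assoc)

lemma psd_tpow: "psd d A \<Longrightarrow> psd (d^n) (tpow n A)"
  by (induction n) (auto simp: psd_kron psd_one)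

lemma mtrace_tpow: "A \<in> carrier_mat d d \<Longrightarrow> mtrace (tpow n A) = mtrace A ^ n"
proof (induction n)
  case 0
  show ?case by (simp add: mtrace_def)
next
  case (Suc n)
  then show ?case by (simp add: mtrace_kron[OF _ tpow_carrier])
qed

lemma density_tpow: "density d A \<Longrightarrow> density (d^n) (tpow n A)"
  by (auto simp: density_def psd_tpow mtrace_tpow[OF psdD(2)])

lemma mpow_tpow: "psd d A \<Longrightarrow> mpow a (tpow n A) = tpow n (mpow a A)"
proof (induction n)
  case 0
  have "specdec 1 (1\<^sub>m 1) (1\<^sub>m 1) (\<lambda>_. 1)" by (simp add: specdec_def unitary_one diag_of_one)
  from specdec_mpow[OF this, of a] show ?case by (simp add: specdec_def diag_of_one)
next
  case (Suc n)
  then show ?case by (simp add: mpow_kron[OF _ psd_tpow])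
qed

text \<open>Every eigenvalue of the power is a monomial in the \<open>d\<close> eigenvalues of
  \<open>A\<close> with exponents at most \<open>n\<close>; counting exponent vectors gives the
  bound, polynomial in \<open>n\<close> although the dimension is exponential.\<close>

lemma specdec_tpow:
  assumes "specdec d A U \<delta>"
  shows "\<exists>V \<epsilon>. specdec (d^n) (tpow n A) V \<epsilon> \<and> card (\<epsilon> ` {..<d^n}) \<le> (n+1)^d"
proof -
  have "\<exists>V \<epsilon>. specdec (d^n) (tpow n A) V \<epsilon> \<and>
    (\<forall>i<d^n. \<exists>k. (\<forall>e<d. k e \<le> n) \<and> \<epsilon> i = (\<Prod>e<d. \<delta> e ^ k e))" for n
  proof (induction n)
    case 0
    have "specdec 1 (1\<^sub>m 1) (1\<^sub>m 1) (\<lambda>_. 1)" by (simp add: specdec_def unitary_one diag_of_one)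
    then show ?case by (intro exI[of _ "1\<^sub>m 1"] exI[of _ "\<lambda>_. 1"]) (auto intro!: exI[of _ "\<lambda>_. 0"])
  next
    case (Suc n)
    then obtain V \<epsilon> where V: "specdec (d^n) (tpow n A) V \<epsilon>"
      and \<epsilon>: "\<And>i. i < d^n \<Longrightarrow> \<exists>k. (\<forall>e<d. k e \<le> n) \<and> \<epsilon> i = (\<Prod>e<d. \<delta> e ^ k e)" by blast
    have "\<exists>k. (\<forall>e<d. k e \<le> Suc n) \<and> \<delta> (i div d^n) * \<epsilon> (i mod d^n) = (\<Prod>e<d. \<delta> e ^ k e)"
      if i: "i < d * d^n" for i
    proof -
      note im = div_mod_less[OF i]
      obtain k where k: "\<forall>e<d. k e \<le> n" "\<epsilon> (i mod d^n) = (\<Prod>e<d. \<delta> e ^ k e)" using \<epsilon>[OF im(2)] by blast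
      \<comment> \<open>The leading tensor factor contributes the eigenvalue with index
        \<open>i div d^n\<close>, whose exponent goes up by one.\<close>
      define k' where "k' e = k e + (if e = i div d^n then 1 else 0)" for e
      have "(\<Prod>e<d. \<delta> e ^ k' e) = (\<Prod>e<d. \<delta> e ^ k e * (if e = i div d^n then \<delta> e else 1))"
        by (intro prod.cong) (auto simp: k'_def)
      also have "\<dots> = (\<Prod>e<d. \<delta> e ^ k e) * \<delta> (i div d^n)"
        using im by (simp add: prod.distrib)
      finally show ?thesis using k by (intro exI[of _ k']) (auto simp: k'_def mult.commute)
    qed
    then show ?case using specdec_kron[OF assms V] by auto
  qed
  then obtain V \<epsilon> where V: "specdec (d^n) (tpow n A) V \<epsilon>"
    and \<epsilon>: "\<And>i. i < d^n \<Longrightarrow> \<exists>k. (\<forall>e<d. k e \<le> n) \<and> \<epsilon> i = (\<Prod>e<d. \<delta> e ^ k e)" by blast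
  have "\<epsilon> ` {..<d^n} \<subseteq> (\<lambda>k. \<Prod>e<d. \<delta> e ^ k e) ` (PiE {..<d} (\<lambda>_. {..n}))"
  proof
    fix x assume "x \<in> \<epsilon> ` {..<d^n}"
    then obtain k where k: "\<forall>e<d. k e \<le> n" "x = (\<Prod>e<d. \<delta> e ^ k e)" using \<epsilon> by blast
    have "x = (\<Prod>e<d. \<delta> e ^ restrict k {..<d} e)" using k by (auto intro!: prod.cong)
    then show "x \<in> (\<lambda>k. \<Prod>e<d. \<delta> e ^ k e) ` (PiE {..<d} (\<lambda>_. {..n}))"
      using k by (intro image_eqI[of _ _ "restrict k {..<d}"]) auto
  qed
  moreover have "finite (PiE {..<d} (\<lambda>_. {..n}))" by (intro finite_PiE) auto
  ultimately have "card (\<epsilon> ` {..<d^n}) \<le> card (PiE {..<d} (\<lambda>_. {..n}))"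
    by (rule surj_card_le[rotated])
  also have "\<dots> = (n+1)^d" by (simp add: card_PiE)
  finally show ?thesis using V by blast
qed

text \<open>The trace under the logarithm of \<open>sandwiched\<close>. Without the logarithm it is
  multiplicative under tensor products and accessible to operator inequalities.\<close>

definition sandQ :: "real \<Rightarrow> complex mat \<Rightarrow> complex mat \<Rightarrow> real" where
  "sandQ \<beta> \<rho> \<sigma> = Re (mtrace (mpow \<beta> (mpow ((1 - \<beta>) / (2 * \<beta>)) \<sigma> * \<rho> * mpow ((1 - \<beta>) / (2 * \<beta>)) \<sigma>)))"

lemma psd_sandwich:
  assumes "psd n \<rho>" "psd n \<sigma>" shows "psd n (mpow a \<sigma> * \<rho> * mpow a \<sigma>)"
  using psd_congruence[OF assms(1) psdD(2)[OF mpow_psd[OF assms(2), of a]]] psdD(5)[OF mpow_psd[OF assms(2), of a]]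
  by simp

lemma sandQ_kron:
  assumes "psd n \<rho>" "psd n \<sigma>" "psd m \<rho>'" "psd m \<sigma>'"
  shows "sandQ \<beta> (kron \<rho> \<rho>') (kron \<sigma> \<sigma>') = sandQ \<beta> \<rho> \<sigma> * sandQ \<beta> \<rho>' \<sigma>'"
proof -
  define a where "a = (1 - \<beta>) / (2 * \<beta>)"
  have d: "dim_row (mpow a \<sigma>) = n" "dim_col (mpow a \<sigma>) = n" "dim_row (mpow a \<sigma>') = m" "dim_col (mpow a \<sigma>') = m"
    "dim_row \<rho> = n" "dim_col \<rho> = n" "dim_row \<rho>' = m" "dim_col \<rho>' = m"
    using assms mpow_psd psdD(3,4) by blast+
  let ?X = "mpow a \<sigma> * \<rho> * mpow a \<sigma>" and ?Y = "mpow a \<sigma>' * \<rho>' * mpow a \<sigma>'"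
  have X: "psd n ?X" and Y: "psd m ?Y" using assms psd_sandwich by blast+
  have "mpow a (kron \<sigma> \<sigma>') * kron \<rho> \<rho>' * mpow a (kron \<sigma> \<sigma>') = kron ?X ?Y"
    using d by (simp add: mpow_kron[OF assms(2,4)] kron_mult)
  moreover have "mtrace (mpow \<beta> (kron ?X ?Y)) = mtrace (mpow \<beta> ?X) * mtrace (mpow \<beta> ?Y)"
    unfolding mpow_kron[OF X Y] by (intro mtrace_kron[of _ n _ m] psdD(2) mpow_psd X Y)
  \<comment> \<open>One real factor suffices for the real part of the product to be the product of
    the real parts.\<close>
  moreover have "Im (mtrace (mpow \<beta> ?X)) = 0"
    by (metis psd_mtrace(2) mpow_psd X Im_complex_of_real)
  ultimately show ?thesis unfolding sandQ_def a_def by simp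
qed

lemma sandQ_tpow:
  assumes "psd d \<rho>" "psd d \<sigma>"
  shows "sandQ \<beta> (tpow n \<rho>) (tpow n \<sigma>) = sandQ \<beta> \<rho> \<sigma> ^ n"
proof (induction n)
  case 0
  have "specdec 1 (1\<^sub>m 1) (1\<^sub>m 1) (\<lambda>_. 1)" by (simp add: specdec_def unitary_one diag_of_one)
  from specdec_mpow[OF this] have "mpow a (1\<^sub>m 1) = 1\<^sub>m 1" for a by (simp add: specdec_def diag_of_one)
  then show ?case by (simp add: sandQ_def mtrace_def)
next
  case (Suc n)
  then show ?case using sandQ_kron[OF assms psd_tpow[OF assms(1)] psd_tpow[OF assms(2)]] by simp
qed

lemma mtrace_mult_tpow:
  assumes "psd d A" "psd d B"
  shows "mtrace (tpow n A * tpow n B) = mtrace (A * B) ^ n"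
proof (induction n)
  case (Suc n)
  note d = psdD(3,4)[OF assms(1)] psdD(3,4)[OF assms(2)]
  have "mtrace (tpow (Suc n) A * tpow (Suc n) B) = mtrace (kron (A * B) (tpow n A * tpow n B))"
    using d by (simp add: kron_mult)
  also have "\<dots> = mtrace (A * B) * mtrace (tpow n A * tpow n B)"
    using d by (intro mtrace_kron[of _ d _ "d^n"]) auto
  finally show ?case using Suc by simp
qed (simp add: mtrace_def)

lemma pure_state_kron:
  assumes "pure_state n A" "pure_state m B"
  shows "pure_state (n*m) (kron A B)"
proof -
  obtain a where a: "a \<in> carrier_vec n" "cinner a a = 1" "A = mat n n (\<lambda>(i,j). a $ i * cnj (a $ j))"
    using assms by (auto simp: pure_state_def)
  obtain b where b: "b \<in> carrier_vec m" "cinner b b = 1" "B = mat m m (\<lambda>(i,j). b $ i * cnj (b $ j))"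
    using assms by (auto simp: pure_state_def)
  define c where "c = vec (n*m) (\<lambda>i. a $ (i div m) * b $ (i mod m))"
  have "cinner c c = (\<Sum>i<n*m. (cnj (a $ (i div m)) * a $ (i div m)) * (cnj (b $ (i mod m)) * b $ (i mod m)))"
    by (simp add: cinner_def c_def mult_ac)
  also have "\<dots> = (\<Sum>i<n. \<Sum>j<m. (cnj (a $ i) * a $ i) * (cnj (b $ j) * b $ j))"
    by (rule sum_div_mod)
  also have "\<dots> = cinner a a * cinner b b" using a(1) b(1) by (simp add: cinner_def sum_product)
  finally have "cinner c c = 1" by (simp only: a(2) b(2) mult_1)
  moreover have "kron A B = mat (n*m) (n*m) (\<lambda>(i,j). c $ i * cnj (c $ j))"
    by (rule eq_matI) (auto simp: a(3) b(3) c_def div_mod_less)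
  ultimately show ?thesis by (auto simp: pure_state_def c_def)
qed

lemma pure_state_tpow: "pure_state d A \<Longrightarrow> pure_state (d^n) (tpow n A)"
proof (induction n)
  case 0
  have "pure_state 1 (1\<^sub>m 1)" unfolding pure_state_def
    by (intro bexI[of _ "vec 1 (\<lambda>_. 1)"]) (auto simp: cinner_def intro!: eq_matI)
  then show ?case by simp
qed (auto simp: pure_state_kron)

section \<open>Pinching\<close>

lemma congruence_index:
  assumes "X \<in> carrier_mat n n" "W \<in> carrier_mat n m" "k < m" "l < m"
  shows "(adj W * X * W) $$ (k,l) = (\<Sum>i<n. cnj (W $$ (i,k)) * (\<Sum>j<n. X $$ (i,j) * W $$ (j,l)))"
proof -
  have "adj W * X * W = adj W * (X * W)" using assms by (simp add: mat_assoc)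
  also have "\<dots> $$ (k,l) = (\<Sum>i<n. adj W $$ (k,i) * (X * W) $$ (i,l))"
    by (rule mat_mult_index[of _ m n _ m]) (use assms in \<open>auto intro!: carrier_matI\<close>)
  also have "\<dots> = (\<Sum>i<n. cnj (W $$ (i,k)) * (\<Sum>j<n. X $$ (i,j) * W $$ (j,l)))"
    using assms by (intro sum.cong refl) (simp add: mat_mult_index[of X n n W m] del: index_mult_mat(1))
  finally show ?thesis .
qed

lemma specdec_index:
  assumes "specdec n A U d" "i < n" "j < n"
  shows "A $$ (i,j) = (\<Sum>k<n. U $$ (i,k) * d k * cnj (U $$ (j,k)))"
proof -
  note A = specdecD[OF assms(1)]
  have "A $$ (i,j) = (\<Sum>k<n. (U * rdiag n d) $$ (i,k) * adj U $$ (k,j))"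
    unfolding A(2) by (rule mat_mult_index[of _ n n _ n]) (use A(4) assms in auto)
  also have "\<dots> = (\<Sum>k<n. U $$ (i,k) * d k * cnj (U $$ (j,k)))"
    using A(4) assms by (intro sum.cong refl) (simp add: mult_diag_of_index[of U n n] del: index_mult_mat(1))
  finally show ?thesis .
qed

lemma cinner_specdec:
  assumes "specdec n A U d" "v \<in> carrier_vec n"
  shows "Re (cinner v (A *\<^sub>v v)) = (\<Sum>k<n. d k * (cmod (\<Sum>i<n. cnj (U $$ (i,k)) * v $ i))\<^sup>2)"
proof -
  note A = specdecD[OF assms(1)]
  have Uv: "adj U *\<^sub>v v \<in> carrier_vec n" using A by (intro carrier_vecI) auto
  have "A = adj (adj U) * rdiag n d * adj U" using A by simp
  then have "cinner v (A *\<^sub>v v) = cinner (adj U *\<^sub>v v) (rdiag n d *\<^sub>v (adj U *\<^sub>v v))"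
    using cinner_congruence[of "rdiag n d" n "adj U" n v] A assms by simp
  then have "Re (cinner v (A *\<^sub>v v)) = (\<Sum>k<n. d k * (cmod ((adj U *\<^sub>v v) $ k))\<^sup>2)"
    using cinner_rdiag[OF Uv] by simp
  also have "\<dots> = (\<Sum>k<n. d k * (cmod (\<Sum>i<n. cnj (U $$ (i,k)) * v $ i))\<^sup>2)"
    using A assms(2) by (intro sum.cong refl) (simp add: mat_vec_index[of "adj U" n n v] del: index_mult_mat_vec)
  finally show ?thesis .
qed

text \<open>A diagonal entry is a sum of eigenvalues weighted by squared moduli of row
  \<open>i\<close> of \<open>U\<close>. If it is zero, each eigenvector with a nonzero eigenvalue
  has no component at \<open>i\<close>, so the whole row and column vanish.\<close>

lemma psd_zero_diag:
  assumes "psd n R" "i < n" "j < n" "R $$ (i,i) = 0"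
  shows "R $$ (i,j) = 0" "R $$ (j,i) = 0"
proof -
  obtain U d where U: "specdec n R U d" "\<forall>i<n. 0 \<le> d i" using psd_obtain[OF assms(1)] by blast
  have "R $$ (i,i) = (\<Sum>k<n. complex_of_real (d k * (cmod (U $$ (i,k)))\<^sup>2))"
    unfolding specdec_index[OF U(1) assms(2,2)]
    by (intro sum.cong refl) (simp add: complex_norm_square mult_ac del: of_real_power)
  also have "\<dots> = complex_of_real (\<Sum>k<n. d k * (cmod (U $$ (i,k)))\<^sup>2)" by simp
  finally have "(\<Sum>k<n. d k * (cmod (U $$ (i,k)))\<^sup>2) = 0" using assms(4) by (metis of_real_eq_0_iff)
  then have z: "d k = 0 \<or> U $$ (i,k) = 0" if "k < n" for k
    using that U(2) by (subst (asm) sum_nonneg_eq_0_iff) auto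
  show "R $$ (i,j) = 0" unfolding specdec_index[OF U(1) assms(2,3)]
    by (rule sum.neutral) (use z in auto)
  then show "R $$ (j,i) = 0" using hermitian_index[OF psdD(1)[OF assms(1)] assms(2,3)] by simp
qed

text \<open>Perturbing the block diagonal part of \<open>\<rho>\<close> by a large multiple of \<open>\<sigma>\<close> separates the
  eigenspaces of \<open>\<sigma>\<close>, so that a single application of the spectral theorem diagonalises both.\<close>
lemma block_eigenbasis:
  assumes "hermitian n \<rho>" "specdec n \<sigma> V \<delta>"
  shows "\<exists>U q. specdec n \<sigma> U q \<and> q ` {..<n} \<subseteq> \<delta> ` {..<n} \<and>
    (\<forall>i<n. \<forall>j<n. i \<noteq> j \<longrightarrow> q i = q j \<longrightarrow> (adj U * \<rho> * U) $$ (i,j) = 0)"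
proof -
  note V = specdecD[OF assms(2)]
  define X where "X = adj V * \<rho> * V"
  have Xh: "hermitian n X" unfolding X_def by (rule hermitian_congruence[OF assms(1) V(4)])
  note X = hermitianD[OF Xh]
  \<comment> \<open>The block diagonal part of \<open>X\<close>: entries between different
    eigenvalues of \<open>\<sigma>\<close> are erased.\<close>
  define M where "M = mat n n (\<lambda>(i,j). if \<delta> i = \<delta> j then X $$ (i,j) else 0)"
  have Mh: "hermitian n M"
    unfolding hermitian_def
  proof (intro conjI eq_matI)
    fix i j assume "i < dim_row M" "j < dim_col M"
    then have ij: "i < n" "j < n" by (auto simp: M_def)
    show "adj M $$ (i,j) = M $$ (i,j)"
      using ij hermitian_index[OF Xh, of j i] by (simp add: M_def)
  qed (auto simp: M_def)
  \<comment> \<open>\<open>B\<close> dominates every absolute row sum of \<open>M\<close> and serves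
    as radius in the Gershgorin estimate below.\<close>
  define B where "B = (\<Sum>i<n. \<Sum>j<n. cmod (M $$ (i,j)))"
  have Brow: "(\<Sum>j<n. cmod (M $$ (i,j))) \<le> B" if "i < n" for i
    unfolding B_def by (rule member_le_sum[of i "{..<n}" "\<lambda>i. \<Sum>j<n. cmod (M $$ (i,j))"])
      (use that in \<open>auto intro: sum_nonneg\<close>)
  have B0: "B \<ge> 0" unfolding B_def by (intro sum_nonneg) auto
  \<comment> \<open>Summing over all pairs is just a way to dominate each single quotient. For
    different eigenvalues the centres \<open>c * \<delta> i\<close> are then more than
    \<open>2 * B\<close> apart, so discs of radius \<open>B\<close> around them are
    disjoint.\<close>
  define c where "c = (\<Sum>i<n. \<Sum>j<n. if \<delta> i = \<delta> j then 0 else (2 * B + 1) / \<bar>\<delta> i - \<delta> j\<bar>)"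
  have c: "c * \<bar>\<delta> i - \<delta> j\<bar> > 2 * B" if "i < n" "j < n" "\<delta> i \<noteq> \<delta> j" for i j
  proof -
    have "(2 * B + 1) / \<bar>\<delta> i - \<delta> j\<bar> \<le> (\<Sum>j<n. if \<delta> i = \<delta> j then 0 else (2 * B + 1) / \<bar>\<delta> i - \<delta> j\<bar>)"
      using member_le_sum[of j "{..<n}" "\<lambda>j. if \<delta> i = \<delta> j then 0 else (2 * B + 1) / \<bar>\<delta> i - \<delta> j\<bar>"] that B0 by simp
    also have "\<dots> \<le> c" unfolding c_def
      by (rule member_le_sum[of i "{..<n}" "\<lambda>i. \<Sum>j<n. if \<delta> i = \<delta> j then 0 else (2 * B + 1) / \<bar>\<delta> i - \<delta> j\<bar>"])
        (use that B0 in \<open>auto intro: sum_nonneg\<close>)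
    finally have "2 * B + 1 \<le> c * \<bar>\<delta> i - \<delta> j\<bar>" using that by (simp add: field_simps)
    then show ?thesis by simp
  qed
  define Y where "Y = M + rdiag n (\<lambda>i. c * \<delta> i)"
  have Yh: "hermitian n Y" unfolding Y_def by (rule hermitian_add[OF Mh hermitian_rdiag])
  obtain W e where W: "specdec n Y W e" using hermitian_specdec[OF Yh] by blast
  note WD = specdecD[OF W] and Wu = unitaryD[OF specdecD(1)[OF W]]
  have YW: "Y * W = W * rdiag n e"
    using WD(7,8) by (simp add: WD(2) mat_assoc Wu)
  have row: "(\<Sum>j<n. M $$ (i,j) * W $$ (j,k)) = (e k - c * \<delta> i) * W $$ (i,k)" if "i < n" "k < n" for i k
  proof -
    have "(Y * W) $$ (i,k) = (\<Sum>j<n. Y $$ (i,j) * W $$ (j,k))"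
      by (rule mat_mult_index[of _ n n _ n]) (use that WD in auto)
    also have "\<dots> = (\<Sum>j<n. M $$ (i,j) * W $$ (j,k) + (if j = i then c * \<delta> i * W $$ (i,k) else 0))"
      using that by (intro sum.cong refl) (auto simp: Y_def M_def algebra_simps)
    also have "\<dots> = (\<Sum>j<n. M $$ (i,j) * W $$ (j,k)) + c * \<delta> i * W $$ (i,k)"
      using that by (simp add: sum.distrib)
    finally have "(\<Sum>j<n. M $$ (i,j) * W $$ (j,k)) + c * \<delta> i * W $$ (i,k) = (W * rdiag n e) $$ (i,k)"
      using YW by simp
    also have "\<dots> = W $$ (i,k) * e k" by (rule mult_diag_of_index) (use that WD in auto)
    finally show ?thesis by (simp add: algebra_simps)
  qed
  \<comment> \<open>Gershgorin within one block: \<open>a\<close> maximises the modulus of the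
    eigenvector among the indices that share the eigenvalue \<open>\<delta> i\<close>, and
    \<open>M\<close> couples \<open>a\<close> only to these.\<close>
  have gersh: "\<bar>e k - c * \<delta> i\<bar> \<le> B" if ik: "i < n" "k < n" "W $$ (i,k) \<noteq> 0" for i k
  proof -
    define S where "S = {j. j < n \<and> \<delta> j = \<delta> i}"
    have S: "finite S" "i \<in> S" using ik by (auto simp: S_def)
    have "Max ((\<lambda>j. cmod (W $$ (j,k))) ` S) \<in> (\<lambda>j. cmod (W $$ (j,k))) ` S"
      using S by (intro Max_in) auto
    then obtain a where a: "a \<in> S" "Max ((\<lambda>j. cmod (W $$ (j,k))) ` S) = cmod (W $$ (a,k))" by auto
    have amax: "cmod (W $$ (j,k)) \<le> cmod (W $$ (a,k))" if "j \<in> S" for j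
      unfolding a(2)[symmetric] using S that by (intro Max_ge) auto
    have apos: "cmod (W $$ (a,k)) > 0" using amax[OF S(2)] ik(3) by (auto simp: less_le_trans)
    have an: "a < n" "\<delta> a = \<delta> i" using a by (auto simp: S_def)
    have "\<bar>e k - c * \<delta> i\<bar> * cmod (W $$ (a,k)) = cmod ((e k - c * \<delta> a) * W $$ (a,k))"
      unfolding an by (simp only: norm_mult norm_of_real flip: of_real_mult of_real_diff)
    also have "\<dots> = cmod (\<Sum>j<n. M $$ (a,j) * W $$ (j,k))" using row[OF an(1) ik(2)] by simp
    also have "\<dots> \<le> (\<Sum>j<n. cmod (M $$ (a,j)) * cmod (W $$ (a,k)))"
    proof (rule sum_norm_le)
      fix j assume "j \<in> {..<n}"
      then show "cmod (M $$ (a,j) * W $$ (j,k)) \<le> cmod (M $$ (a,j)) * cmod (W $$ (a,k))"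
        using amax[of j] an by (cases "\<delta> j = \<delta> a") (auto simp: norm_mult S_def M_def intro!: mult_left_mono)
    qed
    also have "\<dots> = (\<Sum>j<n. cmod (M $$ (a,j))) * cmod (W $$ (a,k))" by (simp add: sum_distrib_right)
    also have "\<dots> \<le> B * cmod (W $$ (a,k))" using Brow[OF an(1)] by (intro mult_right_mono) auto
    finally show ?thesis using apos by simp
  qed
  have same: "\<delta> i = \<delta> j" if "i < n" "j < n" "k < n" "W $$ (i,k) \<noteq> 0" "W $$ (j,k) \<noteq> 0" for i j k
  proof (rule ccontr)
    assume "\<delta> i \<noteq> \<delta> j"
    from c[OF that(1,2) this] have "2 * B < c * \<bar>\<delta> i - \<delta> j\<bar>" .
    moreover have "c \<ge> 0" unfolding c_def using B0 by (intro sum_nonneg) auto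
    then have "c * \<bar>\<delta> i - \<delta> j\<bar> = \<bar>(e k - c * \<delta> i) - (e k - c * \<delta> j)\<bar>"
      by (simp add: abs_mult flip: right_diff_distrib) (metis abs_minus_commute)
    ultimately show False using gersh[of i k] gersh[of j k] that by linarith
  qed
  have ex: "\<exists>i. i < n \<and> W $$ (i,k) \<noteq> 0" if "k < n" for k
  proof (rule ccontr)
    assume "\<nexists>i. i < n \<and> W $$ (i,k) \<noteq> 0"
    then have "(\<Sum>i<n. (cmod (W $$ (i,k)))\<^sup>2) = 0" by (intro sum.neutral) auto
    then show False using unitary_cols_norm[OF WD(1) that] by simp
  qed
  \<comment> \<open>Each eigenvector of \<open>Y\<close> lives on indices with a single value of
    \<open>\<delta>\<close>; \<open>q k\<close> reads this value at some nonzero component.\<close>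
  define q where "q k = \<delta> (SOME i. i < n \<and> W $$ (i,k) \<noteq> 0)" for k
  have q1: "q k \<in> \<delta> ` {..<n}" if "k < n" for k
    using someI_ex[OF ex[OF that]] by (auto simp: q_def)
  have q2: "\<delta> i = q k" if "i < n" "k < n" "W $$ (i,k) \<noteq> 0" for i k
    using someI_ex[OF ex[OF that(2)]] same[OF that(1) _ that(2,3)] unfolding q_def by blast
  have "rdiag n \<delta> * W = W * rdiag n q"
  proof (rule eq_matI)
    fix i j assume "i < dim_row (W * rdiag n q)" "j < dim_col (W * rdiag n q)"
    then have ij: "i < n" "j < n" using WD by auto
    show "(rdiag n \<delta> * W) $$ (i,j) = (W * rdiag n q) $$ (i,j)"
      unfolding diag_of_mult_index[OF WD(4) ij] mult_diag_of_index[OF WD(4) ij]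
      using q2[OF ij] by auto
  qed (use WD in auto)
  then have "rdiag n \<delta> * W * adj W = W * rdiag n q * adj W" by simp
  then have dW: "rdiag n \<delta> = W * rdiag n q * adj W" using WD(7,8) by (simp add: mat_assoc Wu)
  define U where "U = V * W"
  have U: "specdec n \<sigma> U q"
    unfolding specdec_def U_def
  proof
    show "unitary n (V * W)" by (rule unitary_mult[OF V(1) WD(1)])
    show "\<sigma> = V * W * rdiag n q * adj (V * W)"
      using V(7,8) WD(7,8) by (simp add: V(2) dW adj_mult mat_assoc)
  qed
  have "(adj U * \<rho> * U) $$ (k,l) = 0" if kl: "k < n" "l < n" "k \<noteq> l" "q k = q l" for k l
  proof -
    have "adj U * \<rho> * U = adj W * X * W"
      using V(7,8) WD(7,8) hermitianD(1)[OF assms(1)] by (simp add: U_def X_def adj_mult mat_assoc)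
    then have "(adj U * \<rho> * U) $$ (k,l) = (\<Sum>i<n. cnj (W $$ (i,k)) * (\<Sum>j<n. X $$ (i,j) * W $$ (j,l)))"
      using congruence_index[OF X(1) WD(4) kl(1,2)] by simp
    also have "\<dots> = (\<Sum>i<n. (e l - c * q l) * (cnj (W $$ (i,k)) * W $$ (i,l)))"
    proof (intro sum.cong refl)
      fix i assume i: "i \<in> {..<n}"
      show "cnj (W $$ (i,k)) * (\<Sum>j<n. X $$ (i,j) * W $$ (j,l)) = (e l - c * q l) * (cnj (W $$ (i,k)) * W $$ (i,l))"
      proof (cases "W $$ (i,k) = 0")
        case False
        then have di: "\<delta> i = q l" using q2[of i k] i kl by auto
        \<comment> \<open>Where column \<open>l\<close> of \<open>W\<close> is nonzero the
          eigenvalue of \<open>\<sigma>\<close> equals that at \<open>i\<close>, and there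
          \<open>X\<close> and \<open>M\<close> agree. The eigenvalue equation of \<open>Y\<close>
          thus applies to \<open>X\<close>.\<close>
        have "(\<Sum>j<n. X $$ (i,j) * W $$ (j,l)) = (\<Sum>j<n. M $$ (i,j) * W $$ (j,l))"
        proof (intro sum.cong refl)
          fix j assume j: "j \<in> {..<n}"
          show "X $$ (i,j) * W $$ (j,l) = M $$ (i,j) * W $$ (j,l)"
            using q2[of j l] i j kl(2) di by (cases "W $$ (j,l) = 0") (auto simp: M_def)
        qed
        also have "\<dots> = (e l - c * q l) * W $$ (i,l)" using row[of i l] i kl di by simp
        finally show ?thesis by simp
      qed simp
    qed
    also have "\<dots> = (e l - c * q l) * (adj W * W) $$ (k,l)"
      using WD kl by (subst mat_mult_index[of _ n n _ n]) (auto simp: sum_distrib_left)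
    finally show ?thesis using Wu kl by simp
  qed
  then show ?thesis using U q1 by (intro exI[of _ U] exI[of _ q]) auto
qed

text \<open>Split \<open>v\<close> into its parts \<open>w t\<close> by the label \<open>q\<close>.
  By Cauchy-Schwarz the quadratic form of a sum of \<open>k\<close> vectors is at most
  \<open>k\<close> times the sum of their quadratic forms, and on each part \<open>R\<close> acts as
  a diagonal matrix. Entries of \<open>R\<close> between different labels are arbitrary.\<close>

lemma pinching:
  assumes R: "psd n R" and q: "\<And>i j. i < n \<Longrightarrow> j < n \<Longrightarrow> i \<noteq> j \<Longrightarrow> q i = q j \<Longrightarrow> R $$ (i,j) = 0"
    and K: "real (card (q ` {..<n})) \<le> K"
  shows "psd n (rdiag n (\<lambda>i. K * Re (R $$ (i,i))) - R)"
proof (rule psdI)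
  show "hermitian n (rdiag n (\<lambda>i. K * Re (R $$ (i,i))) - R)"
    by (intro hermitian_minus hermitian_rdiag psdD(1)[OF R])
  fix v :: "complex vec" assume v: "v \<in> carrier_vec n"
  obtain U d where U: "specdec n R U d" "\<forall>i<n. 0 \<le> d i" using psd_obtain[OF R] by blast
  let ?T = "q ` {..<n}"
  define w where "w t = vec n (\<lambda>i. if q i = t then v $ i else 0)" for t
  have w: "w t \<in> carrier_vec n" for t by (simp add: w_def)
  define z where "z t k = (\<Sum>i<n. cnj (U $$ (i,k)) * w t $ i)" for t k
  have zsum: "(\<Sum>i<n. cnj (U $$ (i,k)) * v $ i) = (\<Sum>t\<in>?T. z t k)" for k
  proof -
    have "(\<Sum>t\<in>?T. z t k) = (\<Sum>i<n. \<Sum>t\<in>?T. cnj (U $$ (i,k)) * w t $ i)"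
      unfolding z_def by (rule sum.swap)
    also have "\<dots> = (\<Sum>i<n. \<Sum>t\<in>?T. if t = q i then cnj (U $$ (i,k)) * v $ i else 0)"
      by (intro sum.cong refl) (auto simp: w_def)
    also have "\<dots> = (\<Sum>i<n. cnj (U $$ (i,k)) * v $ i)" by (intro sum.cong refl) simp
    finally show ?thesis by simp
  qed
  have sq: "(cmod (\<Sum>t\<in>?T. z t k))\<^sup>2 \<le> real (card ?T) * (\<Sum>t\<in>?T. (cmod (z t k))\<^sup>2)" for k
  proof -
    have "(cmod (\<Sum>t\<in>?T. z t k))\<^sup>2 \<le> (\<Sum>t\<in>?T. cmod (z t k))\<^sup>2"
      by (intro power_mono norm_sum) auto
    also have "\<dots> \<le> (\<Sum>t\<in>?T. (cmod (z t k))\<^sup>2) * real (card ?T)"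
      by (rule sum_squared_le_sum_of_squares)
    finally show ?thesis by (simp add: mult.commute)
  qed
  have wt: "Re (cinner (w t) (R *\<^sub>v w t)) = (\<Sum>i<n. if q i = t then Re (R $$ (i,i)) * (cmod (v $ i))\<^sup>2 else 0)" for t
  proof -
    have "cinner (w t) (R *\<^sub>v w t) = (\<Sum>i<n. \<Sum>j<n. cnj (w t $ i) * R $$ (i,j) * w t $ j)"
      by (rule cinner_mat[OF psdD(2)[OF R] w w])
    also have "\<dots> = (\<Sum>i<n. \<Sum>j<n. if j = i then (if q i = t then cnj (v $ i) * R $$ (i,i) * v $ i else 0) else 0)"
      using q by (intro sum.cong refl) (auto simp: w_def)
    also have "\<dots> = (\<Sum>i<n. if q i = t then cnj (v $ i) * R $$ (i,i) * v $ i else 0)" by simp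
    finally have "Re (cinner (w t) (R *\<^sub>v w t)) = (\<Sum>i<n. Re (if q i = t then cnj (v $ i) * R $$ (i,i) * v $ i else 0))"
      by simp
    also have "\<dots> = (\<Sum>i<n. if q i = t then Re (R $$ (i,i)) * (cmod (v $ i))\<^sup>2 else 0)"
    proof (intro sum.cong refl)
      fix i assume "i \<in> {..<n}"
      then have x: "R $$ (i,i) = complex_of_real (Re (R $$ (i,i)))" using psd_diag(2)[OF R] by blast
      have "cnj a * complex_of_real x * a = complex_of_real (x * (cmod a)\<^sup>2)" for x a
        by (simp add: complex_norm_square mult_ac del: of_real_power)
      from this[of "v $ i" "Re (R $$ (i,i))"]
      have "cnj (v $ i) * R $$ (i,i) * v $ i = complex_of_real (Re (R $$ (i,i)) * (cmod (v $ i))\<^sup>2)"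
        unfolding x[symmetric] .
      then have "Re (cnj (v $ i) * R $$ (i,i) * v $ i) = Re (R $$ (i,i)) * (cmod (v $ i))\<^sup>2"
        by (simp only: Re_complex_of_real)
      then show "Re (if q i = t then cnj (v $ i) * R $$ (i,i) * v $ i else 0)
        = (if q i = t then Re (R $$ (i,i)) * (cmod (v $ i))\<^sup>2 else 0)"
        by (cases "q i = t") (simp_all only: if_True if_False simp_thms zero_complex.sel)
    qed
    finally show ?thesis .
  qed
  have pos: "0 \<le> (\<Sum>i<n. Re (R $$ (i,i)) * (cmod (v $ i))\<^sup>2)"
    using psd_diag(1)[OF R] by (intro sum_nonneg) auto
  have "Re (cinner v (R *\<^sub>v v)) = (\<Sum>k<n. d k * (cmod (\<Sum>t\<in>?T. z t k))\<^sup>2)"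
    unfolding cinner_specdec[OF U(1) v] zsum ..
  also have "\<dots> \<le> (\<Sum>k<n. d k * (real (card ?T) * (\<Sum>t\<in>?T. (cmod (z t k))\<^sup>2)))"
    using U(2) by (intro sum_mono mult_left_mono sq) auto
  also have "\<dots> = real (card ?T) * (\<Sum>t\<in>?T. \<Sum>k<n. d k * (cmod (z t k))\<^sup>2)"
    by (subst sum.swap) (simp add: sum_distrib_left mult_ac)
  also have "\<dots> = real (card ?T) * (\<Sum>t\<in>?T. Re (cinner (w t) (R *\<^sub>v w t)))"
    unfolding cinner_specdec[OF U(1) w] z_def ..
  also have "\<dots> = real (card ?T) * (\<Sum>i<n. \<Sum>t\<in>?T. if t = q i then Re (R $$ (i,i)) * (cmod (v $ i))\<^sup>2 else 0)"
  proof -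
    have "(if q i = t then x else y) = (if t = q i then x else y)" for i t and x y :: real by auto
    then show ?thesis unfolding wt by (subst sum.swap) (simp only:)
  qed
  also have "\<dots> = real (card ?T) * (\<Sum>i<n. Re (R $$ (i,i)) * (cmod (v $ i))\<^sup>2)"
    by (intro arg_cong2[where f="(*)"] sum.cong refl) simp
  also have "\<dots> \<le> K * (\<Sum>i<n. Re (R $$ (i,i)) * (cmod (v $ i))\<^sup>2)"
    using K pos by (rule mult_right_mono)
  also have "\<dots> = Re (cinner v (rdiag n (\<lambda>i. K * Re (R $$ (i,i))) *\<^sub>v v))"
    unfolding cinner_rdiag[OF v] by (simp add: sum_distrib_left mult_ac)
  finally show "0 \<le> Re (cinner v ((rdiag n (\<lambda>i. K * Re (R $$ (i,i))) - R) *\<^sub>v v))"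
    by (simp add: cinner_mat_minus[OF diag_of_carrier psdD(2)[OF R] v])
qed

lemma psd_minus_unitary:
  assumes "unitary n U" "B \<in> carrier_mat n n" "A \<in> carrier_mat n n" "psd n (B - adj U * A * U)"
  shows "psd n (U * B * adj U - A)"
proof -
  note U = unitaryD(1)[OF assms(1)]
  have "U * (B - adj U * A * U) * adj U = (U * B - U * (adj U * A * U)) * adj U"
    by (subst mult_minus_distrib_mat[of U n n B n]) (use U assms in \<open>auto intro!: carrier_matI\<close>)
  also have "\<dots> = U * B * adj U - U * (adj U * A * U) * adj U"
    by (subst minus_mult_distrib_mat[of _ n n _ _ n]) (use U assms in \<open>auto intro!: carrier_matI\<close>)
  also have "U * (adj U * A * U) * adj U = A" by (rule unitary_conj_inv[OF assms(1,3)])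
  finally show ?thesis using psd_congruence'[OF assms(4) U] by simp
qed

text \<open>The form in which pinching is used: \<open>P\<close> keeps only the diagonal of
  \<open>\<rho>\<close> in a suitable eigenbasis of \<open>\<sigma>\<close>, so \<open>P\<close> and
  \<open>\<sigma>\<close> behave like classical distributions, at the price of the factor
  \<open>K\<close>. The eigenvalues may be counted in any decomposition of
  \<open>\<sigma>\<close>.\<close>

lemma pinched_eigenbasis:
  assumes \<rho>: "psd n \<rho>" and \<sigma>: "specdec n \<sigma> V \<delta>" and K: "real (card (\<delta> ` {..<n})) \<le> K"
  shows "\<exists>U q P. specdec n \<sigma> U q \<and> specdec n P U (\<lambda>i. Re ((adj U * \<rho> * U) $$ (i,i))) \<and>
    psd n (complex_of_real K \<cdot>\<^sub>m P - \<rho>)"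
proof -
  obtain U q where U: "specdec n \<sigma> U q" "q ` {..<n} \<subseteq> \<delta> ` {..<n}"
    and off: "\<forall>i<n. \<forall>j<n. i \<noteq> j \<longrightarrow> q i = q j \<longrightarrow> (adj U * \<rho> * U) $$ (i,j) = 0"
    using block_eigenbasis[OF psdD(1)[OF \<rho>] \<sigma>] by blast
  note UD = specdecD[OF U(1)]
  let ?R = "adj U * \<rho> * U"
  have R: "psd n ?R" by (rule psd_congruence[OF \<rho> UD(4)])
  have "card (q ` {..<n}) \<le> card (\<delta> ` {..<n})" using U(2) by (intro card_mono) auto
  then have "real (card (q ` {..<n})) \<le> K" using K by linarith
  then have "psd n (rdiag n (\<lambda>i. K * Re (?R $$ (i,i))) - ?R)"
    using off by (intro pinching[OF R]) auto
  then have *: "psd n (U * rdiag n (\<lambda>i. K * Re (?R $$ (i,i))) * adj U - \<rho>)"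
    by (intro psd_minus_unitary[OF UD(1) _ psdD(2)[OF \<rho>]]) auto
  define P where "P = U * rdiag n (\<lambda>i. Re (?R $$ (i,i))) * adj U"
  have "rdiag n (\<lambda>i. K * Re (?R $$ (i,i))) = complex_of_real K \<cdot>\<^sub>m rdiag n (\<lambda>i. Re (?R $$ (i,i)))"
    by (rule eq_matI) auto
  then have "U * rdiag n (\<lambda>i. K * Re (?R $$ (i,i))) * adj U = complex_of_real K \<cdot>\<^sub>m P"
    unfolding P_def using UD(4)
    by (simp add: mult_smult_distrib[of U n n _ n] mult_smult_assoc_mat[of _ n n "adj U" n])
  then show ?thesis using * U(1) UD(1)
    by (intro exI[of _ U] exI[of _ q] exI[of _ P]) (simp add: specdec_def P_def)
qed

section \<open>Trace inequalities and the sandwiched functional\<close>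

text \<open>Young's inequality supplies the tangent of the power function at the mean
  \<open>m\<close>; averaging the tangent bound over the weights gives the claim, including the case
  \<open>m = 0\<close>.\<close>

lemma powr_jensen:
  fixes w d :: "'a \<Rightarrow> real"
  assumes \<beta>: "\<beta> > 1" and w: "\<And>k. k \<in> S \<Longrightarrow> 0 \<le> w k" "sum w S = 1" and d: "\<And>k. k \<in> S \<Longrightarrow> 0 \<le> d k"
  shows "(\<Sum>k\<in>S. w k * d k) powr \<beta> \<le> (\<Sum>k\<in>S. w k * d k powr \<beta>)"
proof -
  define m where "m = (\<Sum>k\<in>S. w k * d k)"
  have m0: "m \<ge> 0" unfolding m_def using w d by (intro sum_nonneg mult_nonneg_nonneg) auto
  have mp: "m * m powr (\<beta> - 1) = m powr \<beta>"
    using m0 by (cases "m = 0") (auto simp: powr_diff)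
  have "\<beta> * m powr (\<beta> - 1) * d k - (\<beta> - 1) * m powr \<beta> \<le> d k powr \<beta>" if k: "k \<in> S" for k
  proof -
    have e: "(\<beta> - 1) * (\<beta> / (\<beta> - 1)) = \<beta>" using \<beta> by simp
    have "d k * m powr (\<beta> - 1) \<le> d k powr \<beta> / \<beta> + (m powr (\<beta> - 1)) powr (\<beta> / (\<beta> - 1)) / (\<beta> / (\<beta> - 1))"
      using \<beta> d[OF k] by (intro Youngs_inequality) (auto simp: field_simps)
    also have "(m powr (\<beta> - 1)) powr (\<beta> / (\<beta> - 1)) / (\<beta> / (\<beta> - 1)) = (\<beta> - 1) * m powr \<beta> / \<beta>"
      unfolding powr_powr e by simp
    finally show ?thesis using \<beta> by (simp add: field_simps)
  qed
  then have "(\<Sum>k\<in>S. w k * (\<beta> * m powr (\<beta> - 1) * d k - (\<beta> - 1) * m powr \<beta>)) \<le> (\<Sum>k\<in>S. w k * d k powr \<beta>)"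
    using w by (intro sum_mono mult_left_mono) auto
  moreover have "(\<Sum>k\<in>S. w k * (\<beta> * m powr (\<beta> - 1) * d k - (\<beta> - 1) * m powr \<beta>))
    = \<beta> * m powr (\<beta> - 1) * (\<Sum>k\<in>S. w k * d k) - (\<beta> - 1) * m powr \<beta> * sum w S"
    by (simp only: right_diff_distrib sum_subtractf) (simp add: sum_distrib_left sum_distrib_right mult_ac)
  moreover have "\<dots> = m powr \<beta>" unfolding m_def[symmetric] w using mp by (simp add: algebra_simps)
  ultimately show ?thesis unfolding m_def[symmetric] by simp
qed

text \<open>Jensen for the ratio \<open>p / q\<close> under the weights \<open>q / sum q S\<close>.
  The second factor is the weight of \<open>S\<close> to the power
  \<open>s = (\<beta> - 1) / \<beta>\<close>, the quantity that the converse has to balance.\<close>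

lemma holder_sum:
  fixes p q :: "'a \<Rightarrow> real"
  assumes \<beta>: "\<beta> > 1" and S: "finite S" and p: "\<And>k. k \<in> S \<Longrightarrow> 0 \<le> p k" and q: "\<And>k. k \<in> S \<Longrightarrow> 0 < q k"
  shows "sum p S \<le> (\<Sum>k\<in>S. (q k powr ((1 - \<beta>) / \<beta>) * p k) powr \<beta>) powr (1/\<beta>) * (sum q S) powr ((\<beta> - 1) / \<beta>)"
proof (cases "S = {}")
  case False
  define Z where "Z = sum q S"
  have Z: "Z > 0" unfolding Z_def using S False q by (intro sum_pos) auto
  have "(\<Sum>k\<in>S. q k / Z * (p k / q k)) powr \<beta> \<le> (\<Sum>k\<in>S. q k / Z * (p k / q k) powr \<beta>)"
    using \<beta> p q Z by (intro powr_jensen) (auto simp: less_imp_le simp flip: sum_divide_distrib Z_def)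
  moreover have "(\<Sum>k\<in>S. q k / Z * (p k / q k)) = sum p S / Z"
    using q by (simp add: sum_divide_distrib) (intro sum.cong, auto, metis less_irrefl)
  moreover have "(\<Sum>k\<in>S. q k / Z * (p k / q k) powr \<beta>) = (\<Sum>k\<in>S. (q k powr ((1 - \<beta>) / \<beta>) * p k) powr \<beta>) / Z"
    unfolding sum_divide_distrib
  proof (intro sum.cong refl)
    fix k assume k: "k \<in> S"
    have "(q k powr ((1 - \<beta>) / \<beta>) * p k) powr \<beta> = q k powr (1 - \<beta>) * p k powr \<beta>"
      using k p q \<beta> by (simp add: powr_mult powr_powr)
    also have "\<dots> = q k * (p k / q k) powr \<beta>"
      using k p q[OF k] by (simp add: powr_divide powr_diff)
    finally show "q k / Z * (p k / q k) powr \<beta> = (q k powr ((1 - \<beta>) / \<beta>) * p k) powr \<beta> / Z" by simp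
  qed
  ultimately have *: "(sum p S / Z) powr \<beta> \<le> (\<Sum>k\<in>S. (q k powr ((1 - \<beta>) / \<beta>) * p k) powr \<beta>) / Z" (is "_ \<le> ?N / Z") by simp
  have sp: "sum p S \<ge> 0" using p by (intro sum_nonneg) auto
  have N0: "?N \<ge> 0" by (intro sum_nonneg) auto
  have "sum p S powr \<beta> \<le> ?N * Z powr (\<beta> - 1)"
    using * sp Z by (simp add: powr_divide powr_diff field_simps)
  then have "(sum p S powr \<beta>) powr (1/\<beta>) \<le> (?N * Z powr (\<beta> - 1)) powr (1/\<beta>)"
    using \<beta> by (intro powr_mono2) auto
  then show ?thesis using sp \<beta> N0 Z unfolding Z_def[symmetric] by (simp add: powr_powr powr_mult)
qed simp

section \<open>Traces of powers\<close>

lemma congruence_diag: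
  assumes "specdec n A U d" "V \<in> carrier_mat n n" "i < n"
  shows "Re ((adj V * A * V) $$ (i,i)) = (\<Sum>k<n. d k * (cmod ((adj U * V) $$ (k,i)))\<^sup>2)"
proof -
  note A = specdecD[OF assms(1)]
  have c: "V *\<^sub>v unit_vec n i \<in> carrier_vec n" by (intro carrier_vecI) (use assms in auto)
  have "(adj V * A * V) $$ (i,i) = cinner (unit_vec n i) ((adj V * A * V) *\<^sub>v unit_vec n i)"
    by (rule cinner_unit_vec[symmetric]) (use assms in \<open>auto intro!: carrier_matI\<close>)
  also have "\<dots> = cinner (V *\<^sub>v unit_vec n i) (A *\<^sub>v (V *\<^sub>v unit_vec n i))"
    by (rule cinner_congruence[OF A(3) assms(2)]) auto
  finally have "Re ((adj V * A * V) $$ (i,i)) = (\<Sum>k<n. d k * (cmod (\<Sum>j<n. cnj (U $$ (j,k)) * (V *\<^sub>v unit_vec n i) $ j))\<^sup>2)"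
    using cinner_specdec[OF assms(1) c] by simp
  also have "\<dots> = (\<Sum>k<n. d k * (cmod ((adj U * V) $$ (k,i)))\<^sup>2)"
  proof (intro sum.cong refl)
    fix k assume k: "k \<in> {..<n}"
    have "(\<Sum>j<n. cnj (U $$ (j,k)) * (V *\<^sub>v unit_vec n i) $ j) = (\<Sum>j<n. adj U $$ (k,j) * V $$ (j,i))"
      using A(7,8) assms k by (intro sum.cong refl) auto
    also have "\<dots> = (adj U * V) $$ (k,i)"
      using A(4) assms k by (intro mat_mult_index[of _ n n _ n, symmetric]) auto
    finally show "d k * (cmod (\<Sum>j<n. cnj (U $$ (j,k)) * (V *\<^sub>v unit_vec n i) $ j))\<^sup>2 = d k * (cmod ((adj U * V) $$ (k,i)))\<^sup>2"
      by simp
  qed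
  finally show ?thesis .
qed

text \<open>The squared moduli of the unitary \<open>adj U * V\<close> form a doubly stochastic
  matrix. Unit column sums make each diagonal entry a mean of eigenvalues, to which Jensen applies;
  unit row sums restore the total.\<close>

lemma trace_jensen:
  assumes A: "specdec n A U d" and d: "\<forall>i<n. 0 \<le> d i" and V: "unitary n V" and \<beta>: "\<beta> > 1"
  shows "(\<Sum>i<n. Re ((adj V * A * V) $$ (i,i)) powr \<beta>) \<le> (\<Sum>i<n. d i powr \<beta>)"
proof -
  define W where "W = adj U * V"
  have W: "unitary n W" unfolding W_def by (intro unitary_mult unitary_adj V specdecD(1)[OF A])
  have "(\<Sum>i<n. Re ((adj V * A * V) $$ (i,i)) powr \<beta>) = (\<Sum>i<n. (\<Sum>k<n. (cmod (W $$ (k,i)))\<^sup>2 * d k) powr \<beta>)"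
    using congruence_diag[OF A unitaryD(1)[OF V]] by (intro sum.cong) (auto simp: W_def mult.commute)
  also have "\<dots> \<le> (\<Sum>i<n. \<Sum>k<n. (cmod (W $$ (k,i)))\<^sup>2 * d k powr \<beta>)"
    using d \<beta> unitary_cols_norm[OF W] by (intro sum_mono powr_jensen) auto
  also have "\<dots> = (\<Sum>k<n. (\<Sum>i<n. (cmod (W $$ (k,i)))\<^sup>2) * d k powr \<beta>)"
    by (subst sum.swap) (simp add: sum_distrib_right)
  also have "\<dots> = (\<Sum>k<n. d k powr \<beta>)"
    using unitary_rows_norm[OF W] by (intro sum.cong) auto
  finally show ?thesis .
qed

lemma mtrace_mpow: "specdec n A U d \<Longrightarrow> Re (mtrace (mpow a A)) = (\<Sum>i<n. d i powr a)"
  using mtrace_specdec[OF specdec_mpow] by simp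

lemma specdec_diag:
  assumes "specdec n A U d" "i < n"
  shows "(adj U * A * U) $$ (i,i) = d i"
proof -
  have "adj U * A * U = rdiag n d"
    by (subst specdecD(2)[OF assms(1)], rule unitary_conj_inv(2)[OF specdecD(1)[OF assms(1)]]) simp
  then show ?thesis using assms(2) by simp
qed

lemma congruence_minus:
  assumes "A \<in> carrier_mat n n" "B \<in> carrier_mat n n" "V \<in> carrier_mat n m"
  shows "adj V * (A - B) * V = adj V * A * V - adj V * B * V"
proof -
  have "adj V * (A - B) = adj V * A - adj V * B"
    by (rule mult_minus_distrib_mat[of _ m n _ n]) (use assms in auto)
  moreover have "(adj V * A - adj V * B) * V = adj V * A * V - adj V * B * V"
    by (rule minus_mult_distrib_mat[of _ m n _ _ m]) (use assms in \<open>auto intro!: carrier_matI\<close>)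
  ultimately show ?thesis by simp
qed

lemma psd_diag_mono:
  assumes "psd n (B - A)" "A \<in> carrier_mat n n" "B \<in> carrier_mat n n" "V \<in> carrier_mat n m" "i < m"
  shows "Re ((adj V * A * V) $$ (i,i)) \<le> Re ((adj V * B * V) $$ (i,i))"
proof -
  have "psd m (adj V * B * V - adj V * A * V)"
    using psd_congruence[OF assms(1,4)] congruence_minus[OF assms(3,2,4)] by simp
  from psd_diag(1)[OF this assms(5)] show ?thesis using assms by simp
qed

text \<open>For \<open>\<beta> > 1\<close> the power is not operator monotone, but its trace is: in
  an eigenbasis of \<open>A\<close> the eigenvalues of \<open>A\<close> lie below the diagonal of
  \<open>B\<close>, and Jensen compares that diagonal with the eigenvalues of
  \<open>B\<close>.\<close>

lemma mtrace_mpow_mono: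
  assumes "psd n A" "psd n B" "psd n (B - A)" "\<beta> > 1"
  shows "Re (mtrace (mpow \<beta> A)) \<le> Re (mtrace (mpow \<beta> B))"
proof -
  obtain V a where V: "specdec n A V a" "\<forall>i<n. 0 \<le> a i" using psd_obtain[OF assms(1)] by blast
  obtain U b where U: "specdec n B U b" "\<forall>i<n. 0 \<le> b i" using psd_obtain[OF assms(2)] by blast
  have "a i powr \<beta> \<le> Re ((adj V * B * V) $$ (i,i)) powr \<beta>" if "i < n" for i
  proof (rule powr_mono2)
    show "a i \<le> Re ((adj V * B * V) $$ (i,i))"
      using psd_diag_mono[OF assms(3) psdD(2)[OF assms(1)] psdD(2)[OF assms(2)] specdecD(4)[OF V(1)] that]
        specdec_diag[OF V(1) that] by simp
  qed (use V that assms in auto)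
  then have "(\<Sum>i<n. a i powr \<beta>) \<le> (\<Sum>i<n. Re ((adj V * B * V) $$ (i,i)) powr \<beta>)" by (intro sum_mono) auto
  also have "\<dots> \<le> (\<Sum>i<n. b i powr \<beta>)" by (rule trace_jensen[OF U specdecD(1)[OF V(1)] assms(4)])
  finally show ?thesis using mtrace_mpow[OF V(1)] mtrace_mpow[OF U(1)] by simp
qed

section \<open>Classical bounds for the sandwiched functional, supports\<close>

lemma sandwich_diag:
  assumes "specdec n \<sigma> U q" "\<rho> \<in> carrier_mat n n" "i < n" "j < n"
  shows "(adj U * (mpow a \<sigma> * \<rho> * mpow a \<sigma>) * U) $$ (i,j) =
    complex_of_real (q i powr a) * (adj U * \<rho> * U) $$ (i,j) * complex_of_real (q j powr a)"
proof -
  note S = specdecD[OF specdec_mpow[OF assms(1), of a]]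
  let ?D = "rdiag n (\<lambda>i. q i powr a)" and ?R = "adj U * \<rho> * U"
  have R: "?R \<in> carrier_mat n n" using S(7,8) by auto
  have "adj U * (mpow a \<sigma> * \<rho> * mpow a \<sigma>) * U = ?D * ?R * ?D"
    using S(7,8) assms(2) by (simp add: S(2) mat_assoc unitary_cancel[OF S(1)] unitaryD[OF S(1)])
  also have "(?D * ?R * ?D) $$ (i,j) = (?D * ?R) $$ (i,j) * complex_of_real (q j powr a)"
    by (rule mult_diag_of_index) (use R assms in \<open>auto intro!: carrier_matI\<close>)
  also have "(?D * ?R) $$ (i,j) = complex_of_real (q i powr a) * ?R $$ (i,j)"
    by (rule diag_of_mult_index[OF R]) (use assms in auto)
  finally show ?thesis .
qed

text \<open>Dropping off-diagonal entries cannot increase the trace of the power. In an eigenbasis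
  of \<open>\<sigma>\<close> the sandwiched operator has the diagonal of \<open>\<rho>\<close>
  scaled by powers of the eigenvalues, so this is the classical functional of the measured
  states.\<close>

lemma sandQ_lower:
  assumes \<rho>: "psd n \<rho>" and \<sigma>: "psd n \<sigma>" "specdec n \<sigma> U q" and \<beta>: "\<beta> > 1"
  shows "(\<Sum>i<n. (q i powr ((1 - \<beta>) / \<beta>) * Re ((adj U * \<rho> * U) $$ (i,i))) powr \<beta>) \<le> sandQ \<beta> \<rho> \<sigma>"
proof -
  define a where "a = (1 - \<beta>) / (2 * \<beta>)"
  let ?A = "mpow a \<sigma> * \<rho> * mpow a \<sigma>"
  have a2: "(1 - \<beta>) / \<beta> = a + a" by (simp add: a_def field_simps)
  have A: "psd n ?A" by (rule psd_sandwich[OF \<rho> \<sigma>(1)])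
  obtain V d where V: "specdec n ?A V d" "\<forall>i<n. 0 \<le> d i" using psd_obtain[OF A] by blast
  have "Re ((adj U * ?A * U) $$ (i,i)) = q i powr ((1 - \<beta>) / \<beta>) * Re ((adj U * \<rho> * U) $$ (i,i))" if "i < n" for i
    unfolding sandwich_diag[OF \<sigma>(2) psdD(2)[OF \<rho>] that that] a2 powr_add by simp
  then have "(\<Sum>i<n. (q i powr ((1 - \<beta>) / \<beta>) * Re ((adj U * \<rho> * U) $$ (i,i))) powr \<beta>)
    = (\<Sum>i<n. Re ((adj U * ?A * U) $$ (i,i)) powr \<beta>)" by (intro sum.cong) auto
  also have "\<dots> \<le> (\<Sum>i<n. d i powr \<beta>)" by (rule trace_jensen[OF V specdecD(1)[OF \<sigma>(2)] \<beta>])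
  also have "\<dots> = sandQ \<beta> \<rho> \<sigma>" using mtrace_mpow[OF V(1), of \<beta>] by (simp add: sandQ_def a_def)
  finally show ?thesis .
qed

text \<open>Replacing \<open>\<rho>\<close> by the larger operator \<open>K P\<close>, which
  commutes with \<open>\<sigma>\<close>, makes the functional classical. The factor
  \<open>K powr \<beta>\<close> becomes a plain \<open>K\<close> once the power
  \<open>1 / \<beta>\<close> is taken.\<close>

lemma sandQ_upper:
  assumes \<rho>: "psd n \<rho>" and \<sigma>: "psd n \<sigma>" "specdec n \<sigma> U q" and P: "specdec n P U p" "\<forall>i<n. 0 \<le> p i"
    and K: "K \<ge> 0" "psd n (complex_of_real K \<cdot>\<^sub>m P - \<rho>)" and \<beta>: "\<beta> > 1"
  shows "sandQ \<beta> \<rho> \<sigma> \<le> K powr \<beta> * (\<Sum>i<n. (q i powr ((1 - \<beta>) / \<beta>) * p i) powr \<beta>)"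
proof -
  define a where "a = (1 - \<beta>) / (2 * \<beta>)"
  have a2: "(1 - \<beta>) / \<beta> = a + a" by (simp add: a_def field_simps)
  note S = specdecD[OF specdec_mpow[OF \<sigma>(2), of a]] and PD = specdecD[OF P(1)]
  let ?D = "rdiag n (\<lambda>i. q i powr a)"
  have Pp: "psd n P" using psd_specdec[OF P(1)] P(2) by blast
  have KP: "psd n (complex_of_real K \<cdot>\<^sub>m P)" by (rule psd_smult[OF Pp K(1)])
  let ?A = "mpow a \<sigma> * \<rho> * mpow a \<sigma>" and ?B = "mpow a \<sigma> * (complex_of_real K \<cdot>\<^sub>m P) * mpow a \<sigma>"
  have A: "psd n ?A" and B: "psd n ?B" by (rule psd_sandwich[OF _ \<sigma>(1)], fact)+
  have BA: "psd n (?B - ?A)"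
    using psd_sandwich[OF K(2) \<sigma>(1), of a]
      congruence_minus[OF psdD(2)[OF KP] psdD(2)[OF \<rho>] S(3)] S(9) by simp
  have "specdec n ?B U (\<lambda>i. K * (q i powr ((1 - \<beta>) / \<beta>) * p i))"
    unfolding specdec_def
  proof
    show "unitary n U" by (rule S(1))
    have "?B = U * (adj U * ?B * U) * adj U"
      by (rule unitary_conj_inv(1)[OF S(1), symmetric]) (use psdD(2)[OF B] in simp)
    also have "adj U * ?B * U = rdiag n (\<lambda>i. K * (q i powr ((1 - \<beta>) / \<beta>) * p i))"
    proof (rule eq_matI)
      fix i j assume "i < dim_row (rdiag n (\<lambda>i. K * (q i powr ((1 - \<beta>) / \<beta>) * p i)))"
        "j < dim_col (rdiag n (\<lambda>i. K * (q i powr ((1 - \<beta>) / \<beta>) * p i)))"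
      then have ij: "i < n" "j < n" by auto
      have "adj U * (complex_of_real K \<cdot>\<^sub>m P) * U = complex_of_real K \<cdot>\<^sub>m (adj U * P * U)"
      proof -
        have "adj U * P \<in> carrier_mat n n" using PD(5-8) by (intro carrier_matI) auto
        then show ?thesis using PD(3,4) mult_smult_distrib[of "adj U" n n P n K] mult_smult_assoc_mat[of "adj U * P" n n U n K] by simp
      qed
      also have "adj U * P * U = rdiag n p"
        by (subst PD(2), rule unitary_conj_inv(2)[OF PD(1)]) simp
      finally have "(adj U * (complex_of_real K \<cdot>\<^sub>m P) * U) $$ (i,j) = K * (if i = j then complex_of_real (p i) else 0)"
        using ij by simp
      then show "(adj U * ?B * U) $$ (i,j) = rdiag n (\<lambda>i. K * (q i powr ((1 - \<beta>) / \<beta>) * p i)) $$ (i,j)"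
        unfolding sandwich_diag[OF \<sigma>(2) psdD(2)[OF KP] ij] using ij powr_add[of "q i" a a]
        by (auto simp: a2 simp flip: of_real_mult)
    qed (use S(7,8) in auto)
    finally show "?B = U * rdiag n (\<lambda>i. K * (q i powr ((1 - \<beta>) / \<beta>) * p i)) * adj U" .
  qed
  from mtrace_mpow[OF this, of \<beta>]
  have "Re (mtrace (mpow \<beta> ?B)) = (\<Sum>i<n. (K * (q i powr ((1 - \<beta>) / \<beta>) * p i)) powr \<beta>)" .
  also have "\<dots> = K powr \<beta> * (\<Sum>i<n. (q i powr ((1 - \<beta>) / \<beta>) * p i) powr \<beta>)"
    unfolding sum_distrib_left using K(1) P(2) by (intro sum.cong refl) (simp add: powr_mult)
  finally show ?thesis
    using mtrace_mpow_mono[OF A B BA \<beta>] by (simp add: sandQ_def a_def)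
qed

text \<open>Inclusion of supports is the reverse inclusion of kernels. Positivity of
  \<open>\<rho>\<close> lets the diagonal alone decide, because a zero diagonal entry annihilates
  its row.\<close>

lemma supp_subset_diag:
  assumes \<rho>: "psd n \<rho>" and \<sigma>: "specdec n \<sigma> U q"
  shows "supp \<rho> \<subseteq> supp \<sigma> \<longleftrightarrow> (\<forall>i<n. q i = 0 \<longrightarrow> (adj U * \<rho> * U) $$ (i,i) = 0)"
proof -
  note S = specdecD[OF \<sigma>]
  let ?R = "adj U * \<rho> * U"
  have R: "psd n ?R" by (rule psd_congruence[OF \<rho> S(4)])
  have Rc: "?R \<in> carrier_mat n n" by (rule psdD(2)[OF R])
  note d = psdD(3,4)[OF \<rho>]
  show ?thesis
  proof
    assume sub: "supp \<rho> \<subseteq> supp \<sigma>"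
    show "\<forall>i<n. q i = 0 \<longrightarrow> ?R $$ (i,i) = 0"
    proof (intro allI impI)
      fix i assume i: "i < n" "q i = 0"
      have "\<rho> *\<^sub>v (U *\<^sub>v unit_vec n i) \<in> supp \<rho>"
        unfolding supp_def using d S(7) by (auto intro!: carrier_vecI exI[of _ "U *\<^sub>v unit_vec n i"])
      then obtain w where w: "w \<in> carrier_vec n" "\<rho> *\<^sub>v (U *\<^sub>v unit_vec n i) = \<sigma> *\<^sub>v w"
        using sub S(6) by (auto simp: supp_def)
      have "?R *\<^sub>v unit_vec n i = adj U *\<^sub>v (\<rho> *\<^sub>v (U *\<^sub>v unit_vec n i))"
        using d S(7,8) by (simp add: mat_vec_assoc)
      also have "\<dots> = (adj U * \<sigma>) *\<^sub>v w" using w S(5-8) by (simp add: mat_vec_assoc)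
      also have "adj U * \<sigma> = rdiag n q * adj U"
        using S(7,8) by (simp add: S(2) mat_assoc unitary_cancel[OF S(1)])
      also have "(rdiag n q * adj U) *\<^sub>v w = rdiag n q *\<^sub>v (adj U *\<^sub>v w)"
        using w S(7,8) by (simp add: mat_vec_assoc)
      finally have "(?R *\<^sub>v unit_vec n i) $ i = (rdiag n q *\<^sub>v (adj U *\<^sub>v w)) $ i" by simp
      also have "\<dots> = (\<Sum>l<n. rdiag n q $$ (i,l) * (adj U *\<^sub>v w) $ l)"
        by (rule mat_vec_index[of _ n n]) (use i w S(7,8) in \<open>auto intro!: carrier_vecI\<close>)
      also have "\<dots> = 0" using i by (intro sum.neutral) auto
      finally show "?R $$ (i,i) = 0" using i S(7,8) by simp
    qed
  next
    assume z: "\<forall>i<n. q i = 0 \<longrightarrow> ?R $$ (i,i) = 0"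
    show "supp \<rho> \<subseteq> supp \<sigma>"
    proof
      fix x assume "x \<in> supp \<rho>"
      then obtain v where v: "v \<in> carrier_vec n" "x = \<rho> *\<^sub>v v" using d by (auto simp: supp_def)
      define y where "y = ?R *\<^sub>v (adj U *\<^sub>v v)"
      have yd: "dim_vec y = n" using S(8) by (simp add: y_def)
      \<comment> \<open>Division by zero yields 0, which is the right value: where
        \<open>q i = 0\<close> the row \<open>i\<close> of \<open>?R\<close> vanishes and with it
        \<open>y $ i\<close>.\<close>
      define w where "w = vec n (\<lambda>i. y $ i / q i)"
      have wc: "w \<in> carrier_vec n" by (simp add: w_def)
      have "rdiag n q *\<^sub>v w = y"
      proof (rule eq_vecI)
        fix i assume "i < dim_vec y" then have i: "i < n" using yd by simp
        have "(rdiag n q *\<^sub>v w) $ i = (\<Sum>l<n. rdiag n q $$ (i,l) * w $ l)"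
          by (rule mat_vec_index[of _ n n]) (use i wc in auto)
        also have "\<dots> = (\<Sum>l<n. if l = i then q i * w $ i else 0)" using i by (intro sum.cong) auto
        also have "\<dots> = q i * w $ i" using i by simp
        also have "\<dots> = y $ i"
        proof (cases "q i = 0")
          case True
          have "y $ i = (\<Sum>l<n. ?R $$ (i,l) * (adj U *\<^sub>v v) $ l)"
            unfolding y_def by (rule mat_vec_index[OF Rc]) (use i v S(7,8) in \<open>auto intro!: carrier_vecI\<close>)
          also have "\<dots> = 0" using psd_zero_diag(1)[OF R i] z True i by (intro sum.neutral) auto
          finally show ?thesis using True by simp
        qed (use i in \<open>simp add: w_def\<close>)
        finally show "(rdiag n q *\<^sub>v w) $ i = y $ i" .
      qed (use yd in simp)
      moreover have "x = U *\<^sub>v y"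
      proof -
        have "U *\<^sub>v y = (U * ?R * adj U) *\<^sub>v v"
          unfolding y_def using v S(7,8) d by (simp add: mat_vec_assoc mat_assoc)
        then show ?thesis using unitary_conj_inv(1)[OF S(1) psdD(2)[OF \<rho>]] v by simp
      qed
      moreover have "U *\<^sub>v (rdiag n q *\<^sub>v w) = \<sigma> *\<^sub>v (U *\<^sub>v w)"
      proof -
        have "\<sigma> *\<^sub>v (U *\<^sub>v w) = (\<sigma> * U) *\<^sub>v w" using S(5-8) wc by (simp add: mat_vec_assoc)
        also have "\<sigma> * U = U * rdiag n q" using S(7,8) by (simp add: S(2) mat_assoc unitaryD[OF S(1)])
        finally show ?thesis using S(7,8) wc by (simp add: mat_vec_assoc)
      qed
      ultimately have "x = \<sigma> *\<^sub>v (U *\<^sub>v w)" by simp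
      then show "x \<in> supp \<sigma>" unfolding supp_def
        using S(5-8) wc by (auto intro!: exI[of _ "U *\<^sub>v w"] carrier_vecI)
    qed
  qed
qed

text \<open>In an eigenbasis of \<open>\<sigma>\<close>, \<open>\<rho>\<close> is at most
  \<open>n\<close> times its diagonal part, and by the inclusion of supports that diagonal is
  bounded by a multiple of the eigenvalues of \<open>\<sigma>\<close>.\<close>

lemma supp_dominated:
  assumes \<rho>: "psd n \<rho>" and \<sigma>: "psd n \<sigma>" and sub: "supp \<rho> \<subseteq> supp \<sigma>"
  shows "\<exists>c\<ge>1. psd n (complex_of_real c \<cdot>\<^sub>m \<sigma> - \<rho>)"
proof -
  obtain U q where U: "specdec n \<sigma> U q" "\<forall>i<n. 0 \<le> q i" using psd_obtain[OF \<sigma>] by blast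
  note S = specdecD[OF U(1)]
  let ?R = "adj U * \<rho> * U"
  have R: "psd n ?R" by (rule psd_congruence[OF \<rho> S(4)])
  have z: "\<forall>i<n. q i = 0 \<longrightarrow> ?R $$ (i,i) = 0" using sub supp_subset_diag[OF \<rho> U(1)] by simp
  \<comment> \<open>The sum dominates each ratio, with \<open>0 / 0 = 0\<close> on the kernel of
    \<open>\<sigma>\<close>; the summand 1 ensures \<open>c \<ge> 1\<close>.\<close>
  define c where "c = 1 + real n * (\<Sum>i<n. Re (?R $$ (i,i)) / q i)"
  have cpos: "0 \<le> Re (?R $$ (i,i)) / q i" if "i < n" for i using U(2) psd_diag(1)[OF R that] that by simp
  have c1: "c \<ge> 1" unfolding c_def using cpos by (auto intro!: mult_nonneg_nonneg sum_nonneg)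
  have cq: "real n * Re (?R $$ (i,i)) \<le> c * q i" if i: "i < n" for i
  proof (cases "q i = 0")
    case False
    then have qp: "q i > 0" using U(2) i by (simp add: less_le)
    have "Re (?R $$ (i,i)) / q i \<le> (\<Sum>i<n. Re (?R $$ (i,i)) / q i)"
      by (rule member_le_sum[of i "{..<n}" "\<lambda>i. Re (?R $$ (i,i)) / q i"]) (use i cpos in auto)
    then have "real n * (Re (?R $$ (i,i)) / q i) \<le> c" unfolding c_def
      by (smt (verit) mult_left_mono of_nat_0_le_iff)
    then show ?thesis using qp by (simp add: field_simps)
  qed (use z i in auto)
  \<comment> \<open>The injective labelling \<open>real\<close> satisfies the condition on
    off-diagonal entries vacuously and produces \<open>n\<close> labels.\<close>
  have "psd n (rdiag n (\<lambda>i. real n * Re (?R $$ (i,i))) - ?R)"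
    by (rule pinching[OF R, of real]) (auto simp: card_image)
  moreover have "psd n (rdiag n (\<lambda>i. c * q i - real n * Re (?R $$ (i,i))))"
    unfolding psd_rdiag using cq by auto
  ultimately have "psd n (rdiag n (\<lambda>i. c * q i - real n * Re (?R $$ (i,i))) + (rdiag n (\<lambda>i. real n * Re (?R $$ (i,i))) - ?R))"
    by (intro psd_add)
  also have "rdiag n (\<lambda>i. c * q i - real n * Re (?R $$ (i,i))) + (rdiag n (\<lambda>i. real n * Re (?R $$ (i,i))) - ?R)
    = complex_of_real c \<cdot>\<^sub>m rdiag n q - ?R"
    by (rule eq_matI) (use psdD(3,4)[OF R] in auto)
  finally have "psd n (U * (complex_of_real c \<cdot>\<^sub>m rdiag n q) * adj U - \<rho>)"
    by (intro psd_minus_unitary[OF S(1) _ psdD(2)[OF \<rho>]]) auto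
  also have "U * (complex_of_real c \<cdot>\<^sub>m rdiag n q) * adj U = complex_of_real c \<cdot>\<^sub>m \<sigma>"
    unfolding S(2) using S(4)
    by (simp add: mult_smult_distrib[of U n n _ n] mult_smult_assoc_mat[of _ n n "adj U" n])
  finally show ?thesis using c1 by blast
qed

section \<open>Trace distance to a pure state\<close>

lemma trace_norm_specdec:
  assumes "specdec n X W x"
  shows "trace_norm X = (\<Sum>i<n. \<bar>x i\<bar>)"
proof -
  note S = specdecD[OF assms]
  have "adj X * X = X * X" by (simp only: S(9))
  also have "\<dots> = W * (rdiag n x * rdiag n x) * adj W"
    using S(7,8) by (simp add: S(2) mat_assoc unitary_cancel[OF S(1)])
  finally have "adj X * X = W * rdiag n (\<lambda>i. (x i)\<^sup>2) * adj W"
    unfolding diag_of_mult by (simp only: of_real_mult power2_eq_square)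
  then have "specdec n (adj X * X) W (\<lambda>i. (x i)\<^sup>2)" using S(1) by (simp add: specdec_def)
  from mtrace_specdec[OF specdec_mfun[OF this, of sqrt]] show ?thesis by (simp add: trace_norm_def)
qed

lemma pure_state_psd:
  assumes "pure_state n A"
  shows "psd n A" "mtrace A = 1" "mtrace (A * A) = 1"
proof -
  obtain a where a: "a \<in> carrier_vec n" "cinner a a = 1" "A = mat n n (\<lambda>(i,j). a $ i * cnj (a $ j))"
    using assms by (auto simp: pure_state_def)
  define M where "M = mat n 1 (\<lambda>(i,j). a $ i)"
  have "A = M * 1\<^sub>m 1 * adj M"
    by (rule eq_matI) (auto simp: a(3) M_def scalar_prod_def)
  then show "psd n A" using psd_congruence'[OF psd_one, of M n 1] by (simp add: M_def)
  have s: "(\<Sum>i<n. cnj (a $ i) * a $ i) = 1" using a by (simp add: cinner_def)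
  then show "mtrace A = 1" by (simp add: mtrace_def a(3) mult.commute)
  have "mtrace (A * A) = (\<Sum>i<n. \<Sum>j<n. (cnj (a $ i) * a $ i) * (cnj (a $ j) * a $ j))"
  proof -
    have Ac: "A \<in> carrier_mat n n" by (simp add: a(3))
    show ?thesis unfolding mtrace_mult[OF Ac Ac] by (intro sum.cong refl) (simp add: a(3))
  qed
  also have "\<dots> = (\<Sum>i<n. cnj (a $ i) * a $ i) * (\<Sum>i<n. cnj (a $ i) * a $ i)"
    by (simp add: sum_product)
  finally show "mtrace (A * A) = 1" using s by simp
qed

lemma pure_state_congruence:
  assumes "pure_state n A" "unitary n W"
  shows "pure_state n (adj W * A * W)"
proof -
  obtain a where a: "a \<in> carrier_vec n" "cinner a a = 1" "A = mat n n (\<lambda>(i,j). a $ i * cnj (a $ j))"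
    using assms by (auto simp: pure_state_def)
  note W = unitaryD[OF assms(2)]
  define b where "b = adj W *\<^sub>v a"
  have b: "b \<in> carrier_vec n" unfolding b_def using W(1) by (intro carrier_vecI) auto
  have bi: "b $ i = (\<Sum>l<n. cnj (W $$ (l,i)) * a $ l)" if "i < n" for i
    unfolding b_def using W(1) a that by (subst mat_vec_index[of _ n n]) auto
  have Wb: "W *\<^sub>v b = a"
  proof -
    have "W *\<^sub>v b = (W * adj W) *\<^sub>v a" unfolding b_def using W(1) a by (simp add: mat_vec_assoc)
    then show ?thesis using W a by simp
  qed
  have "cinner b b = cinner a (W *\<^sub>v b)"
    using cinner_adj[OF W(1) a(1) b] by (simp add: b_def)
  then have "cinner b b = 1" using Wb a by simp
  moreover have "adj W * A * W = mat n n (\<lambda>(i,j). b $ i * cnj (b $ j))"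
  proof (rule eq_matI)
    fix i j assume "i < dim_row (mat n n (\<lambda>(i,j). b $ i * cnj (b $ j)))" "j < dim_col (mat n n (\<lambda>(i,j). b $ i * cnj (b $ j)))"
    then have ij: "i < n" "j < n" by auto
    have "(adj W * A * W) $$ (i,j) = (\<Sum>k<n. cnj (W $$ (k,i)) * (\<Sum>l<n. A $$ (k,l) * W $$ (l,j)))"
      by (rule congruence_index[of _ n _ n]) (use ij W(1) a in auto)
    also have "\<dots> = (\<Sum>k<n. cnj (W $$ (k,i)) * a $ k * (\<Sum>l<n. cnj (a $ l) * W $$ (l,j)))"
      by (simp add: a(3) sum_distrib_left mult_ac)
    also have "\<dots> = b $ i * cnj (b $ j)" by (simp add: bi ij sum_distrib_right mult.commute)
    finally show "(adj W * A * W) $$ (i,j) = mat n n (\<lambda>(i,j). b $ i * cnj (b $ j)) $$ (i,j)" using ij by simp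
  qed (use W(1) in auto)
  ultimately show ?thesis using b by (auto simp: pure_state_def)
qed

lemma mtrace_congruence:
  assumes "unitary n W" "A \<in> carrier_mat n n" "B \<in> carrier_mat n n"
  shows "mtrace (A * B) = mtrace ((adj W * A * W) * (adj W * B * W))"
proof -
  note W = unitaryD[OF assms(1)]
  have "(adj W * A * W) * (adj W * B * W) = adj W * (A * B) * adj (adj W)"
    using W(1) assms(2,3) by (simp add: mat_assoc unitary_cancel[OF assms(1)])
  then show ?thesis
    using mtrace_cong_unitary[OF unitary_adj[OF assms(1)], of "A * B"] assms(2,3) by simp
qed

text \<open>Splitting each inner product with an eigenvector of \<open>T\<close> into the parts over
  \<open>S\<close> and its complement costs the factor 2; Cauchy-Schwarz bounds each part by weight
  of \<open>b\<close> times weight of \<open>T\<close>. With a suitable \<open>S\<close>, one of the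
  two weights is small on either side.\<close>

lemma psd_split_bound:
  assumes T: "psd n T" and b: "b \<in> carrier_vec n"
  defines "L \<equiv> \<lambda>S. (\<Sum>i\<in>S. (cmod (b $ i))\<^sup>2) * (\<Sum>i\<in>S. Re (T $$ (i,i)))"
  assumes S: "S \<subseteq> {..<n}"
  shows "Re (cinner b (T *\<^sub>v b)) \<le> 2 * L S + 2 * L ({..<n} - S)"
proof -
  obtain U d where U: "specdec n T U d" "\<forall>i<n. 0 \<le> d i" using psd_obtain[OF T] by blast
  have cs: "(cmod (\<Sum>i\<in>S. cnj (U $$ (i,k)) * b $ i))\<^sup>2 \<le> (\<Sum>i\<in>S. (cmod (U $$ (i,k)))\<^sup>2) * (\<Sum>i\<in>S. (cmod (b $ i))\<^sup>2)" for S k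
  proof -
    have "(cmod (\<Sum>i\<in>S. cnj (U $$ (i,k)) * b $ i))\<^sup>2 \<le> (\<Sum>i\<in>S. cmod (U $$ (i,k)) * cmod (b $ i))\<^sup>2"
      by (intro power_mono sum_norm_le) (auto simp: norm_mult)
    also have "\<dots> \<le> (\<Sum>i\<in>S. (cmod (U $$ (i,k)))\<^sup>2) * (\<Sum>i\<in>S. (cmod (b $ i))\<^sup>2)"
      by (rule Cauchy_Schwarz_ineq_sum)
    finally show ?thesis .
  qed
  have dg: "(\<Sum>k<n. d k * (\<Sum>i\<in>S. (cmod (U $$ (i,k)))\<^sup>2)) = (\<Sum>i\<in>S. Re (T $$ (i,i)))" if "S \<subseteq> {..<n}" for S
  proof -
    have "Re (T $$ (i,i)) = (\<Sum>k<n. d k * (cmod (U $$ (i,k)))\<^sup>2)" if "i < n" for i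
    proof -
      have "T $$ (i,i) = (\<Sum>k<n. complex_of_real (d k * (cmod (U $$ (i,k)))\<^sup>2))"
        unfolding specdec_index[OF U(1) that that]
        by (intro sum.cong refl) (simp add: complex_norm_square mult_ac del: of_real_power)
      then show ?thesis by (simp only: Re_sum Re_complex_of_real)
    qed
    then have "(\<Sum>i\<in>S. Re (T $$ (i,i))) = (\<Sum>i\<in>S. \<Sum>k<n. d k * (cmod (U $$ (i,k)))\<^sup>2)"
      using that by (intro sum.cong) auto
    also have "\<dots> = (\<Sum>k<n. d k * (\<Sum>i\<in>S. (cmod (U $$ (i,k)))\<^sup>2))"
      by (subst sum.swap) (simp add: sum_distrib_left)
    finally show ?thesis by simp
  qed
  let ?z = "\<lambda>S k. (\<Sum>i\<in>S. cnj (U $$ (i,k)) * b $ i)"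
  have part: "(\<Sum>k<n. d k * (cmod (?z S k))\<^sup>2) \<le> L S" if "S \<subseteq> {..<n}" for S
  proof -
    have "(\<Sum>k<n. d k * (cmod (?z S k))\<^sup>2) \<le> (\<Sum>k<n. d k * ((\<Sum>i\<in>S. (cmod (U $$ (i,k)))\<^sup>2) * (\<Sum>i\<in>S. (cmod (b $ i))\<^sup>2)))"
      using U(2) cs by (intro sum_mono mult_left_mono) auto
    also have "\<dots> = (\<Sum>k<n. d k * (\<Sum>i\<in>S. (cmod (U $$ (i,k)))\<^sup>2)) * (\<Sum>i\<in>S. (cmod (b $ i))\<^sup>2)"
    proof -
      have "(\<Sum>k<n. d k * (f k * y)) = (\<Sum>k<n. d k * f k) * y" for f y
        by (simp add: sum_distrib_right mult.assoc)
      then show ?thesis .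
    qed
    finally show ?thesis unfolding dg[OF that] L_def by (simp add: mult.commute)
  qed
  have "Re (cinner b (T *\<^sub>v b)) = (\<Sum>k<n. d k * (cmod (?z S k + ?z ({..<n} - S) k))\<^sup>2)"
    unfolding cinner_specdec[OF U(1) b] using S by (simp add: sum.subset_diff[OF S] add.commute)
  also have "\<dots> \<le> (\<Sum>k<n. d k * (2 * (cmod (?z S k))\<^sup>2 + 2 * (cmod (?z ({..<n} - S) k))\<^sup>2))"
  proof (intro sum_mono mult_left_mono)
    fix k assume "k \<in> {..<n}"
    have "(cmod (x + y))\<^sup>2 \<le> 2 * (cmod x)\<^sup>2 + 2 * (cmod y)\<^sup>2" for x y
    proof -
      have "(cmod (x + y))\<^sup>2 \<le> (cmod x + cmod y)\<^sup>2" by (intro power_mono norm_triangle_ineq) auto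
      also have "\<dots> \<le> 2 * (cmod x)\<^sup>2 + 2 * (cmod y)\<^sup>2"
        using sum_squares_bound[of "cmod x" "cmod y"] by (simp add: power2_sum)
      finally show ?thesis .
    qed
    then show "(cmod (?z S k + ?z ({..<n} - S) k))\<^sup>2 \<le> 2 * (cmod (?z S k))\<^sup>2 + 2 * (cmod (?z ({..<n} - S) k))\<^sup>2" .
  qed (use U(2) in auto)
  also have "\<dots> = 2 * (\<Sum>k<n. d k * (cmod (?z S k))\<^sup>2) + 2 * (\<Sum>k<n. d k * (cmod (?z ({..<n} - S) k))\<^sup>2)"
    by (simp add: sum.distrib sum_distrib_left algebra_simps)
  also have "\<dots> \<le> 2 * L S + 2 * L ({..<n} - S)"
    using part[OF S] part[of "{..<n} - S"] by auto
  finally show ?thesis .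
qed

text \<open>The last bound splits the pure state along the negative eigenspace of \<open>\<tau> - A\<close>.\<close>
lemma tdist_pure:
  assumes \<tau>: "density n \<tau>" and A: "pure_state n A"
  defines "F \<equiv> Re (mtrace (A * \<tau>))"
  shows "tdist \<tau> A \<le> 1" "1 - tdist \<tau> A \<le> F" "F \<le> 2 * (1 - tdist \<tau> A)"
proof -
  have \<tau>p: "psd n \<tau>" and \<tau>t: "mtrace \<tau> = 1" using \<tau> by (auto simp: density_def)
  note Ap = pure_state_psd[OF A]
  note c = psdD(2)[OF \<tau>p] psdD(2)[OF Ap(1)]
  obtain W x where W: "specdec n (\<tau> - A) W x"
    using hermitian_specdec[OF hermitian_minus[OF psdD(1)[OF \<tau>p] psdD(1)[OF Ap(1)]]] by blast
  note WD = specdecD[OF W] and Wu = unitaryD[OF specdecD(1)[OF W]]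
  define T where "T = adj W * \<tau> * W"
  define B where "B = adj W * A * W"
  have T: "psd n T" unfolding T_def by (rule psd_congruence[OF \<tau>p WD(4)])
  have B: "pure_state n B" unfolding B_def by (rule pure_state_congruence[OF A WD(1)])
  note Bp = pure_state_psd[OF B]
  obtain b where b: "b \<in> carrier_vec n" "cinner b b = 1" "B = mat n n (\<lambda>(i,j). b $ i * cnj (b $ j))"
    using B by (auto simp: pure_state_def)
  define t where "t i = Re (T $$ (i,i))" for i
  define \<beta> where "\<beta> i = (cmod (b $ i))\<^sup>2" for i
  have t0: "t i \<ge> 0" if "i < n" for i unfolding t_def using psd_diag(1)[OF T that] .
  have \<beta>0: "\<beta> i \<ge> 0" for i by (simp add: \<beta>_def)
  have Bii: "B $$ (i,i) = complex_of_real (\<beta> i)" if "i < n" for i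
    using that by (simp add: b(3) \<beta>_def complex_norm_square del: of_real_power)
  have s\<beta>: "(\<Sum>i<n. \<beta> i) = 1"
    using b(2) cinner_self[OF b(1)] unfolding \<beta>_def by (metis of_real_eq_1_iff)
  have st: "(\<Sum>i<n. t i) = 1"
  proof -
    have "mtrace T = 1"
      using mtrace_cong_unitary[OF unitary_adj[OF WD(1)] c(1)] \<tau>t by (simp add: T_def)
    then show ?thesis using mtrace_carrier[OF psdD(2)[OF T]] unfolding t_def by (metis Re_sum one_complex.sel(1))
  qed
  have x: "x i = t i - \<beta> i" if "i < n" for i
  proof -
    have "complex_of_real (x i) = (adj W * (\<tau> - A) * W) $$ (i,i)" using specdec_diag[OF W that] by simp
    also have "\<dots> = T $$ (i,i) - B $$ (i,i)"
      unfolding congruence_minus[OF c WD(4)] T_def[symmetric] B_def[symmetric]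
      using that psdD(3,4)[OF T] psdD(3,4)[OF Bp(1)] by simp
    finally have "Re (complex_of_real (x i)) = Re (T $$ (i,i) - B $$ (i,i))" by simp
    then show ?thesis by (simp add: t_def Bii[OF that])
  qed
  have td: "tdist \<tau> A = (\<Sum>i<n. \<bar>x i\<bar>) / 2" unfolding tdist_def trace_norm_specdec[OF W] ..
  have "(\<Sum>i<n. \<bar>x i\<bar>) \<le> (\<Sum>i<n. t i + \<beta> i)" using x t0 \<beta>0 by (intro sum_mono) (smt (verit) lessThan_iff)
  then show "tdist \<tau> A \<le> 1" unfolding td using st s\<beta> by (simp add: sum.distrib)
  have sx: "(\<Sum>i<n. x i) = 0"
  proof -
    have "(\<Sum>i<n. x i) = (\<Sum>i<n. t i - \<beta> i)" using x by (intro sum.cong) auto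
    then show ?thesis using st s\<beta> by (simp add: sum_subtractf)
  qed
  \<comment> \<open>The difference of two states is traceless, so half the sum of the moduli is the
    total of the negative parts.\<close>
  have td2: "tdist \<tau> A = (\<Sum>i<n. max 0 (- x i))"
  proof -
    have "(\<Sum>i<n. \<bar>x i\<bar>) = (\<Sum>i<n. x i + 2 * max 0 (- x i))" by (intro sum.cong) auto
    then show ?thesis unfolding td using sx by (simp add: sum.distrib flip: sum_distrib_left)
  qed
  have \<beta>1: "\<beta> i \<le> 1" if "i < n" for i
    using member_le_sum[of i "{..<n}" \<beta>] that \<beta>0 s\<beta> by auto
  have "mtrace ((\<tau> - A) * A) = (\<Sum>i<n. x i * B $$ (i,i))"
    using mtrace_specdec_mult[OF W c(2)] by (simp add: B_def)
  also have "\<dots> = complex_of_real (\<Sum>i<n. x i * \<beta> i)" using Bii by simp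
  finally have "complex_of_real (\<Sum>i<n. x i * \<beta> i) = mtrace (A * (\<tau> - A))"
    using mtrace_comm[OF WD(3) c(2)] by simp
  also have "\<dots> = mtrace (A * \<tau>) - 1" using mtrace_mult_minus[OF c c(2)] Ap(3) by simp
  finally have F1: "F - 1 = (\<Sum>i<n. x i * \<beta> i)"
    unfolding F_def by (metis Re_complex_of_real minus_complex.sel(1) one_complex.sel(1))
  have "(\<Sum>i<n. - x i * \<beta> i) \<le> (\<Sum>i<n. max 0 (- x i))"
  proof (rule sum_mono)
    fix i assume "i \<in> {..<n}"
    then have "- x i * \<beta> i \<le> max 0 (- x i) * \<beta> i" "max 0 (- x i) * \<beta> i \<le> max 0 (- x i) * 1"
      using \<beta>0[of i] \<beta>1[of i] mult_right_mono[of "- x i" "max 0 (- x i)" "\<beta> i"]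
        mult_left_mono[of "\<beta> i" 1 "max 0 (- x i)"] by auto
    then show "- x i * \<beta> i \<le> max 0 (- x i)" by linarith
  qed
  then show "1 - tdist \<tau> A \<le> F" using F1 td2 by (simp add: sum_negf)
  define S where "S = {i. i < n \<and> x i < 0}"
  have S: "S \<subseteq> {..<n}" "finite S" by (auto simp: S_def)
  have "F = Re (mtrace (B * T))"
    unfolding F_def B_def T_def mtrace_congruence[OF WD(1) c(2) c(1)] ..
  also have "mtrace (B * T) = cinner b (T *\<^sub>v b)"
  proof -
    have "mtrace (B * T) = (\<Sum>i<n. \<Sum>j<n. b $ i * cnj (b $ j) * T $$ (j,i))"
      unfolding mtrace_mult[OF psdD(2)[OF Bp(1)] psdD(2)[OF T]] by (simp add: b(3))
    also have "\<dots> = (\<Sum>j<n. \<Sum>i<n. cnj (b $ j) * T $$ (j,i) * b $ i)"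
      by (subst sum.swap) (simp add: mult_ac)
    finally show ?thesis using cinner_mat[OF psdD(2)[OF T] b(1) b(1)] by simp
  qed
  finally have "F \<le> 2 * ((\<Sum>i\<in>S. \<beta> i) * (\<Sum>i\<in>S. t i)) + 2 * ((\<Sum>i\<in>{..<n}-S. \<beta> i) * (\<Sum>i\<in>{..<n}-S. t i))"
    using psd_split_bound[OF T b(1) S(1)] by (simp add: \<beta>_def t_def)
  \<comment> \<open>In each product the larger of the two weights is replaced by 1. Since
    \<open>t i < \<beta> i\<close> exactly on \<open>S\<close>, twice the sum of
    \<open>min (t i) (\<beta> i)\<close> is left.\<close>
  also have "\<dots> \<le> 2 * (\<Sum>i\<in>S. t i) + 2 * (\<Sum>i\<in>{..<n}-S. \<beta> i)"
  proof -
    have s: "0 \<le> (\<Sum>i\<in>S'. \<beta> i)" "(\<Sum>i\<in>S'. \<beta> i) \<le> 1" "0 \<le> (\<Sum>i\<in>S'. t i)" "(\<Sum>i\<in>S'. t i) \<le> 1" if "S' \<subseteq> {..<n}" for S'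
      using sum_mono2[of "{..<n}" S' \<beta>] sum_mono2[of "{..<n}" S' t] that t0 \<beta>0 st s\<beta>
      by (auto intro!: sum_nonneg)
    show ?thesis
      using mult_right_mono[OF s(2,3)[OF S(1)]] mult_left_mono[OF s(4,1)[of "{..<n} - S"]] by auto
  qed
  also have "(\<Sum>i\<in>{..<n}-S. \<beta> i) = 1 - (\<Sum>i\<in>S. \<beta> i)"
    using sum_diff[OF finite_lessThan S(1), of \<beta>] s\<beta> by simp
  also have "2 * (\<Sum>i\<in>S. t i) + 2 * (1 - (\<Sum>i\<in>S. \<beta> i)) = 2 * (1 - (\<Sum>i\<in>S. - x i))"
  proof -
    have "(\<Sum>i\<in>S. - x i) = (\<Sum>i\<in>S. \<beta> i - t i)" using x by (intro sum.cong) (auto simp: S_def)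
    then show ?thesis by (simp add: sum_subtractf)
  qed
  also have "(\<Sum>i\<in>S. - x i) = tdist \<tau> A"
    unfolding td2 by (rule sum.mono_neutral_cong_left) (auto simp: S_def)
  finally show "F \<le> 2 * (1 - tdist \<tau> A)" .
qed

section \<open>The one-shot converse\<close>

lemma specdec_diff:
  assumes "specdec n A U d" "specdec n B U e"
  shows "specdec n (A - B) U (\<lambda>i. d i - e i)"
proof -
  note A = specdecD[OF assms(1)] and B = specdecD[OF assms(2)]
  have "rdiag n (\<lambda>i. d i - e i) = rdiag n d - rdiag n e" by (rule eq_matI) auto
  moreover have "adj (adj U) * (rdiag n d - rdiag n e) * adj U = A - B"
    by (subst congruence_minus[of _ n _ "adj U" n]) (use A(4) A(2) B(2) in auto)
  ultimately show ?thesis using A(1) by (simp add: specdec_def)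
qed

lemma specdec_smult:
  assumes "specdec n A U d"
  shows "specdec n (complex_of_real c \<cdot>\<^sub>m A) U (\<lambda>i. c * d i)"
proof -
  note A = specdecD[OF assms(1)]
  have "rdiag n (\<lambda>i. c * d i) = complex_of_real c \<cdot>\<^sub>m rdiag n d" by (rule eq_matI) auto
  moreover have "U * (complex_of_real c \<cdot>\<^sub>m rdiag n d) * adj U = complex_of_real c \<cdot>\<^sub>m (U * rdiag n d * adj U)"
    using A(4) by (simp add: mult_smult_distrib[of U n n _ n] mult_smult_assoc_mat[of _ n n "adj U" n])
  ultimately show ?thesis using A(1,2) by (simp add: specdec_def)
qed

lemma smult_minus_mat:
  fixes A B :: "complex mat"
  assumes "A \<in> carrier_mat n m" "B \<in> carrier_mat n m"
  shows "c \<cdot>\<^sub>m (A - B) = c \<cdot>\<^sub>m A - c \<cdot>\<^sub>m B"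
  by (rule eq_matI) (use assms in \<open>auto simp: algebra_simps\<close>)

text \<open>After pinching in an eigenbasis of \<open>\<sigma>\<close>, each diagonal entry
  \<open>p\<close> of \<open>\<tau>\<close> satisfies both \<open>p \<le> 1\<close> and
  \<open>a * p \<le> q\<close>, hence \<open>p \<le> p powr s \<le> (q / a) powr s\<close>. For the
  pinched state this is an operator inequality, because it commutes with
  \<open>\<sigma>\<close>.\<close>

lemma dominated_state_bound:
  assumes \<tau>: "density m \<tau>" and \<sigma>: "specdec m \<sigma> V \<delta>" and K: "real (card (\<delta> ` {..<m})) \<le> K"
    and a: "a > 0" and dom: "psd m (\<sigma> - complex_of_real a \<cdot>\<^sub>m \<tau>)" and s: "0 < s" "s < 1" and A: "psd m A"
  shows "Re (mtrace (A * \<tau>)) \<le> K * a powr (-s) * Re (mtrace (A * mpow s \<sigma>))"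
proof -
  have \<tau>p: "psd m \<tau>" and \<tau>t: "mtrace \<tau> = 1" using \<tau> by (auto simp: density_def)
  have K0: "K \<ge> 0" using K by linarith
  obtain U q P where U: "specdec m \<sigma> U q" and P: "specdec m P U (\<lambda>i. Re ((adj U * \<tau> * U) $$ (i,i)))"
    and KP: "psd m (complex_of_real K \<cdot>\<^sub>m P - \<tau>)" using pinched_eigenbasis[OF \<tau>p \<sigma> K] by blast
  note UD = specdecD[OF U]
  let ?R = "adj U * \<tau> * U"
  have R: "psd m ?R" by (rule psd_congruence[OF \<tau>p UD(4)])
  have R0: "0 \<le> Re (?R $$ (i,i))" if "i < m" for i by (rule psd_diag(1)[OF R that])
  have "mtrace ?R = 1" using mtrace_cong_unitary[OF unitary_adj[OF UD(1)] psdD(2)[OF \<tau>p]] \<tau>t by simp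
  then have Rsum: "(\<Sum>i<m. Re (?R $$ (i,i))) = 1"
    unfolding mtrace_carrier[OF psdD(2)[OF R]] by (metis Re_sum one_complex.sel(1))
  have R1: "Re (?R $$ (i,i)) \<le> 1" if "i < m" for i
    using member_le_sum[of i "{..<m}" "\<lambda>i. Re (?R $$ (i,i))"] R0 that Rsum by auto
  have Rq: "a * Re (?R $$ (i,i)) \<le> q i" if "i < m" for i
  proof -
    have "adj U * (complex_of_real a \<cdot>\<^sub>m \<tau>) * U = complex_of_real a \<cdot>\<^sub>m ?R"
    proof -
      have "adj U * \<tau> \<in> carrier_mat m m" using UD(7,8) psdD(3,4)[OF \<tau>p] by (intro carrier_matI) auto
      then show ?thesis
        using UD(4) psdD(2)[OF \<tau>p] mult_smult_distrib[of "adj U" m m \<tau> m a] mult_smult_assoc_mat[of "adj U * \<tau>" m m U m a]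
        by simp
    qed
    moreover have "complex_of_real a \<cdot>\<^sub>m \<tau> \<in> carrier_mat m m" using psdD(2)[OF \<tau>p] by simp
    ultimately show ?thesis
      using psd_diag_mono[OF dom _ UD(3,4) that] specdec_diag[OF U that] that UD(8) by simp
  qed
  have "Re (?R $$ (i,i)) \<le> a powr (-s) * q i powr s" if i: "i < m" for i
  proof -
    let ?p = "Re (?R $$ (i,i))"
    have "?p \<le> ?p powr s"
    proof (cases "?p = 0")
      case False
      then have "?p powr 1 \<le> ?p powr s" using R0[OF i] R1[OF i] s by (intro powr_mono') auto
      then show ?thesis using False R0[OF i] by simp
    qed simp
    also have "\<dots> \<le> (q i / a) powr s"
      using Rq[OF i] R0[OF i] s a by (intro powr_mono2) (auto simp: field_simps)
    also have "\<dots> = a powr (-s) * q i powr s"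
    proof -
      have "0 \<le> q i" using Rq[OF i] R0[OF i] a by (smt (verit) mult_nonneg_nonneg)
      then show ?thesis using a by (simp add: powr_divide powr_minus field_simps)
    qed
    finally show ?thesis .
  qed
  then have "psd m (complex_of_real (a powr (-s)) \<cdot>\<^sub>m mpow s \<sigma> - P)"
    using psd_specdec[OF specdec_diff[OF specdec_smult[OF specdec_mpow[OF U, of s], of "a powr (-s)"] P]] by auto
  from psd_smult[OF this K0]
  have "Re (mtrace (A * (complex_of_real K \<cdot>\<^sub>m P))) \<le> Re (mtrace (A * (complex_of_real K \<cdot>\<^sub>m (complex_of_real (a powr (-s)) \<cdot>\<^sub>m mpow s \<sigma>))))"
  proof -
    let ?X = "complex_of_real (a powr (-s)) \<cdot>\<^sub>m mpow s \<sigma>"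
    have c: "?X \<in> carrier_mat m m" "P \<in> carrier_mat m m"
      using specdecD(3)[OF specdec_mpow[OF U, of s]] specdecD(3)[OF P] by auto
    have "complex_of_real K \<cdot>\<^sub>m (?X - P) = complex_of_real K \<cdot>\<^sub>m ?X - complex_of_real K \<cdot>\<^sub>m P"
      by (rule smult_minus_mat[OF c])
    then show ?thesis using psd_smult[OF \<open>psd m (?X - P)\<close> K0] c by (intro psd_mtrace_mono[OF A]) auto
  qed
  moreover have "Re (mtrace (A * \<tau>)) \<le> Re (mtrace (A * (complex_of_real K \<cdot>\<^sub>m P)))"
    by (rule psd_mtrace_mono[OF A KP psdD(2)[OF \<tau>p]]) (use specdecD(3)[OF P] in simp)
  moreover have "mtrace (A * (complex_of_real K \<cdot>\<^sub>m (complex_of_real (a powr (-s)) \<cdot>\<^sub>m mpow s \<sigma>)))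
     = complex_of_real (K * a powr (-s)) * mtrace (A * mpow s \<sigma>)"
    using specdecD(3)[OF specdec_mpow[OF U, of s]] psdD(2)[OF A] by (simp add: mtrace_mult_smult[of _ m])
  ultimately show ?thesis by simp
qed

section \<open>Channels and linear functionals of the input\<close>

lemma channelD:
  assumes "channel n m \<Phi>"
  shows "X \<in> carrier_mat n n \<Longrightarrow> \<Phi> X \<in> carrier_mat m m"
    "X \<in> carrier_mat n n \<Longrightarrow> Y \<in> carrier_mat n n \<Longrightarrow> \<Phi> (X + Y) = \<Phi> X + \<Phi> Y"
    "X \<in> carrier_mat n n \<Longrightarrow> \<Phi> (c \<cdot>\<^sub>m X) = c \<cdot>\<^sub>m \<Phi> X"
    "X \<in> carrier_mat n n \<Longrightarrow> mtrace (\<Phi> X) = mtrace X"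
  using assms by (auto simp: channel_def)

lemma channel_psd:
  assumes "channel n m \<Phi>" "psd n X"
  shows "psd m (\<Phi> X)"
proof -
  note X = psdD[OF assms(2)]
  have "psd (1 * m) (ampl 1 n m \<Phi> X)" using assms unfolding channel_def by (metis mult_1)
  moreover have "blk n X 0 0 = X" by (rule eq_matI) (use X(3,4) in \<open>auto simp: blk_def\<close>)
  then have "ampl 1 n m \<Phi> X = \<Phi> X"
    by (intro eq_matI) (use channelD(1)[OF assms(1) X(2)] in \<open>auto simp: ampl_def\<close>)
  ultimately show ?thesis by simp
qed

lemma channel_minus:
  assumes "channel n m \<Phi>" "X \<in> carrier_mat n n" "Y \<in> carrier_mat n n"
  shows "\<Phi> (X - Y) = \<Phi> X - \<Phi> Y"
proof -
  have "X - Y = X + (-1) \<cdot>\<^sub>m Y" by (rule eq_matI) (use assms in auto)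
  then have "\<Phi> (X - Y) = \<Phi> X + (-1) \<cdot>\<^sub>m \<Phi> Y" using assms by (simp add: channelD(2,3)[OF assms(1)])
  also have "\<dots> = \<Phi> X - \<Phi> Y"
    by (rule eq_matI) (use channelD(1)[OF assms(1) assms(2)] channelD(1)[OF assms(1) assms(3)] in auto)
  finally show ?thesis .
qed

lemma dyadic_level:
  fixes f :: real
  assumes "f \<le> 1" "(1/2)^J < f"
  shows "\<exists>j<J. (1/2)^(Suc j) < f \<and> f \<le> (1/2)^j"
  using assms
proof (induction J)
  case (Suc J)
  show ?case
  proof (cases "(1/2)^J < f")
    case True
    then show ?thesis using Suc.IH Suc.prems(1) less_Suc_eq by blast
  next
    case False
    then show ?thesis using Suc.prems by (intro exI[of _ J]) auto
  qed
qed simp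

text \<open>The overlap with the target as a function of the input is of this kind; on inputs
  diagonal in \<open>U\<close> it becomes a classical expectation. Only real scalars are extracted,
  since a real part is taken.\<close>

lemma functional_rdiag:
  fixes g :: "complex mat \<Rightarrow> real"
  assumes add: "\<And>X Y. X \<in> carrier_mat n n \<Longrightarrow> Y \<in> carrier_mat n n \<Longrightarrow> g (X + Y) = g X + g Y"
    and sc: "\<And>c X. X \<in> carrier_mat n n \<Longrightarrow> g (complex_of_real c \<cdot>\<^sub>m X) = c * g X"
    and U: "U \<in> carrier_mat n n"
  shows "g (U * rdiag n d * adj U) = (\<Sum>i<n. d i * g (U * rdiag n (\<lambda>j. if j = i then 1 else 0) * adj U))"
proof -
  have "g (U * rdiag n (\<lambda>j. if j < k then d j else 0) * adj U)
    = (\<Sum>i<k. d i * g (U * rdiag n (\<lambda>j. if j = i then 1 else 0) * adj U))" if "k \<le> n" for k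
    using that
  proof (induction k)
    case 0
    have "rdiag n (\<lambda>j. if j < 0 then d j else 0) = complex_of_real 0 \<cdot>\<^sub>m 1\<^sub>m n" by (rule eq_matI) auto
    then have "U * rdiag n (\<lambda>j. if j < 0 then d j else 0) * adj U = complex_of_real 0 \<cdot>\<^sub>m (U * 1\<^sub>m n * adj U)"
      using U by (simp only: mult_smult_distrib[of U n n _ n] mult_smult_assoc_mat[of _ n n "adj U" n] one_carrier_mat mult_carrier_mat adj_carrier)
    moreover have "U * 1\<^sub>m n * adj U \<in> carrier_mat n n" using U by (intro carrier_matI) auto
    ultimately show ?case using sc[of "U * 1\<^sub>m n * adj U" 0] by simp
  next
    case (Suc k)
    let ?D = "rdiag n (\<lambda>j. if j < k then d j else 0)" and ?E = "rdiag n (\<lambda>j. if j = k then 1 else 0)"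
    have "rdiag n (\<lambda>j. if j < Suc k then d j else 0) = ?D + complex_of_real (d k) \<cdot>\<^sub>m ?E"
      by (rule eq_matI) (auto simp: less_Suc_eq)
    then have "U * rdiag n (\<lambda>j. if j < Suc k then d j else 0) * adj U = U * (?D + complex_of_real (d k) \<cdot>\<^sub>m ?E) * adj U" by simp
    also have "\<dots> = (U * ?D + U * (complex_of_real (d k) \<cdot>\<^sub>m ?E)) * adj U"
      using U by (subst mult_add_distrib_mat[of U n n _ n]) auto
    also have "\<dots> = U * ?D * adj U + U * (complex_of_real (d k) \<cdot>\<^sub>m ?E) * adj U"
      by (rule add_mult_distrib_mat[of _ n n _ _ n]) (use U in \<open>auto intro!: carrier_matI\<close>)
    also have "U * (complex_of_real (d k) \<cdot>\<^sub>m ?E) * adj U = complex_of_real (d k) \<cdot>\<^sub>m (U * ?E * adj U)"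
      using U by (simp add: mult_smult_distrib[of U n n _ n] mult_smult_assoc_mat[of _ n n "adj U" n])
    finally have "U * rdiag n (\<lambda>j. if j < Suc k then d j else 0) * adj U
      = U * ?D * adj U + complex_of_real (d k) \<cdot>\<^sub>m (U * ?E * adj U)" .
    moreover have "U * ?D * adj U \<in> carrier_mat n n" "U * ?E * adj U \<in> carrier_mat n n"
      using U by (auto intro!: carrier_matI)
    ultimately show ?case using Suc by (simp add: add sc)
  qed
  from this[of n] show ?thesis
    using diag_of_cong[of n "\<lambda>j. complex_of_real (if j < n then d j else 0)" "\<lambda>j. complex_of_real (d j)"] by simp
qed

text \<open>Hoelder on the set where \<open>\<sigma>\<close> has positive eigenvalues: domination
  places the whole weight 1 of \<open>\<rho>\<close> there, and the weight under
  \<open>\<sigma>\<close> is 1 as well. The bound serves to absorb error terms and to keep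
  logarithms nonnegative.\<close>

lemma sandQ_ge_1:
  assumes \<rho>: "density n \<rho>" and \<sigma>: "density n \<sigma>" and dom: "psd n (complex_of_real c \<cdot>\<^sub>m \<sigma> - \<rho>)" and \<beta>: "\<beta> > 1"
  shows "1 \<le> sandQ \<beta> \<rho> \<sigma>"
proof -
  have \<rho>p: "psd n \<rho>" and \<rho>t: "mtrace \<rho> = 1" using \<rho> by (auto simp: density_def)
  have \<sigma>p: "psd n \<sigma>" and \<sigma>t: "mtrace \<sigma> = 1" using \<sigma> by (auto simp: density_def)
  obtain U q where U: "specdec n \<sigma> U q" "\<forall>i<n. 0 \<le> q i" using psd_obtain[OF \<sigma>p] by blast
  note UD = specdecD[OF U(1)]
  define p where "p i = Re ((adj U * \<rho> * U) $$ (i,i))" for i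
  have R: "psd n (adj U * \<rho> * U)" by (rule psd_congruence[OF \<rho>p UD(4)])
  have p0: "0 \<le> p i" if "i < n" for i unfolding p_def by (rule psd_diag(1)[OF R that])
  have "mtrace (adj U * \<rho> * U) = 1" using mtrace_cong_unitary[OF unitary_adj[OF UD(1)] psdD(2)[OF \<rho>p]] \<rho>t by simp
  then have ps: "(\<Sum>i<n. p i) = 1"
    unfolding mtrace_carrier[OF psdD(2)[OF R]] p_def by (metis Re_sum one_complex.sel(1))
  have qs: "(\<Sum>i<n. q i) = 1" using mtrace_specdec[OF U(1)] \<sigma>t by (metis of_real_eq_1_iff)
  have pq: "p i = 0" if "i < n" "q i = 0" for i
  proof -
    have "p i \<le> Re ((adj U * (complex_of_real c \<cdot>\<^sub>m \<sigma>) * U) $$ (i,i))"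
      unfolding p_def by (rule psd_diag_mono[OF dom psdD(2)[OF \<rho>p] _ UD(4) that(1)]) (use UD(3) in simp)
    also have "\<dots> = c * q i"
      using specdec_diag[OF specdec_smult[OF U(1), of c] that(1)] by simp
    finally show ?thesis using p0[OF that(1)] that(2) by simp
  qed
  define S where "S = {i. i < n \<and> q i > 0}"
  have S: "finite S" "S \<subseteq> {..<n}" by (auto simp: S_def)
  have "1 = sum p S"
    unfolding ps[symmetric] using pq U(2) by (intro sum.mono_neutral_right) (auto simp: S_def less_le)
  also have "\<dots> \<le> (\<Sum>k\<in>S. (q k powr ((1 - \<beta>) / \<beta>) * p k) powr \<beta>) powr (1/\<beta>) * (sum q S) powr ((\<beta> - 1) / \<beta>)"
    using p0 by (intro holder_sum[OF \<beta> S(1)]) (auto simp: S_def)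
  also have "sum q S = 1"
    unfolding qs[symmetric] using U(2) by (intro sum.mono_neutral_left) (auto simp: S_def less_le)
  finally have "1 \<le> (\<Sum>k\<in>S. (q k powr ((1 - \<beta>) / \<beta>) * p k) powr \<beta>) powr (1/\<beta>)" by simp
  then have "1 powr \<beta> \<le> ((\<Sum>k\<in>S. (q k powr ((1 - \<beta>) / \<beta>) * p k) powr \<beta>) powr (1/\<beta>)) powr \<beta>"
    using \<beta> by (intro powr_mono2) auto
  also have "\<dots> = (\<Sum>k\<in>S. (q k powr ((1 - \<beta>) / \<beta>) * p k) powr \<beta>)"
    using \<beta> by (simp add: powr_powr sum_nonneg)
  also have "\<dots> \<le> (\<Sum>k<n. (q k powr ((1 - \<beta>) / \<beta>) * p k) powr \<beta>)"
    using S by (intro sum_mono2) auto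
  also have "\<dots> \<le> sandQ \<beta> \<rho> \<sigma>" unfolding p_def by (rule sandQ_lower[OF \<rho>p \<sigma>p U(1) \<beta>])
  finally show ?thesis by simp
qed

text \<open>The level sets of \<open>f\<close> (the overlap as a function of the eigenvector) are handled one at a time. On a level set \<open>S\<close> of weight \<open>a\<close> under
  \<open>\<sigma>\<close>, Hoelder bounds the weight under \<open>\<rho>\<close> by \<open>N * a powr s\<close>, while the normalised output \<open>\<tau>\<close> of the
  restriction of \<open>\<sigma>\<close> to \<open>S\<close> satisfies \<open>a * \<tau> \<le> \<sigma>'\<close>, so that its overlap with \<open>A\<close> is at most
  \<open>K2 * a powr (-s) * v\<close>: the powers of \<open>a\<close> cancel.\<close>
lemma converse_oneshot:
  assumes \<rho>: "density n \<rho>" and \<sigma>: "density n \<sigma>" and dom: "psd n (complex_of_real c \<cdot>\<^sub>m \<sigma> - \<rho>)"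
    and V: "specdec n \<sigma> V \<delta>" and K1: "real (card (\<delta> ` {..<n})) \<le> K1"
    and V': "specdec m \<sigma>' V' \<delta>'" and K2: "real (card (\<delta>' ` {..<m})) \<le> K2"
    and \<Phi>: "channel n m \<Phi>" "\<Phi> \<sigma> = \<sigma>'"
    and A: "psd m A" "psd m (1\<^sub>m m - A)"
    and \<beta>: "\<beta> > 1"
  defines "v \<equiv> Re (mtrace (A * mpow ((\<beta> - 1) / \<beta>) \<sigma>'))"
  defines "N \<equiv> sandQ \<beta> \<rho> \<sigma> powr (1 / \<beta>)"
  assumes J: "(1/2)^J \<le> v"
  shows "Re (mtrace (A * \<Phi> \<rho>)) \<le> K1 * (2 * real J * K2 + 1) * N * v"
proof -
  have \<rho>p: "psd n \<rho>" and \<rho>t: "mtrace \<rho> = 1" using \<rho> by (auto simp: density_def)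
  have \<sigma>p: "psd n \<sigma>" and \<sigma>t: "mtrace \<sigma> = 1" using \<sigma> by (auto simp: density_def)
  define s where "s = (\<beta> - 1) / \<beta>"
  have s: "0 < s" "s < 1" using \<beta> by (auto simp: s_def)
  have K10: "K1 \<ge> 0" and K20: "K2 \<ge> 0" using K1 K2 by linarith+
  have v0: "v > 0" 
  proof -
    have "(0::real) < (1/2)^J" by simp
    then show ?thesis using J by linarith
  qed
  obtain U q P where U: "specdec n \<sigma> U q" and P: "specdec n P U (\<lambda>i. Re ((adj U * \<rho> * U) $$ (i,i)))"
    and KP: "psd n (complex_of_real K1 \<cdot>\<^sub>m P - \<rho>)" using pinched_eigenbasis[OF \<rho>p V K1] by blast
  note UD = specdecD[OF U] and PD = specdecD[OF P]
  define p where "p i = Re ((adj U * \<rho> * U) $$ (i,i))" for i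
  have R: "psd n (adj U * \<rho> * U)" by (rule psd_congruence[OF \<rho>p UD(4)])
  have p0: "0 \<le> p i" if "i < n" for i unfolding p_def by (rule psd_diag(1)[OF R that])
  have q0: "0 \<le> q i" if "i < n" for i using psd_specdec[OF U] \<sigma>p that by auto
  have "mtrace (adj U * \<rho> * U) = 1" using mtrace_cong_unitary[OF unitary_adj[OF UD(1)] psdD(2)[OF \<rho>p]] \<rho>t by simp
  then have ps: "(\<Sum>i<n. p i) = 1"
    unfolding mtrace_carrier[OF psdD(2)[OF R]] p_def by (metis Re_sum one_complex.sel(1))
  have qs: "(\<Sum>i<n. q i) = 1" using mtrace_specdec[OF U] \<sigma>t by (metis of_real_eq_1_iff)
  have pq: "p i = 0" if "i < n" "q i = 0" for i
  proof -
    have "p i \<le> Re ((adj U * (complex_of_real c \<cdot>\<^sub>m \<sigma>) * U) $$ (i,i))"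
      unfolding p_def by (rule psd_diag_mono[OF dom psdD(2)[OF \<rho>p] _ UD(4) that(1)]) (use UD(3) in simp)
    also have "\<dots> = c * q i"
      using specdec_diag[OF specdec_smult[OF U, of c] that(1)] by simp
    finally show ?thesis using p0[OF that(1)] that(2) by simp
  qed
  define g where "g X = Re (mtrace (A * \<Phi> X))" for X
  have gadd: "g (X + Y) = g X + g Y" if "X \<in> carrier_mat n n" "Y \<in> carrier_mat n n" for X Y
    unfolding g_def channelD(2)[OF \<Phi>(1) that]
    by (simp add: mtrace_mult_add[OF channelD(1)[OF \<Phi>(1) that(1)] channelD(1)[OF \<Phi>(1) that(2)] psdD(2)[OF A(1)]])
  have gsc: "g (complex_of_real c \<cdot>\<^sub>m X) = c * g X" if "X \<in> carrier_mat n n" for c X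
    unfolding g_def channelD(3)[OF \<Phi>(1) that]
    by (simp add: mtrace_mult_smult[OF channelD(1)[OF \<Phi>(1) that] psdD(2)[OF A(1)]])
  have gpos: "0 \<le> g X" if "psd n X" for X
    unfolding g_def by (rule psd_mtrace_mult[OF A(1) channel_psd[OF \<Phi>(1) that]])
  have gtr: "g X \<le> Re (mtrace X)" if "psd n X" for X
  proof -
    have X: "psd m (\<Phi> X)" by (rule channel_psd[OF \<Phi>(1) that])
    have "0 \<le> Re (mtrace (\<Phi> X * (1\<^sub>m m - A)))" by (rule psd_mtrace_mult[OF X A(2)])
    also have "mtrace (\<Phi> X * (1\<^sub>m m - A)) = mtrace (\<Phi> X) - mtrace (A * \<Phi> X)"
      using mtrace_mult_minus[OF one_carrier_mat psdD(2)[OF A(1)] psdD(2)[OF X]]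
        mtrace_comm[OF psdD(2)[OF A(1)] psdD(2)[OF X]] psdD(4)[OF X] by simp
    finally show ?thesis using channelD(4)[OF \<Phi>(1) psdD(2)[OF that]] by (simp add: g_def)
  qed
  let ?e = "\<lambda>i. U * rdiag n (\<lambda>j. if j = i then 1 else 0) * adj U"
  have esd: "specdec n (?e i) U (\<lambda>j. if j = i then 1 else 0)" for i using UD(1) by (simp add: specdec_def)
  have ep: "psd n (?e i)" for i using psd_specdec[OF esd] by auto
  define f where "f i = g (?e i)" for i
  have f0: "0 \<le> f i" for i unfolding f_def by (rule gpos[OF ep])
  have f1: "f i \<le> 1" if "i < n" for i
    using gtr[OF ep, of i] mtrace_specdec[OF esd, of i] that unfolding f_def by simp
  have gdiag: "g (U * rdiag n d * adj U) = (\<Sum>i<n. d i * f i)" for d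
    unfolding f_def by (rule functional_rdiag[OF gadd gsc UD(4)])
  have gP: "g P = (\<Sum>i<n. p i * f i)" 
  proof -
    have "P = U * rdiag n p * adj U" unfolding p_def by (rule PD(2))
    from arg_cong[OF this, of g] show ?thesis unfolding gdiag .
  qed
  have N0: "N \<ge> 0" by (simp add: N_def)
  have hold: "sum p S \<le> N * (sum q S) powr s" if S: "S \<subseteq> {..<n}" "\<forall>i\<in>S. q i > 0" for S
  proof -
    have fS: "finite S" using S(1) finite_subset by auto
    have "sum p S \<le> (\<Sum>k\<in>S. (q k powr ((1 - \<beta>) / \<beta>) * p k) powr \<beta>) powr (1/\<beta>) * (sum q S) powr ((\<beta> - 1) / \<beta>)"
      using S p0 by (intro holder_sum[OF \<beta> fS]) auto
    also have "\<dots> \<le> N * (sum q S) powr ((\<beta> - 1) / \<beta>)"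
    proof (intro mult_right_mono)
      have "(\<Sum>k\<in>S. (q k powr ((1 - \<beta>) / \<beta>) * p k) powr \<beta>) \<le> (\<Sum>k<n. (q k powr ((1 - \<beta>) / \<beta>) * p k) powr \<beta>)"
        using S by (intro sum_mono2) auto
      also have "\<dots> \<le> sandQ \<beta> \<rho> \<sigma>" unfolding p_def by (rule sandQ_lower[OF \<rho>p \<sigma>p U \<beta>])
      finally show "(\<Sum>k\<in>S. (q k powr ((1 - \<beta>) / \<beta>) * p k) powr \<beta>) powr (1/\<beta>) \<le> N"
        unfolding N_def using \<beta> by (intro powr_mono2) (auto intro: sum_nonneg)
    qed auto
    finally show ?thesis by (simp add: s_def)
  qed
  have level: "(1/2)^j * sum p S \<le> 2 * K2 * N * v"
    if S: "S \<subseteq> {..<n}" "\<forall>i\<in>S. q i > 0" "\<forall>i\<in>S. (1/2)^(Suc j) < f i" for S j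
  proof (cases "S = {}")
    case True
    then show ?thesis using K20 N0 v0 by simp
  next
    case False
    have fS: "finite S" using S(1) finite_subset by auto
    define a where "a = sum q S"
    have a: "a > 0" unfolding a_def using S fS False by (intro sum_pos) auto
    define E where "E = U * rdiag n (\<lambda>i. if i \<in> S then q i else 0) * adj U"
    have Esd: "specdec n E U (\<lambda>i. if i \<in> S then q i else 0)" using UD(1) by (simp add: specdec_def E_def)
    have Ep: "psd n E" using psd_specdec[OF Esd] q0 by auto
    have SE: "psd n (\<sigma> - E)" using psd_specdec[OF specdec_diff[OF U Esd]] q0 by auto
    have sumS: "(\<Sum>i<n. if i \<in> S then h i else 0) = sum h S" for h :: "nat \<Rightarrow> real"
      using S(1) by (simp add: sum.If_cases Int_absorb1 Collect_mem_eq)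
    have Et: "mtrace E = complex_of_real a" using mtrace_specdec[OF Esd] unfolding sumS a_def .
    define \<tau> where "\<tau> = complex_of_real (1/a) \<cdot>\<^sub>m \<Phi> E"
    have \<Phi>E: "psd m (\<Phi> E)" by (rule channel_psd[OF \<Phi>(1) Ep])
    have "density m \<tau>"
      unfolding density_def \<tau>_def using a \<Phi>E Et channelD(4)[OF \<Phi>(1) psdD(2)[OF Ep]]
      by (simp add: psd_smult[of _ _ "1/a", simplified] mtrace_smult[OF psdD(2)[OF \<Phi>E]])
    moreover have "complex_of_real a \<cdot>\<^sub>m \<tau> = \<Phi> E"
      unfolding \<tau>_def by (rule eq_matI) (use a in auto)
    then have "psd m (\<sigma>' - complex_of_real a \<cdot>\<^sub>m \<tau>)"
      using channel_psd[OF \<Phi>(1) SE] channel_minus[OF \<Phi>(1) UD(3) psdD(2)[OF Ep]] \<Phi>(2) by simp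
    ultimately have "Re (mtrace (A * \<tau>)) \<le> K2 * a powr (-s) * v"
      unfolding v_def using dominated_state_bound[OF _ V' K2 a _ s A(1)] by (simp add: s_def)
    moreover have "Re (mtrace (A * \<tau>)) = g E / a"
      unfolding \<tau>_def g_def by (simp add: mtrace_mult_smult[OF psdD(2)[OF \<Phi>E] psdD(2)[OF A(1)]])
    \<comment> \<open>\<open>g E / a\<close> is the mean of \<open>f\<close> over the level set with
      weights \<open>q\<close>, so it inherits the lower bound on \<open>f\<close>.\<close>
    moreover have "(1/2)^(Suc j) * a \<le> g E"
    proof -
      have "(1/2)^(Suc j) * a = (\<Sum>i\<in>S. (1/2)^(Suc j) * q i)" by (simp add: a_def sum_distrib_left)
      also have "\<dots> \<le> (\<Sum>i\<in>S. q i * f i)"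
      proof (rule sum_mono)
        fix i assume "i \<in> S"
        then show "(1/2)^(Suc j) * q i \<le> q i * f i"
          using S by (subst mult.commute, intro mult_left_mono) (auto intro: less_imp_le)
      qed
      also have "\<dots> = (\<Sum>i<n. (if i \<in> S then q i else 0) * f i)"
        using sumS[of "\<lambda>i. q i * f i"] by (simp add: if_distrib[of "\<lambda>x. x * _"] cong: if_cong)
      also have "\<dots> = g E" unfolding E_def gdiag ..
      finally show ?thesis .
    qed
    then have "(1/2)^(Suc j) \<le> g E / a" using a by (simp only: pos_le_divide_eq)
    ultimately have lo: "(1/2)^(Suc j) \<le> K2 * a powr (-s) * v" by linarith
    \<comment> \<open>The upper end \<open>(1/2)^j\<close> of a level is twice the lower end
      occurring in \<open>lo\<close>.\<close>
    have "(1/2)^j * sum p S \<le> (2 * (K2 * a powr (-s) * v)) * (N * a powr s)"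
      using lo hold[OF S(1,2)] p0 S(1) K20 v0 by (intro mult_mono) (auto simp: a_def intro!: sum_nonneg)
    also have "\<dots> = 2 * K2 * N * v" using a by (simp add: powr_minus field_simps)
    finally show ?thesis .
  qed
  define S where "S j = {i. i < n \<and> q i > 0 \<and> (1/2)^(Suc j) < f i \<and> f i \<le> (1/2)^j}" for j
  \<comment> \<open>Indices with \<open>p i = 0\<close> need no level, and all others have
    \<open>q i > 0\<close> by domination. Values \<open>f i \<le> (1/2)^J\<close> are not sorted at
    all and go into the remainder.\<close>
  have bound: "p i * f i \<le> (\<Sum>j<J. if i \<in> S j then (1/2)^j * p i else 0) + p i * (1/2)^J" if i: "i < n" for i
  proof (cases "p i = 0 \<or> f i \<le> (1/2)^J")
    case True
    have "0 \<le> (\<Sum>j<J. if i \<in> S j then (1/2)^j * p i else 0)" using p0[OF i] by (intro sum_nonneg) auto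
    moreover have "p i * f i \<le> p i * (1/2)^J" using True p0[OF i] by (cases "p i = 0") (auto intro: mult_left_mono)
    ultimately show ?thesis by linarith
  next
    case False
    then have "q i > 0" using pq[OF i] q0[OF i] by (cases "q i = 0") auto
    obtain j where j: "j < J" "(1/2)^(Suc j) < f i" "f i \<le> (1/2)^j"
      using dyadic_level[OF f1[OF i], of J] False by auto
    have iS: "i \<in> S j" using j i \<open>q i > 0\<close> by (simp add: S_def)
    have "p i * f i \<le> (1/2)^j * p i" using j p0[OF i] by (subst mult.commute, intro mult_right_mono) auto
    also have "\<dots> \<le> (\<Sum>j<J. if i \<in> S j then (1/2)^j * p i else 0)"
      using member_le_sum[of j "{..<J}" "\<lambda>j. if i \<in> S j then (1/2)^j * p i else 0"] j iS p0[OF i] by simp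
    finally show ?thesis using p0[OF i] by (simp add: add_increasing2)
  qed
  have "g P \<le> (\<Sum>i<n. (\<Sum>j<J. if i \<in> S j then (1/2)^j * p i else 0) + p i * (1/2)^J)"
    unfolding gP using bound by (intro sum_mono) auto
  also have "\<dots> = (\<Sum>j<J. \<Sum>i<n. if i \<in> S j then (1/2)^j * p i else 0) + (1/2)^J"
    unfolding sum.distrib by (subst sum.swap) (simp add: ps flip: sum_distrib_right sum_divide_distrib)
  also have "(\<Sum>j<J. \<Sum>i<n. if i \<in> S j then (1/2)^j * p i else 0) = (\<Sum>j<J. (1/2)^j * sum p (S j))"
  proof (rule sum.cong[OF refl])
    fix j
    have "S j \<subseteq> {..<n}" by (auto simp: S_def)
    then have "(\<Sum>i<n. if i \<in> S j then (1/2)^j * p i else 0) = (\<Sum>i\<in>S j. (1/2)^j * p i)"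
      by (simp add: sum.If_cases Int_absorb1 Collect_mem_eq)
    then show "(\<Sum>i<n. if i \<in> S j then (1/2)^j * p i else 0) = (1/2)^j * sum p (S j)"
      by (simp add: sum_distrib_left)
  qed
  also have "(\<Sum>j<J. (1/2)^j * sum p (S j)) \<le> (\<Sum>j<J. 2 * K2 * N * v)"
    by (intro sum_mono level) (auto simp: S_def)
  \<comment> \<open>The remainder is at most \<open>v\<close> by the hypothesis on \<open>J\<close>,
    hence at most \<open>N * v\<close>.\<close>
  also have "(\<Sum>j<J. 2 * K2 * N * v) + (1/2)^J \<le> 2 * real J * K2 * N * v + N * v"
  proof -
    have "1 \<le> N" unfolding N_def using sandQ_ge_1[OF \<rho> \<sigma> dom \<beta>] \<beta> by (intro ge_one_powr_ge_zero) auto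
    then have "v \<le> N * v" using v0 by simp
    then show ?thesis using J by simp
  qed
  finally have "g P \<le> (2 * real J * K2 + 1) * N * v" by (simp add: algebra_simps)
  then have "K1 * g P \<le> K1 * ((2 * real J * K2 + 1) * N * v)" using K10 by (rule mult_left_mono)
  \<comment> \<open>The functional is positive, so the pinching inequality passes from operators to
    overlaps.\<close>
  moreover have "g \<rho> \<le> K1 * g P"
  proof -
    have c: "complex_of_real K1 \<cdot>\<^sub>m P \<in> carrier_mat n n" using PD(3) by simp
    have "0 \<le> g (complex_of_real K1 \<cdot>\<^sub>m P - \<rho>)" by (rule gpos[OF KP])
    also have "\<dots> = g (complex_of_real K1 \<cdot>\<^sub>m P) - g \<rho>"
      unfolding g_def channel_minus[OF \<Phi>(1) c psdD(2)[OF \<rho>p]]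
      using mtrace_mult_minus[OF channelD(1)[OF \<Phi>(1) c] channelD(1)[OF \<Phi>(1) psdD(2)[OF \<rho>p]] psdD(2)[OF A(1)]] by simp
    finally show ?thesis using gsc[OF PD(3)] by simp
  qed
  ultimately show ?thesis by (simp add: g_def mult.assoc)
qed

section \<open>Measure-and-prepare channels\<close>

lemma mtrace_adj: "A \<in> carrier_mat n n \<Longrightarrow> mtrace (adj A) = cnj (mtrace A)"
  by (simp add: mtrace_def)

lemma blk_carrier [simp]: "blk m X a b \<in> carrier_mat m m"
  by (simp add: blk_def)

lemma block_index_less: "a < k \<Longrightarrow> b < m \<Longrightarrow> a * m + b < k * (m::nat)"
proof -
  assume "a < k" "b < m"
  then have "a * m + b < Suc a * m" by simp
  also have "\<dots> \<le> k * m" using \<open>a < k\<close> by (intro mult_le_mono1) auto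
  finally show ?thesis .
qed

text \<open>This is the partial trace of \<open>X\<close> against \<open>T\<close> on the second
  factor. Diagonalising \<open>T\<close> turns its quadratic form at \<open>v\<close> into a sum,
  weighted by the eigenvalues \<open>t x\<close>, of quadratic forms of \<open>X\<close> at the
  product vectors \<open>w x\<close> of \<open>v\<close> with an eigenvector.\<close>

lemma psd_partial_trace:
  assumes T: "psd m T" and X: "psd (k * m) X"
  shows "psd k (mat k k (\<lambda>(a,a'). mtrace (T * blk m X a a')))" (is "psd k ?Y")
proof -
  obtain U t where U: "specdec m T U t" "\<forall>i<m. 0 \<le> t i" using psd_obtain[OF T] by blast
  note UD = specdecD[OF U(1)]
  have herm: "hermitian k ?Y"
    unfolding hermitian_def
  proof (intro conjI eq_matI)
    fix a a' assume "a < dim_row ?Y" "a' < dim_col ?Y"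
    then have a: "a < k" "a' < k" by auto
    have "blk m X a a' = adj (blk m X a' a)"
    proof (rule eq_matI)
      fix b b' assume "b < dim_row (adj (blk m X a' a))" "b' < dim_col (adj (blk m X a' a))"
      then have b: "b < m" "b' < m" by (auto simp: blk_def)
      show "blk m X a a' $$ (b,b') = adj (blk m X a' a) $$ (b,b')"
        using b hermitian_index[OF psdD(1)[OF X] block_index_less[OF a(2) b(2)] block_index_less[OF a(1) b(1)]]
        by (simp add: blk_def)
    qed (auto simp: blk_def)
    then have "T * blk m X a a' = adj (blk m X a' a * T)"
      using psdD(3,5)[OF T] by (simp add: adj_mult blk_def)
    then have "mtrace (T * blk m X a a') = cnj (mtrace (blk m X a' a * T))"
      using mtrace_adj[OF mult_carrier_mat[OF blk_carrier psdD(2)[OF T]]] by simp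
    also have "mtrace (blk m X a' a * T) = mtrace (T * blk m X a' a)"
      by (rule mtrace_comm[OF blk_carrier psdD(2)[OF T]])
    finally show "adj ?Y $$ (a,a') = ?Y $$ (a,a')" using a by simp
  qed auto
  have ent: "?Y $$ (a,a') = (\<Sum>x<m. t x * (\<Sum>b<m. cnj (U $$ (b,x)) * (\<Sum>b'<m. X $$ (a*m+b, a'*m+b') * U $$ (b',x))))"
    if "a < k" "a' < k" for a a'
  proof -
    have "?Y $$ (a,a') = (\<Sum>x<m. t x * (adj U * blk m X a a' * U) $$ (x,x))"
      using that mtrace_specdec_mult[OF U(1) blk_carrier] by simp
    also have "\<dots> = (\<Sum>x<m. t x * (\<Sum>b<m. cnj (U $$ (b,x)) * (\<Sum>b'<m. X $$ (a*m+b, a'*m+b') * U $$ (b',x))))"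
    proof (intro sum.cong refl)
      fix x assume "x \<in> {..<m}"
      then have x: "x < m" by simp
      show "t x * (adj U * blk m X a a' * U) $$ (x,x) =
        t x * (\<Sum>b<m. cnj (U $$ (b,x)) * (\<Sum>b'<m. X $$ (a*m+b, a'*m+b') * U $$ (b',x)))"
        unfolding congruence_index[OF blk_carrier UD(4) x x] by (simp add: blk_def)
    qed
    finally show ?thesis .
  qed
  show ?thesis
  proof (rule psdI[OF herm])
    fix v :: "complex vec" assume v: "v \<in> carrier_vec k"
    define w where "w x = vec (k * m) (\<lambda>i. v $ (i div m) * U $$ (i mod m, x))" for x
    have w: "w x \<in> carrier_vec (k * m)" for x by (simp add: w_def)
    have q: "cinner (w x) (X *\<^sub>v w x) = (\<Sum>a<k. \<Sum>a'<k. cnj (v $ a) *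
      (\<Sum>b<m. cnj (U $$ (b,x)) * (\<Sum>b'<m. X $$ (a*m+b, a'*m+b') * U $$ (b',x))) * v $ a')" for x
    proof -
      define h where "h a b a' b' = cnj (v $ a * U $$ (b,x)) * X $$ (a*m+b, a'*m+b') * (v $ a' * U $$ (b',x))" for a b a' b'
      have "cinner (w x) (X *\<^sub>v w x) = (\<Sum>i<k*m. \<Sum>j<k*m. h (i div m) (i mod m) (j div m) (j mod m))"
        unfolding cinner_mat[OF psdD(2)[OF X] w w] by (intro sum.cong refl) (simp add: w_def h_def)
      also have "\<dots> = (\<Sum>i<k*m. \<Sum>a'<k. \<Sum>b'<m. h (i div m) (i mod m) a' b')"
        by (intro sum.cong refl sum_div_mod)
      also have "\<dots> = (\<Sum>a<k. \<Sum>b<m. \<Sum>a'<k. \<Sum>b'<m. h a b a' b')" by (rule sum_div_mod)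
      also have "\<dots> = (\<Sum>a<k. \<Sum>a'<k. \<Sum>b<m. \<Sum>b'<m. h a b a' b')"
        by (intro sum.cong refl sum.swap)
      finally show ?thesis by (simp add: h_def sum_distrib_left sum_distrib_right mult_ac)
    qed
    have "cinner v (?Y *\<^sub>v v) = (\<Sum>a<k. \<Sum>a'<k. cnj (v $ a) * ?Y $$ (a,a') * v $ a')"
      by (rule cinner_mat[OF _ v v]) auto
    also have "\<dots> = (\<Sum>a<k. \<Sum>a'<k. \<Sum>x<m. t x * (cnj (v $ a) *
      (\<Sum>b<m. cnj (U $$ (b,x)) * (\<Sum>b'<m. X $$ (a*m+b, a'*m+b') * U $$ (b',x))) * v $ a'))"
    proof (intro sum.cong refl)
      fix a a' assume "a \<in> {..<k}" "a' \<in> {..<k}"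
      then have a: "a < k" "a' < k" by auto
      show "cnj (v $ a) * ?Y $$ (a,a') * v $ a' = (\<Sum>x<m. t x * (cnj (v $ a) *
        (\<Sum>b<m. cnj (U $$ (b,x)) * (\<Sum>b'<m. X $$ (a*m+b, a'*m+b') * U $$ (b',x))) * v $ a'))"
      proof -
        have "c * (\<Sum>x<m. t x * h x) * e = (\<Sum>x<m. t x * (c * h x * e))" for c e :: complex and h :: "nat \<Rightarrow> complex"
          by (simp add: sum_distrib_left sum_distrib_right mult_ac)
        then show ?thesis unfolding ent[OF a] .
      qed
    qed
    also have "\<dots> = (\<Sum>a<k. \<Sum>x<m. \<Sum>a'<k. t x * (cnj (v $ a) *
      (\<Sum>b<m. cnj (U $$ (b,x)) * (\<Sum>b'<m. X $$ (a*m+b, a'*m+b') * U $$ (b',x))) * v $ a'))"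
      by (intro sum.cong refl sum.swap)
    also have "\<dots> = (\<Sum>x<m. \<Sum>a<k. \<Sum>a'<k. t x * (cnj (v $ a) *
      (\<Sum>b<m. cnj (U $$ (b,x)) * (\<Sum>b'<m. X $$ (a*m+b, a'*m+b') * U $$ (b',x))) * v $ a'))"
      by (rule sum.swap)
    also have "\<dots> = (\<Sum>x<m. t x * cinner (w x) (X *\<^sub>v w x))"
    proof -
      have "(\<Sum>a<k. \<Sum>a'<k. c * h a a') = c * (\<Sum>a<k. \<Sum>a'<k. h a a')" for c :: complex and h
        by (simp add: sum_distrib_left)
      then show ?thesis unfolding q by simp
    qed
    finally have "Re (cinner v (?Y *\<^sub>v v)) = (\<Sum>x<m. t x * Re (cinner (w x) (X *\<^sub>v w x)))" by simp
    then show "0 \<le> Re (cinner v (?Y *\<^sub>v v))"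
      using U(2) psdD(6)[OF X w] by (auto intro!: sum_nonneg mult_nonneg_nonneg)
  qed
qed

text \<open>Complete positivity: with a reference system the output is a sum of two product
  operators, whose reference parts are partial traces of \<open>X\<close> against \<open>T\<close>
  and \<open>1 - T\<close> and hence positive.\<close>

lemma measure_prepare_channel:
  assumes T: "psd n T" "psd n (1\<^sub>m n - T)" and Q: "density m Q" "density m Q'"
  shows "channel n m (\<lambda>X. mtrace (T * X) \<cdot>\<^sub>m Q + mtrace ((1\<^sub>m n - T) * X) \<cdot>\<^sub>m Q')" (is "channel n m ?\<Phi>")
proof -
  have Qp: "psd m Q" "psd m Q'" "mtrace Q = 1" "mtrace Q' = 1" using Q by (auto simp: density_def)
  note Tc = psdD(2)[OF T(1)] psdD(2)[OF T(2)] and Qc = psdD(2)[OF Qp(1)] psdD(2)[OF Qp(2)]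
  have tr: "mtrace (T * X) + mtrace ((1\<^sub>m n - T) * X) = mtrace X" if X: "X \<in> carrier_mat n n" for X
  proof -
    have "mtrace ((1\<^sub>m n - T) * X) = mtrace (X * (1\<^sub>m n - T))" by (rule mtrace_comm[OF Tc(2) X])
    also have "\<dots> = mtrace X - mtrace (X * T)"
      using mtrace_mult_minus[OF one_carrier_mat Tc(1) X] X by simp
    finally show ?thesis using mtrace_comm[OF Tc(1) X] by simp
  qed
  show ?thesis
    unfolding channel_def
  proof (intro conjI ballI allI impI)
    fix X :: "complex mat" assume X: "X \<in> carrier_mat n n"
    show "?\<Phi> X \<in> carrier_mat m m" using Qc by simp
    show "mtrace (?\<Phi> X) = mtrace X"
      using Qc tr[OF X] by (simp add: mtrace_add[of _ m] mtrace_smult[of _ m] Qp)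
    show "?\<Phi> (c \<cdot>\<^sub>m X) = c \<cdot>\<^sub>m ?\<Phi> X" for c
      unfolding mtrace_mult_smult[OF X Tc(1)] mtrace_mult_smult[OF X Tc(2)]
      by (rule eq_matI) (use Qc in \<open>auto simp: algebra_simps\<close>)
    fix Y :: "complex mat" assume Y: "Y \<in> carrier_mat n n"
    show "?\<Phi> (X + Y) = ?\<Phi> X + ?\<Phi> Y"
      unfolding mtrace_mult_add[OF X Y Tc(1)] mtrace_mult_add[OF X Y Tc(2)]
      by (rule eq_matI) (use Qc in \<open>auto simp: algebra_simps\<close>)
  next
    fix k X assume X: "psd (k * n) X"
    let ?Y = "\<lambda>T. mat k k (\<lambda>(a,a'). mtrace (T * blk n X a a'))"
    have "ampl k n m ?\<Phi> X = kron (?Y T) Q + kron (?Y (1\<^sub>m n - T)) Q'"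
    proof (rule eq_matI)
      fix i j assume "i < dim_row (kron (?Y T) Q + kron (?Y (1\<^sub>m n - T)) Q')"
        "j < dim_col (kron (?Y T) Q + kron (?Y (1\<^sub>m n - T)) Q')"
      then have ij: "i < k * m" "j < k * m" using Qc by auto
      show "ampl k n m ?\<Phi> X $$ (i,j) = (kron (?Y T) Q + kron (?Y (1\<^sub>m n - T)) Q') $$ (i,j)"
        using ij div_mod_less[OF ij(1)] div_mod_less[OF ij(2)] Qc by (simp add: ampl_def)
    qed (use Qc in \<open>auto simp: ampl_def\<close>)
    moreover have "psd (k * m) (kron (?Y T) Q + kron (?Y (1\<^sub>m n - T)) Q')"
      by (intro psd_add psd_kron psd_partial_trace T X Qp)
    ultimately show "psd (k * m) (ampl k n m ?\<Phi> X)" by simp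
  qed
qed

text \<open>The state prepared on rejection is forced by the constraint: it must be
  \<open>(\<sigma>' - a Q) / (1 - a)\<close>, which is a state because \<open>a Q\<close> lies below
  \<open>\<sigma>'\<close>. Its contribution to the overlap is nonnegative and is dropped.\<close>

lemma achieve_oneshot:
  assumes T: "psd n T" "psd n (1\<^sub>m n - T)" and \<sigma>: "density n \<sigma>" and \<sigma>': "density m \<sigma>'" and Q: "density m Q"
    and a: "Re (mtrace (T * \<sigma>)) = a" "a < 1" and dom: "psd m (\<sigma>' - complex_of_real a \<cdot>\<^sub>m Q)"
    and \<rho>: "density n \<rho>" and A: "psd m A"
  shows "\<exists>\<Phi>. channel n m \<Phi> \<and> \<Phi> \<sigma> = \<sigma>' \<and> Re (mtrace (T * \<rho>)) * Re (mtrace (A * Q)) \<le> Re (mtrace (A * \<Phi> \<rho>))"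
proof -
  have Qp: "psd m Q" "mtrace Q = 1" using Q by (auto simp: density_def)
  have \<sigma>p: "psd n \<sigma>" "mtrace \<sigma> = 1" using \<sigma> by (auto simp: density_def)
  have \<sigma>'p: "psd m \<sigma>'" "mtrace \<sigma>' = 1" using \<sigma>' by (auto simp: density_def)
  have \<rho>p: "psd n \<rho>" "mtrace \<rho> = 1" using \<rho> by (auto simp: density_def)
  note c = psdD(2)[OF Qp(1)] psdD(2)[OF \<sigma>p(1)] psdD(2)[OF \<sigma>'p(1)] psdD(2)[OF T(1)] psdD(2)[OF T(2)]
    psdD(2)[OF dom] psdD(2)[OF A] psdD(2)[OF \<rho>p(1)]
  define Q' where "Q' = complex_of_real (1 / (1 - a)) \<cdot>\<^sub>m (\<sigma>' - complex_of_real a \<cdot>\<^sub>m Q)"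
  have Q'p: "psd m Q'" unfolding Q'_def using a(2) by (intro psd_smult[OF dom]) simp
  have "mtrace Q' = 1"
  proof -
    have "mtrace (\<sigma>' - complex_of_real a \<cdot>\<^sub>m Q) = complex_of_real (1 - a)"
      using mtrace_minus[OF c(3), of "complex_of_real a \<cdot>\<^sub>m Q"] mtrace_smult[OF c(1)] c(1) Qp(2) \<sigma>'p(2) by simp
    then have "mtrace Q' = complex_of_real (1 / (1 - a)) * complex_of_real (1 - a)"
      unfolding Q'_def mtrace_smult[OF c(6)] by (simp only:)
    also have "\<dots> = complex_of_real ((1 / (1 - a)) * (1 - a))" by (simp only: of_real_mult)
    also have "(1 / (1 - a)) * (1 - a) = 1" using a(2) by simp
    finally show ?thesis by simp
  qed
  then have Q': "density m Q'" using Q'p by (simp add: density_def)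
  have ta: "mtrace (T * \<sigma>) = complex_of_real a"
    using psd_mtrace_mult_real[OF T(1) \<sigma>p(1)] a(1) by simp
  have tb: "mtrace ((1\<^sub>m n - T) * \<sigma>) = complex_of_real (1 - a)"
  proof -
    have "mtrace ((1\<^sub>m n - T) * \<sigma>) = mtrace (\<sigma> * (1\<^sub>m n - T))" by (rule mtrace_comm[OF c(5,2)])
    also have "\<dots> = mtrace \<sigma> - mtrace (\<sigma> * T)"
      using mtrace_mult_minus[OF one_carrier_mat c(4) c(2)] c(2) by simp
    finally show ?thesis using mtrace_comm[OF c(4,2)] ta \<sigma>p by simp
  qed
  let ?\<Phi> = "\<lambda>X. mtrace (T * X) \<cdot>\<^sub>m Q + mtrace ((1\<^sub>m n - T) * X) \<cdot>\<^sub>m Q'"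
  have "channel n m ?\<Phi>" by (rule measure_prepare_channel[OF T Q Q'])
  moreover have "?\<Phi> \<sigma> = \<sigma>'"
  proof -
    have "complex_of_real (1 - a) \<cdot>\<^sub>m Q' = \<sigma>' - complex_of_real a \<cdot>\<^sub>m Q"
    proof -
      have k: "complex_of_real (1 - a) * complex_of_real (1 / (1 - a)) = 1"
        unfolding of_real_mult[symmetric] using a(2) by simp
      have "complex_of_real (1 - a) \<cdot>\<^sub>m Q' = (complex_of_real (1 - a) * complex_of_real (1 / (1 - a))) \<cdot>\<^sub>m (\<sigma>' - complex_of_real a \<cdot>\<^sub>m Q)"
        unfolding Q'_def by (rule eq_matI) auto
      moreover have "1 \<cdot>\<^sub>m X = X" for X :: "complex mat" by (rule eq_matI) auto
      ultimately show ?thesis unfolding k by simp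
    qed
    then show ?thesis unfolding ta tb by (intro eq_matI) (use c(1,3) in auto)
  qed
  moreover have "Re (mtrace (T * \<rho>)) * Re (mtrace (A * Q)) \<le> Re (mtrace (A * ?\<Phi> \<rho>))"
  proof -
    have "mtrace (A * ?\<Phi> \<rho>) = mtrace (T * \<rho>) * mtrace (A * Q) + mtrace ((1\<^sub>m n - T) * \<rho>) * mtrace (A * Q')"
      using c psdD(2)[OF Q'p] by (simp add: mtrace_mult_add[of _ m] mtrace_mult_smult[of _ m])
    moreover have "Im (mtrace (T * \<rho>)) = 0" "Im (mtrace ((1\<^sub>m n - T) * \<rho>)) = 0"
      using psd_mtrace_mult_real[OF T(1) \<rho>p(1)] psd_mtrace_mult_real[OF T(2) \<rho>p(1)] by (metis Im_complex_of_real)+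
    ultimately have "Re (mtrace (A * ?\<Phi> \<rho>)) = Re (mtrace (T * \<rho>)) * Re (mtrace (A * Q))
      + Re (mtrace ((1\<^sub>m n - T) * \<rho>)) * Re (mtrace (A * Q'))"
      by simp
    moreover have "0 \<le> Re (mtrace ((1\<^sub>m n - T) * \<rho>)) * Re (mtrace (A * Q'))"
      by (rule mult_nonneg_nonneg[OF psd_mtrace_mult[OF T(2) \<rho>p(1)] psd_mtrace_mult[OF A Q'p]])
    ultimately show ?thesis by linarith
  qed
  ultimately show ?thesis by blast
qed

section \<open>Families of tests and output states\<close>

lemma finite_maximizer:
  fixes f :: "'a \<Rightarrow> real"
  assumes "finite I" "I \<noteq> {}"
  shows "\<exists>x\<in>I. \<forall>y\<in>I. f y \<le> f x"
proof -
  have "Max (f ` I) \<in> f ` I" using assms by (intro Max_in) auto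
  then obtain x where "x \<in> I" "Max (f ` I) = f x" by auto
  then show ?thesis using assms by (metis Max_ge finite_imageI imageI)
qed

lemma sum_indicator:
  fixes h :: "nat \<Rightarrow> 'a::comm_monoid_add"
  assumes "S \<subseteq> {..<n}"
  shows "(\<Sum>i<n. if i \<in> S then h i else 0) = sum h S"
  using assms by (simp add: sum.If_cases Int_absorb1 Collect_mem_eq)

lemma dyadic_level_up:
  fixes r :: real
  assumes "1 < r" "r \<le> 2^J"
  shows "\<exists>j<J. 2^j < r \<and> r \<le> 2^(Suc j)"
  using assms
proof (induction J)
  case (Suc J)
  show ?case
  proof (cases "r \<le> 2^J")
    case True
    then show ?thesis using Suc.IH Suc.prems(1) less_Suc_eq by blast
  next
    case False
    then show ?thesis using Suc.prems by (intro exI[of _ J]) auto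
  qed
qed simp

text \<open>The tests are spectral projections onto dyadic levels of the likelihood ratio
  \<open>p / q\<close>, together with the identity for ratios up to 1. Domination bounds the ratio
  by \<open>2^J\<close>, so \<open>J\<close> levels suffice. The family is chosen before
  \<open>\<beta>\<close>; only the optimal member depends on \<open>\<beta>\<close>, as the minimax
  argument requires.\<close>

lemma test_family:
  assumes \<rho>: "density n \<rho>" and \<sigma>: "density n \<sigma>" and dom: "psd n (complex_of_real c \<cdot>\<^sub>m \<sigma> - \<rho>)"
    and V: "specdec n \<sigma> V \<delta>" and K: "real (card (\<delta> ` {..<n})) \<le> K" and J: "c \<le> 2^J"
  shows "\<exists>I. finite I \<and>
    (\<forall>T\<in>I. psd n T \<and> psd n (1\<^sub>m n - T) \<and> 0 < Re (mtrace (T * \<rho>)) \<and> 0 < Re (mtrace (T * \<sigma>))) \<and>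
    (\<forall>\<beta>>1. \<exists>T\<in>I. sandQ \<beta> \<rho> \<sigma> powr (1 / \<beta>) \<le>
      2 * K * (real J + 1) * (Re (mtrace (T * \<rho>)) * Re (mtrace (T * \<sigma>)) powr (- ((\<beta> - 1) / \<beta>))))"
proof -
  have \<rho>p: "psd n \<rho>" and \<rho>t: "mtrace \<rho> = 1" using \<rho> by (auto simp: density_def)
  have \<sigma>p: "psd n \<sigma>" and \<sigma>t: "mtrace \<sigma> = 1" using \<sigma> by (auto simp: density_def)
  have K0: "K \<ge> 0" using K by linarith
  obtain U q P where U: "specdec n \<sigma> U q" and P: "specdec n P U (\<lambda>i. Re ((adj U * \<rho> * U) $$ (i,i)))"
    and KP: "psd n (complex_of_real K \<cdot>\<^sub>m P - \<rho>)" using pinched_eigenbasis[OF \<rho>p V K] by blast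
  note UD = specdecD[OF U]
  define p where "p i = Re ((adj U * \<rho> * U) $$ (i,i))" for i
  have R: "psd n (adj U * \<rho> * U)" by (rule psd_congruence[OF \<rho>p UD(4)])
  have p0: "0 \<le> p i" if "i < n" for i unfolding p_def by (rule psd_diag(1)[OF R that])
  have q0: "0 \<le> q i" if "i < n" for i using psd_specdec[OF U] \<sigma>p that by auto
  have qs: "(\<Sum>i<n. q i) = 1" using mtrace_specdec[OF U] \<sigma>t by (metis of_real_eq_1_iff)
  have pc: "p i \<le> 2^J * q i" if "i < n" for i
  proof -
    have "p i \<le> Re ((adj U * (complex_of_real c \<cdot>\<^sub>m \<sigma>) * U) $$ (i,i))"
      unfolding p_def by (rule psd_diag_mono[OF dom psdD(2)[OF \<rho>p] _ UD(4) that]) (use UD(3) in simp)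
    also have "\<dots> = c * q i"
      using specdec_diag[OF specdec_smult[OF U, of c] that(1)] by simp
    also have "\<dots> \<le> 2^J * q i" using J q0[OF that] by (rule mult_right_mono)
    finally show ?thesis .
  qed
  define S where "S j = {i. i < n \<and> q i > 0 \<and> 2^j * q i < p i \<and> p i \<le> 2^(Suc j) * q i}" for j
  have Sn: "S j \<subseteq> {..<n}" "finite (S j)" for j by (auto simp: S_def)
  define T where "T j = U * rdiag n (\<lambda>i. if i \<in> S j then 1 else 0) * adj U" for j
  have Tsd: "specdec n (T j) U (\<lambda>i. if i \<in> S j then 1 else 0)" for j using UD(1) by (simp add: specdec_def T_def)
  have Tp: "psd n (T j)" for j using psd_specdec[OF Tsd] by auto
  have onesd: "specdec n (1\<^sub>m n) U (\<lambda>_. 1)" using UD(1) unitaryD[OF UD(1)] by (simp add: specdec_def diag_of_one)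
  have T1: "psd n (1\<^sub>m n - T j)" for j using psd_specdec[OF specdec_diff[OF onesd Tsd]] by auto
  have T\<rho>: "Re (mtrace (T j * \<rho>)) = sum p (S j)" for j
  proof -
    have "Re (mtrace (T j * \<rho>)) = (\<Sum>i<n. if i \<in> S j then p i else 0)"
      unfolding mtrace_specdec_mult[OF Tsd psdD(2)[OF \<rho>p]] Re_sum by (intro sum.cong refl) (simp add: p_def)
    then show ?thesis using sum_indicator[OF Sn(1)] by simp
  qed
  have T\<sigma>: "Re (mtrace (T j * \<sigma>)) = sum q (S j)" for j
  proof -
    have "Re (mtrace (T j * \<sigma>)) = (\<Sum>i<n. if i \<in> S j then q i else 0)"
      unfolding mtrace_specdec_mult[OF Tsd UD(3)] Re_sum
      by (intro sum.cong refl) (simp add: specdec_diag[OF U] del: index_mult_mat(1))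
    then show ?thesis using sum_indicator[OF Sn(1)] by simp
  qed
  have qpos: "0 < sum q (S j)" if "S j \<noteq> {}" for j
    using that Sn by (intro sum_pos) (auto simp: S_def)
  have plow: "2^j * sum q (S j) \<le> sum p (S j)" for j
    unfolding sum_distrib_left by (intro sum_mono) (auto simp: S_def)
  have ppos: "0 < sum p (S j)" if "S j \<noteq> {}" for j
    using less_le_trans[OF _ plow[of j]] qpos[OF that] by simp
  define I where "I = insert (1\<^sub>m n) (T ` {j. j < J \<and> S j \<noteq> {}})"
  have tr1: "Re (mtrace (1\<^sub>m n * \<rho>)) = 1" "Re (mtrace (1\<^sub>m n * \<sigma>)) = 1"
    using psdD(3)[OF \<rho>p] psdD(3)[OF \<sigma>p] \<rho>t \<sigma>t by simp_all
  have fin: "finite I" and ne: "I \<noteq> {}" by (auto simp: I_def)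
  have props: "\<forall>T\<in>I. psd n T \<and> psd n (1\<^sub>m n - T) \<and> 0 < Re (mtrace (T * \<rho>)) \<and> 0 < Re (mtrace (T * \<sigma>))"
  proof -
    have "psd n (1\<^sub>m n - 1\<^sub>m n)" using psd_specdec[OF specdec_diff[OF onesd onesd]] by auto
    then show ?thesis unfolding I_def using psd_one tr1 Tp T1 T\<rho> T\<sigma> qpos ppos by auto
  qed
  have "\<exists>T\<in>I. sandQ \<beta> \<rho> \<sigma> powr (1 / \<beta>) \<le>
      2 * K * (real J + 1) * (Re (mtrace (T * \<rho>)) * Re (mtrace (T * \<sigma>)) powr (- ((\<beta> - 1) / \<beta>)))" if \<beta>: "\<beta> > 1" for \<beta>
  proof -
    define s where "s = (\<beta> - 1) / \<beta>"
    let ?h = "\<lambda>T. Re (mtrace (T * \<rho>)) * Re (mtrace (T * \<sigma>)) powr (-s)"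
    obtain T0 where T0: "T0 \<in> I" "\<forall>T\<in>I. ?h T \<le> ?h T0" using finite_maximizer[OF fin ne, of ?h] by blast
    define M where "M = ?h T0"
    \<comment> \<open>The identity belongs to the family and has value 1.\<close>
    have M1: "M \<ge> 1" using T0(2) tr1 unfolding M_def I_def by auto
    define t where "t i = (q i powr ((1 - \<beta>) / \<beta>) * p i) powr \<beta>" for i
    have tq: "t i \<le> q i * r powr \<beta>" if "i < n" "q i > 0" "p i \<le> r * q i" for i r
    proof -
      have r0: "r \<ge> 0" using that p0[OF that(1)] by (smt (verit) mult_neg_pos)
      have "t i = q i powr (1 - \<beta>) * p i powr \<beta>"
        unfolding t_def using that p0[OF that(1)] \<beta> by (simp add: powr_mult powr_powr)
      also have "\<dots> \<le> q i powr (1 - \<beta>) * (r * q i) powr \<beta>"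
        using that p0[OF that(1)] \<beta> by (intro mult_left_mono powr_mono2) auto
      also have "\<dots> = q i * r powr \<beta>"
        using that(2) r0 by (simp add: powr_mult powr_diff)
      finally show ?thesis .
    qed
    \<comment> \<open>The summand \<open>q i\<close>, of total 1, covers ratios up to 1; every
      larger ratio lies in exactly one level.\<close>
    have ti: "t i \<le> q i + (\<Sum>j<J. if i \<in> S j then q i * (2^(Suc j)) powr \<beta> else 0)" if i: "i < n" for i
    proof -
      have sn: "0 \<le> (\<Sum>j<J. if i \<in> S j then q i * (2^(Suc j)) powr \<beta> else 0)"
        using q0[OF i] by (intro sum_nonneg) auto
      show ?thesis
      proof (cases "q i = 0")
        case True
        then show ?thesis using sn \<beta> by (simp add: t_def)
      next
        case False
        then have qp: "q i > 0" using q0[OF i] by simp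
        show ?thesis
        proof (cases "p i \<le> q i")
          case True
          then show ?thesis using tq[OF i qp, of 1] sn by simp
        next
          case False
          then obtain j where j: "j < J" "2^j < p i / q i" "p i / q i \<le> 2^(Suc j)"
            using dyadic_level_up[of "p i / q i" J] pc[OF i] qp by (auto simp: field_simps)
          then have iS: "i \<in> S j" using i qp by (simp add: S_def field_simps)
          have "t i \<le> q i * (2^(Suc j)) powr \<beta>" using iS by (intro tq[OF i qp]) (simp add: S_def)
          also have "\<dots> \<le> (\<Sum>j<J. if i \<in> S j then q i * (2^(Suc j)) powr \<beta> else 0)"
            using member_le_sum[of j "{..<J}" "\<lambda>j. if i \<in> S j then q i * (2^(Suc j)) powr \<beta> else 0"] j(1) iS q0[OF i]
            by simp
          finally show ?thesis using qp by linarith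
        qed
      qed
    qed
    \<comment> \<open>The left side is the power \<open>\<beta>\<close> of
      \<open>2 * (2^j * ?a) * ?a powr (-s)\<close>, and \<open>2^j * ?a\<close> is at most the
      \<open>\<rho>\<close>-weight of the level. The base is thus at most twice the value of the
      test.\<close>
    have lev: "sum q (S j) * (2^(Suc j)) powr \<beta> \<le> (2 * M) powr \<beta>" if "j < J" for j
    proof (cases "S j = {}")
      case False
      let ?a = "sum q (S j)"
      have hT: "sum p (S j) * ?a powr (-s) \<le> M"
        using T0(2) that False unfolding M_def I_def by (auto simp: T\<rho> T\<sigma>)
      have ap: "?a > 0" by (rule qpos[OF False])
      have e: "?a powr (1/\<beta>) = ?a * ?a powr (-s)"
      proof -
        have "1/\<beta> = 1 + (-s)" using \<beta> by (simp add: s_def field_simps)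
        then show ?thesis using ap by (simp only: powr_add powr_one)
      qed
      have "?a * (2^(Suc j)) powr \<beta> = (?a powr (1/\<beta>) * 2^(Suc j)) powr \<beta>"
        using ap \<beta> by (simp add: powr_mult powr_powr)
      also have "\<dots> = (2 * (2^j * ?a) * ?a powr (-s)) powr \<beta>" unfolding e by (simp add: mult_ac)
      also have "\<dots> \<le> (2 * M) powr \<beta>"
      proof (rule powr_mono2)
        have "2^j * ?a * ?a powr (-s) \<le> sum p (S j) * ?a powr (-s)" using plow by (rule mult_right_mono) simp
        then show "2 * (2^j * ?a) * ?a powr (-s) \<le> 2 * M" using hT by simp
      qed (use \<beta> ap in auto)
      finally show ?thesis .
    qed (use \<beta> M1 in simp)
    have "(\<Sum>i<n. t i) \<le> (\<Sum>i<n. q i + (\<Sum>j<J. if i \<in> S j then q i * (2^(Suc j)) powr \<beta> else 0))"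
      using ti by (intro sum_mono) auto
    also have "\<dots> = 1 + (\<Sum>j<J. \<Sum>i<n. if i \<in> S j then q i * (2^(Suc j)) powr \<beta> else 0)"
      unfolding sum.distrib qs by (subst sum.swap) simp
    also have "(\<Sum>j<J. \<Sum>i<n. if i \<in> S j then q i * (2^(Suc j)) powr \<beta> else 0) = (\<Sum>j<J. sum q (S j) * (2^(Suc j)) powr \<beta>)"
      by (intro sum.cong refl) (simp only: sum_indicator[OF Sn(1)] sum_distrib_right)
    also have "\<dots> \<le> (\<Sum>j<J. (2 * M) powr \<beta>)" by (intro sum_mono lev) auto
    also have "1 + (\<Sum>j<J. (2 * M) powr \<beta>) \<le> (real J + 1) * (2 * M) powr \<beta>"
    proof -
      have "1 \<le> (2 * M) powr \<beta>" using M1 \<beta> by (intro ge_one_powr_ge_zero) auto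
      then show ?thesis by (simp add: algebra_simps)
    qed
    finally have tb: "(\<Sum>i<n. t i) \<le> (real J + 1) * (2 * M) powr \<beta>" by simp
    have "sandQ \<beta> \<rho> \<sigma> \<le> K powr \<beta> * (\<Sum>i<n. t i)"
      unfolding t_def p_def using sandQ_upper[OF \<rho>p \<sigma>p U P _ K0 KP \<beta>] p0 by (simp add: p_def)
    \<comment> \<open>Enlarging \<open>J + 1\<close> to its power \<open>\<beta>\<close> makes the
      final factor independent of \<open>\<beta>\<close> once the root is taken.\<close>
    also have "\<dots> \<le> K powr \<beta> * ((real J + 1) powr \<beta> * (2 * M) powr \<beta>)"
    proof (intro mult_left_mono order_trans[OF tb] mult_right_mono)
      have "(real J + 1) powr 1 \<le> (real J + 1) powr \<beta>" using \<beta> by (intro powr_mono) auto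
      then show "real J + 1 \<le> (real J + 1) powr \<beta>" by simp
    qed auto
    also have "\<dots> = (2 * K * (real J + 1) * M) powr \<beta>" 
    proof -
      have a: "(x * (y * z)) powr \<beta> = x powr \<beta> * (y powr \<beta> * z powr \<beta>)" if "0 \<le> x" "0 \<le> y" "0 \<le> z" for x y z :: real
        using that by (simp add: powr_mult)
      have "2 * K * (real J + 1) * M = K * ((real J + 1) * (2 * M))" by simp
      then show ?thesis using K0 M1 by (simp only:) (intro a[symmetric], auto)
    qed
    finally have "sandQ \<beta> \<rho> \<sigma> powr (1/\<beta>) \<le> ((2 * K * (real J + 1) * M) powr \<beta>) powr (1/\<beta>)"
    proof (intro powr_mono2)
      have "0 \<le> (\<Sum>i<n. (q i powr ((1 - \<beta>) / \<beta>) * Re ((adj U * \<rho> * U) $$ (i,i))) powr \<beta>)" by (intro sum_nonneg) auto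
      then show "0 \<le> sandQ \<beta> \<rho> \<sigma>" using sandQ_lower[OF \<rho>p \<sigma>p U \<beta>] by linarith
    qed (use \<beta> in auto)
    also have "\<dots> = 2 * K * (real J + 1) * M" using K0 M1 \<beta> by (simp add: powr_powr)
    finally show ?thesis unfolding M_def using T0(1) by (auto simp: s_def)
  qed
  then show ?thesis using fin props by blast
qed

text \<open>The expectation of \<open>\<sigma>^s\<close> in the pure state is a sum of
  \<open>W t * t powr s\<close> over the distinct eigenvalues \<open>t\<close>, so the largest term
  is at least the fraction \<open>1 / K\<close> of it. That term is realised by the normalised
  projection onto the eigenspace, with overlap \<open>W t\<close>; \<open>t\<close> times this state
  is below \<open>\<sigma>\<close>.\<close>

lemma output_family:
  assumes A: "pure_state m A" and \<sigma>: "density m \<sigma>" and V: "specdec m \<sigma> V \<delta>" and K: "real (card (\<delta> ` {..<m})) \<le> K"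
  shows "\<exists>I. finite I \<and>
    (\<forall>(Q,l)\<in>I. density m Q \<and> psd m (\<sigma> - complex_of_real l \<cdot>\<^sub>m Q) \<and> 0 < Re (mtrace (A * Q)) \<and> 0 < l) \<and>
    (\<forall>s>0. 0 < Re (mtrace (A * mpow s \<sigma>)) \<longrightarrow>
      (\<exists>(Q,l)\<in>I. Re (mtrace (A * mpow s \<sigma>)) \<le> K * (Re (mtrace (A * Q)) * l powr s)))"
proof -
  have \<sigma>p: "psd m \<sigma>" and \<sigma>t: "mtrace \<sigma> = 1" using \<sigma> by (auto simp: density_def)
  note VD = specdecD[OF V]
  have \<delta>0: "0 \<le> \<delta> i" if "i < m" for i using psd_specdec[OF V] \<sigma>p that by auto
  note Ap = pure_state_psd[OF A]
  define B where "B = adj V * A * V"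
  have B: "pure_state m B" unfolding B_def by (rule pure_state_congruence[OF A VD(1)])
  obtain b where b: "b \<in> carrier_vec m" "cinner b b = 1" "B = mat m m (\<lambda>(i,j). b $ i * cnj (b $ j))"
    using B by (auto simp: pure_state_def)
  define w where "w i = (cmod (b $ i))\<^sup>2" for i
  have Bii: "B $$ (i,i) = complex_of_real (w i)" if "i < m" for i
    using that by (simp add: b(3) w_def complex_norm_square del: of_real_power)
  define E where "E t = {i. i < m \<and> \<delta> i = t}" for t
  have E: "E t \<subseteq> {..<m}" "finite (E t)" for t by (auto simp: E_def)
  define W where "W t = sum w (E t)" for t
  have W0: "W t \<ge> 0" for t unfolding W_def by (intro sum_nonneg) (auto simp: w_def)
  have trs: "Re (mtrace (A * mpow s \<sigma>)) = (\<Sum>t\<in>\<delta> ` {..<m}. W t * t powr s)" for s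
  proof -
    note M = specdec_mpow[OF V, of s]
    have "mtrace (A * mpow s \<sigma>) = mtrace (mpow s \<sigma> * A)"
      by (rule mtrace_comm[OF psdD(2)[OF Ap(1)] specdecD(3)[OF M]])
    also have "Re \<dots> = (\<Sum>i<m. w i * \<delta> i powr s)"
      unfolding mtrace_specdec_mult[OF M psdD(2)[OF Ap(1)]] B_def[symmetric] Re_sum
      by (intro sum.cong refl) (simp add: Bii)
    also have "\<dots> = (\<Sum>t\<in>\<delta> ` {..<m}. \<Sum>i\<in>E t. w i * \<delta> i powr s)"
      using sum.image_gen[of "{..<m}" "\<lambda>i. w i * \<delta> i powr s" \<delta>] by (simp add: E_def)
    also have "\<dots> = (\<Sum>t\<in>\<delta> ` {..<m}. W t * t powr s)"
      unfolding W_def sum_distrib_right by (intro sum.cong refl) (auto simp: E_def)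
    finally show ?thesis .
  qed
  have ex: "\<exists>Q. density m Q \<and> psd m (\<sigma> - complex_of_real t \<cdot>\<^sub>m Q) \<and> Re (mtrace (A * Q)) = W t"
    if t: "t \<ge> 0" "W t > 0" for t
  proof -
    define \<phi> where "\<phi> = vec m (\<lambda>i. if i \<in> E t then b $ i / complex_of_real (sqrt (W t)) else 0)"
    have \<phi>c: "\<phi> \<in> carrier_vec m" by (simp add: \<phi>_def)
    have sq: "(sqrt (W t))\<^sup>2 = W t" using t by simp
    have \<phi>n: "(cmod (\<phi> $ i))\<^sup>2 = (if i \<in> E t then w i / W t else 0)" if "i < m" for i
      using that sq by (simp add: \<phi>_def w_def norm_divide power_divide)
    have "(\<Sum>i<m. (cmod (\<phi> $ i))\<^sup>2) = (\<Sum>i<m. if i \<in> E t then w i / W t else 0)"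
      using \<phi>n by (intro sum.cong) auto
    also have "\<dots> = (\<Sum>i\<in>E t. w i / W t)" by (rule sum_indicator[OF E(1)])
    also have "\<dots> = W t / W t" unfolding sum_divide_distrib[symmetric] W_def[symmetric] ..
    finally have \<phi>1: "(\<Sum>i<m. (cmod (\<phi> $ i))\<^sup>2) = 1" using t by simp
    define Q0 where "Q0 = mat m m (\<lambda>(i,j). \<phi> $ i * cnj (\<phi> $ j))"
    have Q0: "pure_state m Q0"
      unfolding pure_state_def Q0_def using \<phi>c \<phi>1 cinner_self[OF \<phi>c] by (intro bexI[of _ \<phi>]) auto
    note Q0p = pure_state_psd[OF Q0]
    define Q where "Q = V * Q0 * adj V"
    have Q: "pure_state m Q"
      using pure_state_congruence[OF Q0 unitary_adj[OF VD(1)]] by (simp add: Q_def)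
    note Qp = pure_state_psd[OF Q]
    have "density m Q" using Qp by (simp add: density_def)
    moreover have "Re (mtrace (A * Q)) = W t"
    proof -
      have "adj V * Q * V = Q0" unfolding Q_def by (rule unitary_conj_inv(2)[OF VD(1) psdD(2)[OF Q0p(1)]])
      then have "mtrace (A * Q) = mtrace (B * Q0)"
        using mtrace_congruence[OF VD(1) psdD(2)[OF Ap(1)] psdD(2)[OF Qp(1)]] by (simp add: B_def)
      also have "\<dots> = (\<Sum>i<m. \<Sum>j<m. (b $ i * cnj (\<phi> $ i)) * cnj (b $ j * cnj (\<phi> $ j)))"
        unfolding mtrace_mult[OF psdD(2)[OF pure_state_psd(1)[OF B]] psdD(2)[OF Q0p(1)]]
        by (intro sum.cong refl) (simp add: b(3) Q0_def mult_ac)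
      also have "\<dots> = (\<Sum>i<m. b $ i * cnj (\<phi> $ i)) * cnj (\<Sum>i<m. b $ i * cnj (\<phi> $ i))"
        by (simp add: sum_product)
      also have "(\<Sum>i<m. b $ i * cnj (\<phi> $ i)) = (\<Sum>i<m. if i \<in> E t then complex_of_real (w i / sqrt (W t)) else 0)"
        by (intro sum.cong refl) (simp add: \<phi>_def w_def complex_norm_square del: of_real_power)
      also have "\<dots> = complex_of_real (\<Sum>i\<in>E t. w i / sqrt (W t))"
        unfolding sum_indicator[OF E(1)] by simp
      also have "(\<Sum>i\<in>E t. w i / sqrt (W t)) = sqrt (W t)"
        unfolding sum_divide_distrib[symmetric] W_def[symmetric] using t by (simp add: real_div_sqrt)
      finally show ?thesis using t by (simp flip: of_real_mult)
    qed
    moreover have "psd m (\<sigma> - complex_of_real t \<cdot>\<^sub>m Q)"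
    proof -
      \<comment> \<open>\<open>Q0\<close> has rank one and lives on \<open>E t\<close>, where the
        diagonal matrix acts as \<open>t\<close>; Cauchy-Schwarz on \<open>E t\<close> gives the
        inequality of quadratic forms.\<close>
      have "psd m (rdiag m \<delta> - complex_of_real t \<cdot>\<^sub>m Q0)"
      proof (rule psdI)
        show "hermitian m (rdiag m \<delta> - complex_of_real t \<cdot>\<^sub>m Q0)"
          by (intro hermitian_minus hermitian_rdiag hermitian_smult psdD(1)[OF Q0p(1)])
        fix v :: "complex vec" assume v: "v \<in> carrier_vec m"
        have "cinner v (Q0 *\<^sub>v v) = (\<Sum>i<m. \<Sum>j<m. (cnj (v $ i) * \<phi> $ i) * cnj (cnj (v $ j) * \<phi> $ j))"
          unfolding cinner_mat[OF psdD(2)[OF Q0p(1)] v v] by (intro sum.cong refl) (simp add: Q0_def mult_ac)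
        also have "\<dots> = (\<Sum>i<m. cnj (v $ i) * \<phi> $ i) * cnj (\<Sum>i<m. cnj (v $ i) * \<phi> $ i)"
          by (simp add: sum_product)
        also have "\<dots> = complex_of_real ((cmod (\<Sum>i<m. cnj (v $ i) * \<phi> $ i))\<^sup>2)"
          by (simp only: complex_norm_square)
        finally have "Re (cinner v (Q0 *\<^sub>v v)) = (cmod (\<Sum>i<m. cnj (v $ i) * \<phi> $ i))\<^sup>2"
          by (simp only: Re_complex_of_real)
        also have "(\<Sum>i<m. cnj (v $ i) * \<phi> $ i) = (\<Sum>i\<in>E t. cnj (v $ i) * \<phi> $ i)"
          by (rule sum.mono_neutral_right) (auto simp: E_def \<phi>_def)
        also have "(cmod (\<Sum>i\<in>E t. cnj (v $ i) * \<phi> $ i))\<^sup>2 \<le> (\<Sum>i\<in>E t. cmod (v $ i) * cmod (\<phi> $ i))\<^sup>2"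
          by (intro power_mono sum_norm_le) (auto simp: norm_mult)
        also have "\<dots> \<le> (\<Sum>i\<in>E t. (cmod (v $ i))\<^sup>2) * (\<Sum>i\<in>E t. (cmod (\<phi> $ i))\<^sup>2)"
          by (rule Cauchy_Schwarz_ineq_sum)
        also have "\<dots> \<le> (\<Sum>i\<in>E t. (cmod (v $ i))\<^sup>2) * 1"
          using sum_mono2[of "{..<m}" "E t" "\<lambda>i. (cmod (\<phi> $ i))\<^sup>2"] E(1) \<phi>1
          by (intro mult_left_mono) (auto intro: sum_nonneg)
        finally have le: "Re (cinner v (Q0 *\<^sub>v v)) \<le> (\<Sum>i\<in>E t. (cmod (v $ i))\<^sup>2)" by simp
        have "t * Re (cinner v (Q0 *\<^sub>v v)) \<le> t * (\<Sum>i\<in>E t. (cmod (v $ i))\<^sup>2)"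
          using le t(1) by (rule mult_left_mono)
        also have "\<dots> = (\<Sum>i\<in>E t. \<delta> i * (cmod (v $ i))\<^sup>2)"
          unfolding sum_distrib_left by (intro sum.cong refl) (auto simp: E_def)
        also have "\<dots> \<le> (\<Sum>i<m. \<delta> i * (cmod (v $ i))\<^sup>2)"
          using \<delta>0 E(1) by (intro sum_mono2) auto
        also have "\<dots> = Re (cinner v (rdiag m \<delta> *\<^sub>v v))" by (rule cinner_rdiag[OF v, symmetric])
        finally show "0 \<le> Re (cinner v ((rdiag m \<delta> - complex_of_real t \<cdot>\<^sub>m Q0) *\<^sub>v v))"
          using cinner_mat_minus[OF diag_of_carrier _ v, of "complex_of_real t \<cdot>\<^sub>m Q0" "\<lambda>i. complex_of_real (\<delta> i)"] psdD(2)[OF Q0p(1)]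
            cinner_mat_smult[OF psdD(2)[OF Q0p(1)] v, of "complex_of_real t"] by simp
      qed
      from psd_congruence'[OF this VD(4)]
      have "psd m (adj (adj V) * (rdiag m \<delta> - complex_of_real t \<cdot>\<^sub>m Q0) * adj V)" by simp
      also have "adj (adj V) * (rdiag m \<delta> - complex_of_real t \<cdot>\<^sub>m Q0) * adj V
        = adj (adj V) * rdiag m \<delta> * adj V - adj (adj V) * (complex_of_real t \<cdot>\<^sub>m Q0) * adj V"
        by (rule congruence_minus) (use psdD(2)[OF Q0p(1)] VD(4) in auto)
      also have "adj (adj V) * (complex_of_real t \<cdot>\<^sub>m Q0) * adj V = complex_of_real t \<cdot>\<^sub>m Q"
        unfolding Q_def using VD(4) psdD(2)[OF Q0p(1)]
        by (simp add: mult_smult_distrib[of V m m _ m] mult_smult_assoc_mat[of _ m m "adj V" m])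
      also have "adj (adj V) * rdiag m \<delta> * adj V = \<sigma>" using VD(2) by simp
      finally show ?thesis .
    qed
    ultimately show ?thesis by blast
  qed
  \<comment> \<open>Zero eigenvalues and eigenspaces orthogonal to the pure state contribute nothing
    for \<open>s > 0\<close>. Discarding them makes the numbers in each pair positive, so that their
    logarithms can be used.\<close>
  define G where "G = {t \<in> \<delta> ` {..<m}. t > 0 \<and> W t > 0}"
  have "\<forall>t\<in>G. \<exists>Q. density m Q \<and> psd m (\<sigma> - complex_of_real t \<cdot>\<^sub>m Q) \<and> Re (mtrace (A * Q)) = W t"
    using ex by (auto simp: G_def)
  then obtain Q where Q: "\<And>t. t \<in> G \<Longrightarrow> density m (Q t) \<and> psd m (\<sigma> - complex_of_real t \<cdot>\<^sub>m Q t) \<and> Re (mtrace (A * Q t)) = W t"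
    by metis
  have fG: "finite G" by (auto simp: G_def)
  define I where "I = (\<lambda>t. (Q t, t)) ` G"
  have "\<exists>(Q,l)\<in>I. Re (mtrace (A * mpow s \<sigma>)) \<le> K * (Re (mtrace (A * Q)) * l powr s)"
    if s: "s > 0" "0 < Re (mtrace (A * mpow s \<sigma>))" for s
  proof -
    have sumG: "Re (mtrace (A * mpow s \<sigma>)) = (\<Sum>t\<in>G. W t * t powr s)"
      unfolding trs
    proof (rule sum.mono_neutral_right)
      show "\<forall>i\<in>\<delta> ` {..<m} - G. W i * i powr s = 0"
        using \<delta>0 W0 by (fastforce simp: G_def less_le)
    qed (auto simp: G_def)
    then have "G \<noteq> {}" using s by auto
    then obtain t where t: "t \<in> G" "\<forall>t'\<in>G. W t' * t' powr s \<le> W t * t powr s"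
      using finite_maximizer[OF fG, of "\<lambda>t. W t * t powr s"] by blast
    have "Re (mtrace (A * mpow s \<sigma>)) \<le> (\<Sum>t'\<in>G. W t * t powr s)"
      unfolding sumG using t by (intro sum_mono) auto
    also have "\<dots> = real (card G) * (W t * t powr s)" by simp
    also have "\<dots> \<le> K * (W t * t powr s)"
    proof (intro mult_right_mono)
      have "card G \<le> card (\<delta> ` {..<m})" by (intro card_mono) (auto simp: G_def)
      then show "real (card G) \<le> K" using K by linarith
    qed (use W0 in auto)
    finally show ?thesis using t(1) Q[OF t(1)] by (intro bexI[of _ "(Q t, t)"]) (auto simp: I_def)
  qed
  moreover have "\<forall>(Q,l)\<in>I. density m Q \<and> psd m (\<sigma> - complex_of_real l \<cdot>\<^sub>m Q) \<and> 0 < Re (mtrace (A * Q)) \<and> 0 < l"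
    using Q by (auto simp: I_def G_def)
  moreover have "finite I" using fG by (simp add: I_def)
  ultimately show ?thesis by blast
qed

section \<open>The conversion problem\<close>

lemma dominated_tpow:
  assumes \<rho>: "psd d \<rho>" and \<sigma>: "psd d \<sigma>" and c: "c \<ge> 0" and dom: "psd d (complex_of_real c \<cdot>\<^sub>m \<sigma> - \<rho>)"
  shows "psd (d^n) (complex_of_real (c^n) \<cdot>\<^sub>m tpow n \<sigma> - tpow n \<rho>)"
proof (induction n)
  case 0
  have "complex_of_real (c^0) \<cdot>\<^sub>m tpow 0 \<sigma> - tpow 0 \<rho> = complex_of_real 0 \<cdot>\<^sub>m 1\<^sub>m 1" by (rule eq_matI) auto
  then show ?case using psd_smult[OF psd_one, of 0 1] by simp
next
  case (Suc n)
  have "psd (d * d^n) (kron (complex_of_real c \<cdot>\<^sub>m \<sigma>) (complex_of_real (c^n) \<cdot>\<^sub>m tpow n \<sigma>) - kron \<rho> (tpow n \<rho>))"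
    by (rule psd_kron_mono[OF \<rho> psd_smult[OF psd_tpow[OF \<sigma>]] dom Suc])
      (use c psdD(2)[OF \<sigma>] psdD(2)[OF psd_tpow[OF \<rho>, of n]] in auto)
  then show ?case by (simp add: kron_smult)
qed

text \<open>A point \<open>(x,y)\<close> is the line \<open>(1 - s) * x + s * y\<close>.
  \<open>A\<close> collects the parameters where a falling line reaches \<open>c\<close>,
  \<open>B\<close> those for rising lines. Both sets are closed and cover a connected interval; at a
  common parameter a falling and a rising line mix to a horizontal one of height at least
  \<open>c\<close>.\<close>

lemma minimax_two_points:
  fixes I :: "(real \<times> real) set"
  assumes fin: "finite I" and cov: "\<And>s. 0 < s \<Longrightarrow> s < 1 \<Longrightarrow> \<exists>(x,y)\<in>I. c \<le> (1 - s) * x + s * y"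
  shows "\<exists>p\<in>I. \<exists>p'\<in>I. \<exists>l. 0 \<le> l \<and> l \<le> 1 \<and>
    c \<le> l * fst p + (1 - l) * fst p' \<and> c \<le> l * snd p + (1 - l) * snd p'"
proof -
  define A where "A = (\<Union>p\<in>{p\<in>I. snd p \<le> fst p}. {s. c \<le> (1 - s) * fst p + s * snd p})"
  define B where "B = (\<Union>p\<in>{p\<in>I. fst p \<le> snd p}. {s. c \<le> (1 - s) * fst p + s * snd p})"
  have cl: "closed A" "closed B"
    unfolding A_def B_def using fin by (auto intro!: closed_UN closed_Collect_le continuous_intros)
  have "{0<..<1} \<subseteq> A \<union> B"
  proof
    fix s :: real assume "s \<in> {0<..<1}"
    then obtain p where "p \<in> I" "c \<le> (1 - s) * fst p + s * snd p" using cov[of s] by fastforce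
    then show "s \<in> A \<union> B" unfolding A_def B_def by (cases "snd p \<le> fst p") auto
  qed
  \<comment> \<open>Covering is assumed on the open interval only, as \<open>s = 1\<close>
    corresponds to no finite \<open>\<beta>\<close>; closedness adds the end points.\<close>
  then have "closure {0<..<1} \<subseteq> A \<union> B" using cl by (intro closure_minimal) auto
  then have sub: "{0..1} \<subseteq> A \<union> B" by (simp add: closure_greaterThanLessThan)
  have diag: ?thesis if "p \<in> I" "c \<le> fst p" "c \<le> snd p" for p
    by (rule bexI[OF _ that(1)], rule bexI[OF _ that(1)], rule exI[of _ 0]) (use that in auto)
  show ?thesis
  proof (cases "A \<inter> B \<inter> {0..1} = {}")
    case True
    then have "A \<inter> {0..1} = {} \<or> B \<inter> {0..1} = {}"
      using connected_closedD[OF connected_Icc _ sub cl] by blast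
    moreover have "0 \<in> A \<union> B" "1 \<in> A \<union> B" using subsetD[OF sub, of 0] subsetD[OF sub, of 1] by auto
    \<comment> \<open>If only one set meets the interval, it contains both end points. A rising line
      that reaches \<open>c\<close> at 0, or a falling one that reaches \<open>c\<close> at 1, stays
      above \<open>c\<close>, so a single point suffices.\<close>
    ultimately have "0 \<in> B \<or> 1 \<in> A" by auto
    then show ?thesis
    proof
      assume "0 \<in> B"
      then obtain p where "p \<in> I" "fst p \<le> snd p" "c \<le> fst p" by (auto simp: B_def)
      then show ?thesis using diag[of p] by linarith
    next
      assume "1 \<in> A"
      then obtain p where "p \<in> I" "snd p \<le> fst p" "c \<le> snd p" by (auto simp: A_def)
      then show ?thesis using diag[of p] by linarith
    qed
  next
    case False
    then obtain s where "s \<in> A" "s \<in> B" by auto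
    then obtain p p' where p: "p \<in> I" "snd p \<le> fst p" "c \<le> (1 - s) * fst p + s * snd p"
      and p': "p' \<in> I" "fst p' \<le> snd p'" "c \<le> (1 - s) * fst p' + s * snd p'"
      by (auto simp: A_def B_def)
    define u where "u = fst p - snd p"
    define u' where "u' = snd p' - fst p'"
    have u: "u \<ge> 0" "u' \<ge> 0" using p p' by (auto simp: u_def u'_def)
    show ?thesis
    proof (cases "u + u' = 0")
      case True
      then have "fst p = snd p" using u by (auto simp: u_def)
      then show ?thesis using p diag[of p] by (simp add: algebra_simps)
    next
      case False
      \<comment> \<open>The weight makes the slopes \<open>-u\<close> and \<open>u'\<close> cancel,
        so the value of the mixture at \<open>s\<close> is also its value at both ends.\<close>
      define l where "l = u' / (u + u')"
      have l: "0 \<le> l" "l \<le> 1" using u False by (auto simp: l_def divide_simps)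
      have eq: "l * u = (1 - l) * u'" using False by (simp add: l_def field_simps)
      have "l * ((1 - s) * fst p + s * snd p) + (1 - l) * ((1 - s) * fst p' + s * snd p') \<ge> l * c + (1 - l) * c"
        using p(3) p'(3) l by (intro add_mono mult_left_mono) auto
      moreover have "l * ((1 - s) * fst p + s * snd p) + (1 - l) * ((1 - s) * fst p' + s * snd p')
        = l * fst p + (1 - l) * fst p' + s * ((1 - l) * u' - l * u)"
        by (simp add: u_def u'_def algebra_simps)
      moreover have "l * snd p + (1 - l) * snd p' = l * fst p + (1 - l) * fst p' + ((1 - l) * u' - l * u)"
        by (simp add: u_def u'_def algebra_simps)
      ultimately have "c \<le> l * fst p + (1 - l) * fst p'" "c \<le> l * snd p + (1 - l) * snd p'"
        using eq by (auto simp: algebra_simps)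
      then show ?thesis using p(1) p'(1) l by blast
    qed
  qed
qed

lemma pure_state_le_one:
  assumes "pure_state n A"
  shows "psd n (1\<^sub>m n - A)"
proof -
  note Ap = pure_state_psd[OF assms]
  obtain U d where U: "specdec n A U d" "\<forall>i<n. 0 \<le> d i" using psd_obtain[OF Ap(1)] by blast
  have "(\<Sum>i<n. d i) = 1" using mtrace_specdec[OF U(1)] Ap(2) by (metis of_real_eq_1_iff)
  then have d1: "d i \<le> 1" if "i < n" for i
    using member_le_sum[of i "{..<n}" d] U(2) that by auto
  have "specdec n (1\<^sub>m n) U (\<lambda>_. 1)"
    using specdecD(1)[OF U(1)] unitaryD[OF specdecD(1)[OF U(1)]] by (simp add: specdec_def diag_of_one)
  then show ?thesis using psd_specdec[OF specdec_diff[OF _ U(1)]] d1 by auto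
qed

section \<open>Feasible channels and the error exponent\<close>

locale conversion =
  fixes d1 d2 :: nat and \<rho>1 \<sigma>1 \<rho>2 \<sigma>2 :: "complex mat"
  assumes \<rho>1: "density d1 \<rho>1" and \<sigma>1: "density d1 \<sigma>1" and \<rho>2: "density d2 \<rho>2" and \<sigma>2: "density d2 \<sigma>2"
    and pure: "pure_state d2 \<rho>2"
begin

lemma psd_states: "psd d1 \<rho>1" "psd d1 \<sigma>1" "psd d2 \<rho>2" "psd d2 \<sigma>2"
  using \<rho>1 \<sigma>1 \<rho>2 \<sigma>2 by (auto simp: density_def)

definition feasible :: "nat \<Rightarrow> nat \<Rightarrow> (complex mat \<Rightarrow> complex mat) \<Rightarrow> bool" where
  "feasible n m \<Phi> \<longleftrightarrow> channel (d1^n) (d2^m) \<Phi> \<and> \<Phi> (tpow n \<sigma>1) = tpow m \<sigma>2"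

definition overlap :: "nat \<Rightarrow> nat \<Rightarrow> (complex mat \<Rightarrow> complex mat) \<Rightarrow> real" where
  "overlap n m \<Phi> = Re (mtrace (tpow m \<rho>2 * \<Phi> (tpow n \<rho>1)))"

lemma feasible_density:
  assumes "feasible n m \<Phi>"
  shows "density (d2^m) (\<Phi> (tpow n \<rho>1))"
proof -
  have \<Phi>: "channel (d1^n) (d2^m) \<Phi>" using assms by (simp add: feasible_def)
  have p: "density (d1^n) (tpow n \<rho>1)" by (rule density_tpow[OF \<rho>1])
  then have pp: "psd (d1^n) (tpow n \<rho>1)" by (simp add: density_def)
  show ?thesis using channel_psd[OF \<Phi> pp] channelD(4)[OF \<Phi> psdD(2)[OF pp]] p by (simp add: density_def)
qed

lemma feasible_tdist:
  assumes "feasible n m \<Phi>"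
  shows "tdist (\<Phi> (tpow n \<rho>1)) (tpow m \<rho>2) \<le> 1"
    "1 - tdist (\<Phi> (tpow n \<rho>1)) (tpow m \<rho>2) \<le> overlap n m \<Phi>"
    "overlap n m \<Phi> \<le> 2 * (1 - tdist (\<Phi> (tpow n \<rho>1)) (tpow m \<rho>2))"
  using tdist_pure[OF feasible_density[OF assms] pure_state_tpow[OF pure]] by (auto simp: overlap_def)

lemma tdist_nonneg:
  assumes "feasible n m \<Phi>"
  shows "0 \<le> tdist (\<Phi> (tpow n \<rho>1)) (tpow m \<rho>2)"
proof -
  have "psd (d2^m) (\<Phi> (tpow n \<rho>1))" using feasible_density[OF assms] by (simp add: density_def)
  then have "hermitian (d2^m) (\<Phi> (tpow n \<rho>1) - tpow m \<rho>2)"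
    by (intro hermitian_minus psdD(1) psd_tpow psd_states)
  then obtain W x where "specdec (d2^m) (\<Phi> (tpow n \<rho>1) - tpow m \<rho>2) W x" using hermitian_specdec by blast
  then show ?thesis unfolding tdist_def using trace_norm_specdec by (simp add: sum_nonneg)
qed

lemma feasible_measure_prepare:
  assumes T: "psd (d1^n) T" "psd (d1^n) (1\<^sub>m (d1^n) - T)" and Q: "density (d2^m) Q"
    and a: "Re (mtrace (T * tpow n \<sigma>1)) < 1"
    and dom: "psd (d2^m) (tpow m \<sigma>2 - complex_of_real (Re (mtrace (T * tpow n \<sigma>1))) \<cdot>\<^sub>m Q)"
  shows "\<exists>\<Phi>. feasible n m \<Phi> \<and> Re (mtrace (T * tpow n \<rho>1)) * Re (mtrace (tpow m \<rho>2 * Q)) \<le> overlap n m \<Phi>"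
  unfolding feasible_def overlap_def
  using achieve_oneshot[OF T density_tpow[OF \<sigma>1] density_tpow[OF \<sigma>2] Q refl a dom density_tpow[OF \<rho>1] psd_tpow[OF psd_states(3)]]
  by blast

text \<open>The test that never accepts yields the channel preparing the required output regardless
  of the input. It makes the set under the infimum nonempty.\<close>

lemma feasible_exists: "\<exists>\<Phi>. feasible n m \<Phi>"
proof -
  let ?T = "complex_of_real 0 \<cdot>\<^sub>m 1\<^sub>m (d1^n)"
  have z: "?T * X = 0\<^sub>m (d1^n) (d1^n)" if "X \<in> carrier_mat (d1^n) (d1^n)" for X
    by (rule eq_matI) (use that in \<open>auto simp: scalar_prod_def\<close>)
  have "Re (mtrace (?T * tpow n \<sigma>1)) = 0"
    unfolding z[OF psdD(2)[OF psd_tpow[OF psd_states(2)]]] by (simp add: mtrace_def)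
  moreover have "1\<^sub>m (d1^n) - ?T = 1\<^sub>m (d1^n)" by (rule eq_matI) auto
  moreover have "tpow m \<sigma>2 - complex_of_real 0 \<cdot>\<^sub>m tpow m \<sigma>2 = tpow m \<sigma>2" by (rule eq_matI) auto
  ultimately show ?thesis
    using feasible_measure_prepare[of n ?T m "tpow m \<sigma>2"] psd_smult[OF psd_one, of 0 "d1^n"] psd_one
      density_tpow[OF \<sigma>2] psd_tpow[OF psd_states(4)] by auto
qed

context
  fixes r :: real
begin

abbreviation "eps n \<equiv> eps_d d1 d2 \<rho>1 \<sigma>1 \<rho>2 \<sigma>2 r n"

lemma eps_eq_Inf: "eps n = Inf {tdist (\<Phi> (tpow n \<rho>1)) (tpow (outlen r n) \<rho>2) | \<Phi>. feasible n (outlen r n) \<Phi>}"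
  by (simp add: eps_d_def feasible_def)

lemma eps_lower:
  assumes "\<And>\<Phi>. feasible n (outlen r n) \<Phi> \<Longrightarrow> overlap n (outlen r n) \<Phi> \<le> B"
  shows "1 - B \<le> eps n"
  unfolding eps_eq_Inf
proof (rule cInf_greatest)
  show "{tdist (\<Phi> (tpow n \<rho>1)) (tpow (outlen r n) \<rho>2) | \<Phi>. feasible n (outlen r n) \<Phi>} \<noteq> {}"
    using feasible_exists by blast
  fix x assume "x \<in> {tdist (\<Phi> (tpow n \<rho>1)) (tpow (outlen r n) \<rho>2) | \<Phi>. feasible n (outlen r n) \<Phi>}"
  then show "1 - B \<le> x" using feasible_tdist(2) assms by fastforce
qed

lemma eps_upper:
  assumes "feasible n (outlen r n) \<Phi>"
  shows "eps n \<le> tdist (\<Phi> (tpow n \<rho>1)) (tpow (outlen r n) \<rho>2)"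
  unfolding eps_eq_Inf
proof (rule cInf_lower)
  show "bdd_below {tdist (\<Phi> (tpow n \<rho>1)) (tpow (outlen r n) \<rho>2) | \<Phi>. feasible n (outlen r n) \<Phi>}"
    using tdist_nonneg by (intro bdd_belowI[of _ 0]) auto
qed (use assms in blast)

lemma eps_le_1: "eps n \<le> 1"
  using feasible_exists[of n "outlen r n"] eps_upper feasible_tdist(1) order_trans by blast

abbreviation "sc \<equiv> sc_term d1 d2 \<rho>1 \<sigma>1 \<rho>2 \<sigma>2 r"

lemma sc_lower:
  assumes "\<And>\<Phi>. feasible n (outlen r n) \<Phi> \<Longrightarrow> overlap n (outlen r n) \<Phi> \<le> B" "B > 0"
  shows "ereal (- (1 / real n) * log 2 B) \<le> sc n"
proof (cases "eps n = 1")
  case False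
  then have e1: "eps n < 1" using eps_le_1[of n] by linarith
  have "1 - eps n \<le> B" using eps_lower[OF assms(1)] by simp
  then have "log 2 (1 - eps n) \<le> log 2 B" using e1 assms(2) by simp
  then have "(1 / real n) * log 2 (1 - eps n) \<le> (1 / real n) * log 2 B" by (intro mult_left_mono) auto
  then show ?thesis using False by (simp add: sc_term_def Let_def)
qed (simp add: sc_term_def)

lemma sc_upper:
  assumes "feasible n (outlen r n) \<Phi>" "B \<le> overlap n (outlen r n) \<Phi>" "B > 0"
  shows "sc n \<le> ereal (- (1 / real n) * log 2 (B / 2))"
proof -
  have "B / 2 \<le> 1 - y" if "x \<le> 2 * (1 - t)" "y \<le> t" "B \<le> x" for x t y :: real
  proof -
    have "B \<le> 2 * (1 - t)" using that(1,3) by (rule order_trans[rotated])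
    also have "\<dots> \<le> 2 * (1 - y)" using that(2) by simp
    finally show ?thesis by simp
  qed
  from this[OF feasible_tdist(3)[OF assms(1)] eps_upper[OF assms(1)] assms(2)] have B: "B / 2 \<le> 1 - eps n" .
  then have "eps n \<noteq> 1" using assms(3) by auto
  have "log 2 (B / 2) \<le> log 2 (1 - eps n)" using B assms(3) by simp
  then have "(1 / real n) * log 2 (B / 2) \<le> (1 / real n) * log 2 (1 - eps n)" by (intro mult_left_mono) auto
  then show ?thesis using \<open>eps n \<noteq> 1\<close> by (simp add: sc_term_def Let_def)
qed

lemma sc_infinite:
  assumes "\<And>\<Phi>. feasible n (outlen r n) \<Phi> \<Longrightarrow> overlap n (outlen r n) \<Phi> \<le> 0"
  shows "sc n = \<infinity>"
  using eps_lower[OF assms] eps_le_1[of n] by (simp add: sc_term_def)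

lemma overlap_le_1:
  assumes "feasible n m \<Phi>"
  shows "overlap n m \<Phi> \<le> 1"
proof -
  have p: "psd (d2^m) (\<Phi> (tpow n \<rho>1))" "mtrace (\<Phi> (tpow n \<rho>1)) = 1"
    using feasible_density[OF assms] by (auto simp: density_def)
  have "psd (d2^m) (1\<^sub>m (d2^m) - tpow m \<rho>2)"
    by (rule pure_state_le_one[OF pure_state_tpow[OF pure]])
  from psd_mtrace_mono[OF p(1) this psdD(2)[OF psd_tpow[OF psd_states(3)]] one_carrier_mat]
  show ?thesis
    unfolding overlap_def mtrace_comm[OF psdD(2)[OF psd_tpow[OF psd_states(3)]] psdD(2)[OF p(1)]]
    using p psdD(4)[OF p(1)] by simp
qed

lemma sc_nonneg: "0 \<le> sc n"
  using sc_lower[of n 1] overlap_le_1 by (simp add: zero_ereal_def)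

end

end

section \<open>The converse for tensor powers\<close>

lemma mtrace_mpow_le_1:
  assumes \<rho>: "density n \<rho>" and \<sigma>: "density n \<sigma>" and s: "s > 0"
  shows "Re (mtrace (\<rho> * mpow s \<sigma>)) \<le> 1"
proof -
  have \<rho>p: "psd n \<rho>" and \<rho>t: "mtrace \<rho> = 1" using \<rho> by (auto simp: density_def)
  have \<sigma>p: "psd n \<sigma>" and \<sigma>t: "mtrace \<sigma> = 1" using \<sigma> by (auto simp: density_def)
  obtain U q where U: "specdec n \<sigma> U q" "\<forall>i<n. 0 \<le> q i" using psd_obtain[OF \<sigma>p] by blast
  have "(\<Sum>i<n. q i) = 1" using mtrace_specdec[OF U(1)] \<sigma>t by (metis of_real_eq_1_iff)
  then have q1: "q i \<le> 1" if "i < n" for i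
    using member_le_sum[of i "{..<n}" q] U(2) that by auto
  have "specdec n (1\<^sub>m n) U (\<lambda>_. 1)"
    using specdecD(1)[OF U(1)] unitaryD[OF specdecD(1)[OF U(1)]] by (simp add: specdec_def diag_of_one)
  then have "psd n (1\<^sub>m n - mpow s \<sigma>)"
    using psd_specdec[OF specdec_diff[OF _ specdec_mpow[OF U(1), of s]]] q1 U(2) s powr_le1[of s] by auto
  from psd_mtrace_mono[OF \<rho>p this psdD(2)[OF mpow_psd[OF \<sigma>p]] one_carrier_mat]
  show ?thesis using psdD(4)[OF \<rho>p] \<rho>t by simp
qed

text \<open>The last bound converts polynomials in the output length into polynomials in
  \<open>n\<close>; the added 1 keeps it valid at \<open>n = 0\<close>.\<close>

lemma outlen_bounds:
  assumes "r > 0"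
  shows "real (outlen r n) \<le> real n * r" "real n * r - 1 \<le> real (outlen r n)"
    "real (outlen r n) + 1 \<le> (r + 1) * (real n + 1)"
proof -
  have 0: "0 \<le> real n * r" using assms by simp
  then have "real (outlen r n) = of_int \<lfloor>real n * r\<rfloor>" by (simp add: outlen_def)
  then show 1: "real (outlen r n) \<le> real n * r" "real n * r - 1 \<le> real (outlen r n)" by linarith+
  show "real (outlen r n) + 1 \<le> (r + 1) * (real n + 1)" using 1(1) assms by (simp add: algebra_simps)
qed

lemma power_eq_powr_log:
  fixes x :: real
  assumes "0 < x"
  shows "x ^ n = 2 powr (real n * log 2 x)"
proof -
  have "2 powr (real n * log 2 x) = (2 powr log 2 x) powr real n" by (simp add: powr_powr mult.commute)
  then show ?thesis using assms by (simp add: powr_realpow)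
qed

context conversion begin

text \<open>The trace in \<open>petz\<close> of order \<open>1 / \<beta>\<close>, where
  \<open>s = 1 - 1 / \<beta>\<close>. The power of \<open>\<rho>2\<close> is absent because a pure
  state is a projection.\<close>

definition petzQ :: "real \<Rightarrow> real" where
  "petzQ s = Re (mtrace (\<rho>2 * mpow s \<sigma>2))"

text \<open>The expression under the supremum with its prefactor multiplied out, as a real
  number.\<close>

definition rate :: "real \<Rightarrow> real \<Rightarrow> real" where
  "rate r \<beta> = - r * log 2 (petzQ ((\<beta> - 1) / \<beta>)) - log 2 (sandQ \<beta> \<rho>1 \<sigma>1) / \<beta>"

lemma petzQ_tpow: "Re (mtrace (tpow m \<rho>2 * mpow s (tpow m \<sigma>2))) = petzQ s ^ m"
proof -
  have "mtrace (tpow m \<rho>2 * mpow s (tpow m \<sigma>2)) = mtrace (\<rho>2 * mpow s \<sigma>2) ^ m"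
    unfolding mpow_tpow[OF psd_states(4)] by (rule mtrace_mult_tpow[OF psd_states(3) mpow_psd[OF psd_states(4)]])
  also have "\<dots> = complex_of_real (petzQ s) ^ m"
    unfolding petzQ_def using psd_mtrace_mult_real[OF psd_states(3) mpow_psd[OF psd_states(4), of s]] by simp
  also have "\<dots> = complex_of_real (petzQ s ^ m)" by simp
  finally show ?thesis by (simp only: Re_complex_of_real)
qed

lemma petzQ_le_1: "s > 0 \<Longrightarrow> petzQ s \<le> 1"
  unfolding petzQ_def by (rule mtrace_mpow_le_1[OF \<rho>2 \<sigma>2])

text \<open>Channels preserve domination, so the output lies below \<open>c^n\<close> times the
  prescribed one. This is crude, but it forces the overlap to vanish when \<open>\<rho>2\<close> and
  \<open>\<sigma>2\<close> are orthogonal.\<close>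

lemma overlap_dominated:
  assumes c: "c \<ge> 0" "psd d1 (complex_of_real c \<cdot>\<^sub>m \<sigma>1 - \<rho>1)" and \<Phi>: "feasible n m \<Phi>"
  shows "overlap n m \<Phi> \<le> c^n * Re (mtrace (\<rho>2 * \<sigma>2)) ^ m"
proof -
  note dom = dominated_tpow[OF psd_states(1,2) c, of n]
  have ch: "channel (d1^n) (d2^m) \<Phi>" "\<Phi> (tpow n \<sigma>1) = tpow m \<sigma>2" using \<Phi> by (auto simp: feasible_def)
  note c1 = psdD(2)[OF psd_tpow[OF psd_states(1)], of n] and c2 = psdD(2)[OF psd_tpow[OF psd_states(2)], of n]
  have "\<Phi> (complex_of_real (c^n) \<cdot>\<^sub>m tpow n \<sigma>1 - tpow n \<rho>1) = complex_of_real (c^n) \<cdot>\<^sub>m tpow m \<sigma>2 - \<Phi> (tpow n \<rho>1)"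
    using channel_minus[OF ch(1) _ c1, of "complex_of_real (c^n) \<cdot>\<^sub>m tpow n \<sigma>1"] channelD(3)[OF ch(1) c2] c2 ch(2)
    by simp
  then have "psd (d2^m) (complex_of_real (c^n) \<cdot>\<^sub>m tpow m \<sigma>2 - \<Phi> (tpow n \<rho>1))"
    using channel_psd[OF ch(1) dom] by simp
  then have "overlap n m \<Phi> \<le> Re (mtrace (tpow m \<rho>2 * (complex_of_real (c^n) \<cdot>\<^sub>m tpow m \<sigma>2)))"
    unfolding overlap_def using psdD(2)[OF psd_tpow[OF psd_states(4)], of m]
    by (intro psd_mtrace_mono[OF psd_tpow[OF psd_states(3)]]) (auto intro: channelD(1)[OF ch(1) c1])
  also have "mtrace (tpow m \<rho>2 * (complex_of_real (c^n) \<cdot>\<^sub>m tpow m \<sigma>2)) = complex_of_real (c^n) * mtrace (tpow m \<rho>2 * tpow m \<sigma>2)"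
    by (rule mtrace_mult_smult[OF psdD(2)[OF psd_tpow[OF psd_states(4)]] psdD(2)[OF psd_tpow[OF psd_states(3)]]])
  also have "mtrace (tpow m \<rho>2 * tpow m \<sigma>2) = complex_of_real (Re (mtrace (\<rho>2 * \<sigma>2)) ^ m)"
    unfolding mtrace_mult_tpow[OF psd_states(3,4)]
    using psd_mtrace_mult_real[OF psd_states(3,4)] by (metis of_real_power)
  finally show ?thesis by simp
qed

text \<open>The quantity \<open>v\<close> of the one-shot bound decays exponentially in the output
  length, so the number of dyadic levels down to \<open>v\<close> grows only linearly and the
  prefactor stays polynomial.\<close>

lemma converse_bound:
  assumes c: "c \<ge> 1" "psd d1 (complex_of_real c \<cdot>\<^sub>m \<sigma>1 - \<rho>1)" and \<beta>: "\<beta> > 1" and r: "r > 0"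
    and v: "petzQ ((\<beta> - 1) / \<beta>) > 0"
  shows "\<exists>C D. C > 0 \<and> (\<forall>n \<Phi>. feasible n (outlen r n) \<Phi> \<longrightarrow>
    overlap n (outlen r n) \<Phi> \<le> C * (real n + 1) ^ D * 2 powr (- real n * rate r \<beta>))"
proof -
  define s where "s = (\<beta> - 1) / \<beta>"
  have s: "s > 0" using \<beta> by (simp add: s_def)
  let ?v = "petzQ s" and ?Q = "sandQ \<beta> \<rho>1 \<sigma>1"
  have v0: "?v > 0" and v1: "?v \<le> 1" using v petzQ_le_1[OF s] by (auto simp: s_def)
  have Q1: "?Q \<ge> 1" by (rule sandQ_ge_1[OF \<rho>1 \<sigma>1 c(2) \<beta>])
  define l where "l = - log 2 ?v"
  have l0: "l \<ge> 0" unfolding l_def using v0 v1 by simp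
  obtain U1 e1 where U1: "specdec d1 \<sigma>1 U1 e1" using psd_obtain[OF psd_states(2)] by blast
  obtain U2 e2 where U2: "specdec d2 \<sigma>2 U2 e2" using psd_obtain[OF psd_states(4)] by blast
  \<comment> \<open>\<open>2 * l + 3\<close> bounds the level count,
    \<open>(r + 1) ^ (d2 + 1)\<close> replaces the output length by \<open>n\<close>, and
    \<open>1 / ?v\<close> pays for rounding \<open>n r\<close> down.\<close>
  define C where "C = (2 * l + 3) * (r + 1) ^ (d2 + 1) / ?v"
  define D where "D = d1 + d2 + 1"
  have "overlap n (outlen r n) \<Phi> \<le> C * (real n + 1) ^ D * 2 powr (- real n * rate r \<beta>)"
    if \<Phi>: "feasible n (outlen r n) \<Phi>" for n \<Phi>
  proof -
    define m where "m = outlen r n"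
    note m = outlen_bounds[OF r, of n, folded m_def]
    obtain V \<epsilon> where V: "specdec (d1^n) (tpow n \<sigma>1) V \<epsilon>" "card (\<epsilon> ` {..<d1^n}) \<le> (n+1)^d1"
      using specdec_tpow[OF U1] by blast
    obtain V' \<epsilon>' where V': "specdec (d2^m) (tpow m \<sigma>2) V' \<epsilon>'" "card (\<epsilon>' ` {..<d2^m}) \<le> (m+1)^d2"
      using specdec_tpow[OF U2] by blast
    have K1: "real (card (\<epsilon> ` {..<d1^n})) \<le> (real n + 1)^d1"
      using V(2) by (metis of_nat_1 of_nat_add of_nat_le_iff of_nat_power)
    have K2: "real (card (\<epsilon>' ` {..<d2^m})) \<le> (real m + 1)^d2"
      using V'(2) by (metis of_nat_1 of_nat_add of_nat_le_iff of_nat_power)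
    \<comment> \<open>The least \<open>J\<close> with \<open>(1/2)^J \<le> ?v ^ m\<close>, since
      \<open>?v ^ m\<close> equals 2 to the power \<open>- m * l\<close>.\<close>
    define J where "J = nat \<lceil>real m * l\<rceil>"
    have Jl: "real m * l \<le> real J" unfolding J_def by linarith
    have ml: "0 \<le> real m * l" using l0 by simp
    have Ju: "real J \<le> real m * l + 1" unfolding J_def using ml by linarith
    have vm: "?v ^ m = 2 powr (- (real m * l))" using power_eq_powr_log[OF v0, of m] by (simp add: l_def)
    have "(1/2::real)^J = 2 powr (- real J)" using power_eq_powr_log[of "1/2" J] by (simp add: log_divide)
    also have "\<dots> \<le> ?v ^ m" unfolding vm using Jl by simp
    finally have J: "(1/2)^J \<le> Re (mtrace (tpow m \<rho>2 * mpow ((\<beta> - 1) / \<beta>) (tpow m \<sigma>2)))"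
      unfolding petzQ_tpow s_def .
    have ch: "channel (d1^n) (d2^m) \<Phi>" "\<Phi> (tpow n \<sigma>1) = tpow m \<sigma>2" using \<Phi> by (auto simp: feasible_def m_def)
    have "overlap n m \<Phi> \<le> (real n + 1)^d1 * (2 * real J * (real m + 1)^d2 + 1) * (?Q ^ n) powr (1 / \<beta>) * ?v ^ m"
      using converse_oneshot[OF density_tpow[OF \<rho>1] density_tpow[OF \<sigma>1] dominated_tpow[OF psd_states(1,2) _ c(2)]
          V(1) K1 V'(1) K2 ch psd_tpow[OF psd_states(3)] pure_state_le_one[OF pure_state_tpow[OF pure]] \<beta> J] c(1)
      unfolding overlap_def petzQ_tpow sandQ_tpow[OF psd_states(1,2)] s_def by simp
    also have "\<dots> = ((real n + 1)^d1 * (2 * real J * (real m + 1)^d2 + 1)) * ((?Q ^ n) powr (1 / \<beta>) * ?v ^ m)"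
      by (simp only: mult.assoc)
    also have "\<dots> \<le> ((real n + 1)^d1 * ((2 * l + 3) * (r + 1) ^ (d2 + 1) * (real n + 1) ^ (d2 + 1)))
        * (2 powr (- real n * rate r \<beta>) / ?v)"
    proof (intro mult_mono mult_left_mono)
      have "2 * real J * (real m + 1)^d2 + 1 \<le> 2 * ((l + 1) * (real m + 1)) * (real m + 1)^d2 + (real m + 1)^(d2 + 1)"
      proof (intro add_mono mult_right_mono mult_left_mono)
        show "real J \<le> (l + 1) * (real m + 1)" using Ju l0 by (simp add: algebra_simps)
        show "1 \<le> (real m + 1)^(d2 + 1)" by (intro one_le_power) simp
      qed auto
      also have "\<dots> = (2 * l + 3) * (real m + 1)^(d2 + 1)" by (simp add: algebra_simps)
      also have "\<dots> \<le> (2 * l + 3) * ((r + 1) * (real n + 1))^(d2 + 1)"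
        using m(3) l0 by (intro mult_left_mono power_mono) auto
      finally show "2 * real J * (real m + 1)^d2 + 1 \<le> (2 * l + 3) * (r + 1) ^ (d2 + 1) * (real n + 1) ^ (d2 + 1)"
        by (simp only: power_mult_distrib mult.assoc)
      have "(?Q ^ n) powr (1 / \<beta>) = 2 powr (real n * (log 2 ?Q / \<beta>))"
        using power_eq_powr_log[of ?Q n] Q1 by (simp add: powr_powr)
      moreover have "?v ^ m \<le> 2 powr (real n * r * log 2 ?v - log 2 ?v)"
      proof -
        have "(real n * r - 1) * l \<le> real m * l" using m(2) l0 by (rule mult_right_mono)
        then have "- (real m * l) \<le> real n * r * log 2 ?v - log 2 ?v" by (simp add: l_def algebra_simps)
        then show ?thesis unfolding vm by simp
      qed
      ultimately have "(?Q ^ n) powr (1 / \<beta>) * ?v ^ m \<le> 2 powr (real n * (log 2 ?Q / \<beta>)) * 2 powr (real n * r * log 2 ?v - log 2 ?v)"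
        by (simp add: mult_left_mono)
      also have "\<dots> = 2 powr (- real n * rate r \<beta> - log 2 ?v)"
        unfolding powr_add[symmetric] rate_def s_def by (simp add: algebra_simps)
      also have "\<dots> = 2 powr (- real n * rate r \<beta>) / ?v" using v0 by (simp add: powr_diff)
      finally show "(?Q ^ n) powr (1 / \<beta>) * ?v ^ m \<le> 2 powr (- real n * rate r \<beta>) / ?v" .
    qed (use v0 l0 r in \<open>auto intro!: mult_nonneg_nonneg\<close>)
    also have "\<dots> = C * (real n + 1) ^ D * 2 powr (- real n * rate r \<beta>)"
      by (simp add: C_def D_def power_add)
    finally show ?thesis by (simp add: m_def)
  qed
  moreover have "C > 0" unfolding C_def using l0 r v0 by (intro divide_pos_pos mult_pos_pos) auto
  ultimately show ?thesis by blast
qed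

lemma sc_eventually_gt:
  assumes c: "c \<ge> 1" "psd d1 (complex_of_real c \<cdot>\<^sub>m \<sigma>1 - \<rho>1)" and \<beta>: "\<beta> > 1" and r: "r > 0"
    and v: "petzQ ((\<beta> - 1) / \<beta>) > 0" and y: "y < rate r \<beta>"
  shows "eventually (\<lambda>n. ereal y < sc_term d1 d2 \<rho>1 \<sigma>1 \<rho>2 \<sigma>2 r n) sequentially"
proof -
  obtain C D where C: "C > 0" and bd: "\<And>n \<Phi>. feasible n (outlen r n) \<Phi> \<Longrightarrow>
    overlap n (outlen r n) \<Phi> \<le> C * (real n + 1) ^ D * 2 powr (- real n * rate r \<beta>)"
    using converse_bound[OF c \<beta> r v] by blast
  define R where "R = rate r \<beta>"
  have "(\<lambda>n. (log 2 C + real D * log 2 (real n + 1)) / real n) \<longlonglongrightarrow> 0" by real_asymp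
  then have "eventually (\<lambda>n. (log 2 C + real D * log 2 (real n + 1)) / real n < R - y) sequentially"
    using y by (intro order_tendstoD(2)) (auto simp: R_def)
  moreover have "eventually (\<lambda>n. n > 0) sequentially" by (rule eventually_gt_at_top)
  ultimately show ?thesis
  proof (eventually_elim)
    case (elim n)
    let ?B = "C * (real n + 1) ^ D * 2 powr (- real n * R)"
    have "log 2 ?B = log 2 C + real D * log 2 (real n + 1) - real n * R"
      using C by (simp add: log_mult log_nat_power)
    then have "- (1 / real n) * log 2 ?B = R - (log 2 C + real D * log 2 (real n + 1)) / real n"
      using elim(2) by (simp add: field_simps)
    then have "y < - (1 / real n) * log 2 ?B" using elim(1) by linarith
    also have "ereal (- (1 / real n) * log 2 ?B) \<le> sc_term d1 d2 \<rho>1 \<sigma>1 \<rho>2 \<sigma>2 r n"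
      by (rule sc_lower) (use bd C in \<open>auto simp: R_def\<close>)
    finally show ?case by simp
  qed
qed

end

section \<open>Combining tests and output states\<close>

lemma Re_mult_real: "Im x = 0 \<Longrightarrow> Re (x * y) = Re x * Re y"
  by simp

lemma psd_mtrace_mult_kron:
  assumes "psd n A" "psd n B" "psd m C" "psd m D"
  shows "Re (mtrace (kron A C * kron B D)) = Re (mtrace (A * B)) * Re (mtrace (C * D))"
proof -
  note c = psdD(2)[OF assms(1)] psdD(2)[OF assms(2)] psdD(2)[OF assms(3)] psdD(2)[OF assms(4)]
  have "kron A C * kron B D = kron (A * B) (C * D)" using c by (intro kron_mult) auto
  also have "mtrace \<dots> = mtrace (A * B) * mtrace (C * D)"
    by (rule mtrace_kron[OF mult_carrier_mat[OF c(1,2)] mult_carrier_mat[OF c(3,4)]])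
  finally show ?thesis
    using psd_mtrace_mult_real[OF assms(1,2)] by (metis Im_complex_of_real Re_mult_real)
qed

context conversion begin

text \<open>Only the two acceptance weights of a test are retained; they multiply under tensor
  products. \<open>out_opt\<close> does the same for the overlap of a prepared state and the
  multiple of it that fits below \<open>\<sigma>2\<close>.\<close>

definition test_opt :: "nat \<Rightarrow> real \<Rightarrow> real \<Rightarrow> bool" where
  "test_opt n b a \<longleftrightarrow> (\<exists>T. psd (d1^n) T \<and> psd (d1^n) (1\<^sub>m (d1^n) - T) \<and>
     Re (mtrace (T * tpow n \<rho>1)) = b \<and> Re (mtrace (T * tpow n \<sigma>1)) = a)"

definition out_opt :: "nat \<Rightarrow> real \<Rightarrow> real \<Rightarrow> bool" where
  "out_opt m w l \<longleftrightarrow> (\<exists>Q. density (d2^m) Q \<and> psd (d2^m) (tpow m \<sigma>2 - complex_of_real l \<cdot>\<^sub>m Q) \<and>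
     Re (mtrace (tpow m \<rho>2 * Q)) = w)"

lemma test_opt_add:
  assumes "test_opt n b a" "test_opt n' b' a'"
  shows "test_opt (n + n') (b * b') (a * a')"
proof -
  obtain T where T: "psd (d1^n) T" "psd (d1^n) (1\<^sub>m (d1^n) - T)"
    "Re (mtrace (T * tpow n \<rho>1)) = b" "Re (mtrace (T * tpow n \<sigma>1)) = a" using assms(1) by (auto simp: test_opt_def)
  obtain T' where T': "psd (d1^n') T'" "psd (d1^n') (1\<^sub>m (d1^n') - T')"
    "Re (mtrace (T' * tpow n' \<rho>1)) = b'" "Re (mtrace (T' * tpow n' \<sigma>1)) = a'" using assms(2) by (auto simp: test_opt_def)
  have "psd (d1^n * d1^n') (kron (1\<^sub>m (d1^n)) (1\<^sub>m (d1^n')) - kron T T')"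
    by (rule psd_kron_mono[OF T(1) psd_one T(2) T'(2)]) (use psdD(2)[OF T'(1)] in auto)
  then show ?thesis
    unfolding test_opt_def power_add tpow_add
    using psd_kron[OF T(1) T'(1)]
      psd_mtrace_mult_kron[OF T(1) psd_tpow[OF psd_states(1)] T'(1) psd_tpow[OF psd_states(1)]]
      psd_mtrace_mult_kron[OF T(1) psd_tpow[OF psd_states(2)] T'(1) psd_tpow[OF psd_states(2)]] T(3,4) T'(3,4)
    by (intro exI[of _ "kron T T'"]) (auto simp: kron_one)
qed

lemma out_opt_add:
  assumes "out_opt m w l" "out_opt m' w' l'" "l \<ge> 0" "l' \<ge> 0"
  shows "out_opt (m + m') (w * w') (l * l')"
proof -
  obtain Q where Q: "density (d2^m) Q" "psd (d2^m) (tpow m \<sigma>2 - complex_of_real l \<cdot>\<^sub>m Q)"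
    "Re (mtrace (tpow m \<rho>2 * Q)) = w" using assms(1) by (auto simp: out_opt_def)
  obtain Q' where Q': "density (d2^m') Q'" "psd (d2^m') (tpow m' \<sigma>2 - complex_of_real l' \<cdot>\<^sub>m Q')"
    "Re (mtrace (tpow m' \<rho>2 * Q')) = w'" using assms(2) by (auto simp: out_opt_def)
  have p: "psd (d2^m) Q" "psd (d2^m') Q'" "mtrace Q = 1" "mtrace Q' = 1" using Q(1) Q'(1) by (auto simp: density_def)
  have "density (d2^m * d2^m') (kron Q Q')"
    using psd_kron[OF p(1,2)] mtrace_kron[OF psdD(2)[OF p(1)] psdD(2)[OF p(2)]] p(3,4) by (simp add: density_def)
  moreover have "psd (d2^m * d2^m') (kron (tpow m \<sigma>2) (tpow m' \<sigma>2) - kron (complex_of_real l \<cdot>\<^sub>m Q) (complex_of_real l' \<cdot>\<^sub>m Q'))"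
    by (rule psd_kron_mono[OF psd_smult[OF p(1) assms(3)] psd_tpow[OF psd_states(4)] Q(2) Q'(2)])
      (use psdD(2)[OF p(2)] psdD(2)[OF psd_tpow[OF psd_states(4)]] in auto)
  ultimately show ?thesis
    unfolding out_opt_def power_add tpow_add
    using psd_mtrace_mult_kron[OF psd_tpow[OF psd_states(3)] p(1) psd_tpow[OF psd_states(3)] p(2)] Q(3) Q'(3)
    by (intro exI[of _ "kron Q Q'"]) (auto simp: kron_smult)
qed

text \<open>The smaller of \<open>x\<close> and \<open>y\<close> is the logarithm of the achievable
  overlap, up to a constant: \<open>y\<close> is relevant when the test must be attenuated because
  \<open>a\<close> exceeds \<open>l\<close>. Moreover \<open>(1 - s) * x + s * y\<close> is the
  logarithm of \<open>b * w * (l / a) powr s\<close>.\<close>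

definition achieves :: "nat \<Rightarrow> nat \<Rightarrow> real \<Rightarrow> real \<Rightarrow> bool" where
  "achieves n m x y \<longleftrightarrow> (\<exists>b a w l. 0 < b \<and> 0 < a \<and> 0 < w \<and> 0 < l \<and> test_opt n b a \<and> out_opt m w l \<and>
     x = log 2 (b * w) \<and> y = log 2 (b * w * l / a))"

lemma achieves_add:
  assumes "achieves n m x y" "achieves n' m' x' y'"
  shows "achieves (n + n') (m + m') (x + x') (y + y')"
proof -
  obtain b a w l where A: "0 < b" "0 < a" "0 < w" "0 < l" "test_opt n b a" "out_opt m w l"
    "x = log 2 (b * w)" "y = log 2 (b * w * l / a)" using assms(1) by (auto simp: achieves_def)
  obtain b' a' w' l' where B: "0 < b'" "0 < a'" "0 < w'" "0 < l'" "test_opt n' b' a'" "out_opt m' w' l'"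
    "x' = log 2 (b' * w')" "y' = log 2 (b' * w' * l' / a')" using assms(2) by (auto simp: achieves_def)
  have "x + x' = log 2 ((b * b') * (w * w'))" using A B by (simp add: log_mult)
  moreover have "y + y' = log 2 ((b * b') * (w * w') * (l * l') / (a * a'))"
    using A B by (simp add: log_mult log_divide)
  ultimately show ?thesis unfolding achieves_def
    using A(1-4) B(1-4) test_opt_add[OF A(5) B(5)] out_opt_add[OF A(6) B(6)]
    by (intro exI[of _ "b * b'"] exI[of _ "a * a'"] exI[of _ "w * w'"] exI[of _ "l * l'"]) simp
qed

lemma test_opt_trivial: "test_opt n 1 1"
proof -
  have "density (d1^n) (tpow n \<rho>1)" "density (d1^n) (tpow n \<sigma>1)" using density_tpow \<rho>1 \<sigma>1 by auto
  then have "psd (d1^n) (tpow n \<rho>1)" "psd (d1^n) (tpow n \<sigma>1)" "mtrace (tpow n \<rho>1) = 1" "mtrace (tpow n \<sigma>1) = 1"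
    by (auto simp: density_def)
  note p = this
  have "1\<^sub>m (d1^n) - 1\<^sub>m (d1^n) = complex_of_real 0 \<cdot>\<^sub>m 1\<^sub>m (d1^n)" by (rule eq_matI) auto
  then have "psd (d1^n) (1\<^sub>m (d1^n) - 1\<^sub>m (d1^n))" using psd_smult[OF psd_one, of 0] by simp
  then show ?thesis unfolding test_opt_def
    using psd_one p psdD(3)[OF p(1)] psdD(3)[OF p(2)] by (intro exI[of _ "1\<^sub>m (d1^n)"]) simp
qed

lemma out_opt_trivial: "out_opt 0 1 1"
proof -
  have "1\<^sub>m 1 - complex_of_real 1 \<cdot>\<^sub>m 1\<^sub>m 1 = complex_of_real 0 \<cdot>\<^sub>m 1\<^sub>m 1" by (rule eq_matI) auto
  then have "psd 1 (1\<^sub>m 1 - complex_of_real 1 \<cdot>\<^sub>m 1\<^sub>m 1)" using psd_smult[OF psd_one, of 0 1] by simp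
  then show ?thesis unfolding out_opt_def
    by (intro exI[of _ "1\<^sub>m 1"]) (auto simp: density_def psd_one mtrace_def)
qed

text \<open>Surplus input copies are ignored by the trivial test at no cost; this pads the input to
  an arbitrary length.\<close>

lemma achieves_input: "achieves n 0 0 0"
  unfolding achieves_def using test_opt_trivial out_opt_trivial
  by (intro exI[of _ "1::real"]) auto

lemma achieves_times:
  assumes "achieves n m x y"
  shows "achieves (k * n) (k * m) (real k * x) (real k * y)"
proof (induction k)
  case 0
  show ?case using achieves_input[of 0] by simp
next
  case (Suc k)
  show ?case using achieves_add[OF assms Suc] by (simp add: algebra_simps)
qed

text \<open>The test is scaled by \<open>\<theta> = min 1 (l / a) / 2\<close>. The minimum brings
  its \<open>\<sigma>\<close>-weight down to at most \<open>l\<close>, so the output fits below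
  \<open>\<sigma>2\<close>; the half keeps that weight below 1, as normalising the second prepared
  state requires.\<close>

lemma achieves_value:
  assumes "achieves n m x y"
  shows "\<exists>\<Phi>. feasible n m \<Phi> \<and> 2 powr (min x y) / 2 \<le> overlap n m \<Phi>"
proof -
  obtain b a w l where A: "0 < b" "0 < a" "0 < w" "0 < l" "test_opt n b a" "out_opt m w l"
    "x = log 2 (b * w)" "y = log 2 (b * w * l / a)" using assms(1) by (auto simp: achieves_def)
  obtain T where T: "psd (d1^n) T" "psd (d1^n) (1\<^sub>m (d1^n) - T)"
    "Re (mtrace (T * tpow n \<rho>1)) = b" "Re (mtrace (T * tpow n \<sigma>1)) = a" using A(5) by (auto simp: test_opt_def)
  obtain Q where Q: "density (d2^m) Q" "psd (d2^m) (tpow m \<sigma>2 - complex_of_real l \<cdot>\<^sub>m Q)"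
    "Re (mtrace (tpow m \<rho>2 * Q)) = w" using A(6) by (auto simp: out_opt_def)
  have Qp: "psd (d2^m) Q" using Q(1) by (simp add: density_def)
  note s1 = psd_tpow[OF psd_states(1), of n] and s2 = psd_tpow[OF psd_states(2), of n]
  note Tc = psdD(2)[OF T(1)]
  have a1: "a \<le> 1"
  proof -
    have "Re (mtrace (tpow n \<sigma>1 * T)) \<le> Re (mtrace (tpow n \<sigma>1 * 1\<^sub>m (d1^n)))"
      by (rule psd_mtrace_mono[OF s2 T(2) Tc one_carrier_mat])
    moreover have "mtrace (tpow n \<sigma>1) = 1" using density_tpow[OF \<sigma>1] by (simp add: density_def)
    ultimately show ?thesis using mtrace_comm[OF Tc psdD(2)[OF s2]] T(4) psdD(4)[OF s2] by simp
  qed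
  define \<theta> where "\<theta> = min 1 (l / a) / 2"
  have \<theta>: "0 < \<theta>" "\<theta> \<le> 1/2" "\<theta> * a \<le> l" using A by (auto simp: \<theta>_def min_def field_simps)
  define T' where "T' = complex_of_real \<theta> \<cdot>\<^sub>m T"
  have T'1: "psd (d1^n) T'" unfolding T'_def using \<theta> by (intro psd_smult T(1)) auto
  have T'2: "psd (d1^n) (1\<^sub>m (d1^n) - T')"
  proof -
    have "1\<^sub>m (d1^n) - T' = complex_of_real (1 - \<theta>) \<cdot>\<^sub>m 1\<^sub>m (d1^n) + complex_of_real \<theta> \<cdot>\<^sub>m (1\<^sub>m (d1^n) - T)"
      unfolding T'_def by (rule eq_matI) (use Tc in \<open>auto simp: algebra_simps\<close>)
    then show ?thesis using psd_add[OF psd_smult[OF psd_one, of "1 - \<theta>"] psd_smult[OF T(2), of \<theta>]] \<theta> by simp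
  qed
  have sc: "Re (mtrace (T' * X)) = \<theta> * Re (mtrace (T * X))" if "X \<in> carrier_mat (d1^n) (d1^n)" for X
    using mtrace_comm[OF Tc that] mtrace_comm[OF psdD(2)[OF T'1] that] mtrace_mult_smult[OF Tc that, of "complex_of_real \<theta>"]
    by (simp add: T'_def)
  have ta: "Re (mtrace (T' * tpow n \<sigma>1)) = \<theta> * a" using sc[OF psdD(2)[OF s2]] T(4) by simp
  have tb: "Re (mtrace (T' * tpow n \<rho>1)) = \<theta> * b" using sc[OF psdD(2)[OF s1]] T(3) by simp
  have "psd (d2^m) (tpow m \<sigma>2 - complex_of_real (\<theta> * a) \<cdot>\<^sub>m Q)"
  proof -
    have "tpow m \<sigma>2 - complex_of_real (\<theta> * a) \<cdot>\<^sub>m Q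
      = (tpow m \<sigma>2 - complex_of_real l \<cdot>\<^sub>m Q) + complex_of_real (l - \<theta> * a) \<cdot>\<^sub>m Q"
      by (rule eq_matI) (use psdD(3,4)[OF Qp] psdD(3,4)[OF psd_tpow[OF psd_states(4)], of m] in \<open>auto simp: algebra_simps\<close>)
    then show ?thesis using psd_add[OF Q(2) psd_smult[OF Qp, of "l - \<theta> * a"]] \<theta>(3) by simp
  qed
  moreover have "\<theta> * a < 1"
    using mult_mono[OF \<theta>(2) a1] A(2) by simp
  ultimately obtain \<Phi> where \<Phi>: "feasible n m \<Phi>" "(\<theta> * b) * w \<le> overlap n m \<Phi>"
    using feasible_measure_prepare[OF T'1 T'2 Q(1)] unfolding ta tb Q(3) by blast
  have "2 powr (min x y) \<le> 2 * (\<theta> * b * w)"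
  proof -
    have X: "2 powr x = b * w" "2 powr y = b * w * l / a" using A by simp_all
    show ?thesis
    proof (cases "1 \<le> l / a")
      case True
      then have "2 * (\<theta> * b * w) = b * w" by (simp add: \<theta>_def min_def)
      moreover have "2 powr (min x y) \<le> 2 powr x" by simp
      ultimately show ?thesis by (simp only: X)
    next
      case False
      then have "2 * (\<theta> * b * w) = b * w * l / a" by (simp add: \<theta>_def min_def)
      moreover have "2 powr (min x y) \<le> 2 powr y" by simp
      ultimately show ?thesis by (simp only: X)
    qed
  qed
  then show ?thesis using \<Phi> by (intro exI[of _ \<Phi>]) auto
qed

section \<open>Finite families for tensor powers and blocks\<close>

lemma out_choices:
  "\<exists>I. finite I \<and> (\<forall>(w,l)\<in>I. out_opt m w l \<and> 0 < w \<and> 0 < l) \<and>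
    (\<forall>s>0. 0 < petzQ s \<longrightarrow> (\<exists>(w,l)\<in>I. petzQ s ^ m \<le> (real m + 1)^d2 * (w * l powr s)))"
proof -
  obtain U e where U: "specdec d2 \<sigma>2 U e" using psd_obtain[OF psd_states(4)] by blast
  obtain V \<epsilon> where V: "specdec (d2^m) (tpow m \<sigma>2) V \<epsilon>" "card (\<epsilon> ` {..<d2^m}) \<le> (m+1)^d2"
    using specdec_tpow[OF U] by blast
  have K: "real (card (\<epsilon> ` {..<d2^m})) \<le> (real m + 1)^d2"
    using V(2) by (metis of_nat_1 of_nat_add of_nat_le_iff of_nat_power)
  obtain I where I: "finite I" "\<forall>(Q,l)\<in>I. density (d2^m) Q \<and> psd (d2^m) (tpow m \<sigma>2 - complex_of_real l \<cdot>\<^sub>m Q) \<and>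
      0 < Re (mtrace (tpow m \<rho>2 * Q)) \<and> 0 < l"
    "\<forall>s>0. 0 < Re (mtrace (tpow m \<rho>2 * mpow s (tpow m \<sigma>2))) \<longrightarrow> (\<exists>(Q,l)\<in>I. Re (mtrace (tpow m \<rho>2 * mpow s (tpow m \<sigma>2)))
      \<le> (real m + 1)^d2 * (Re (mtrace (tpow m \<rho>2 * Q)) * l powr s))"
    using output_family[OF pure_state_tpow[OF pure] density_tpow[OF \<sigma>2] V(1) K] by blast
  let ?f = "\<lambda>(Q,l). (Re (mtrace (tpow m \<rho>2 * Q)), l :: real)"
  show ?thesis
  proof (intro exI[of _ "?f ` I"] conjI allI impI)
    show "finite (?f ` I)" using I(1) by simp
    show "\<forall>(w,l)\<in>?f ` I. out_opt m w l \<and> 0 < w \<and> 0 < l"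
      using I(2) by (fastforce simp: out_opt_def)
    fix s :: real assume s: "s > 0" "0 < petzQ s"
    then obtain Q l where "(Q,l) \<in> I" "petzQ s ^ m \<le> (real m + 1)^d2 * (Re (mtrace (tpow m \<rho>2 * Q)) * l powr s)"
      using I(3) unfolding petzQ_tpow by fastforce
    then show "\<exists>(w,l)\<in>?f ` I. petzQ s ^ m \<le> (real m + 1)^d2 * (w * l powr s)" by force
  qed
qed

lemma test_choices:
  assumes c: "c \<ge> 1" "psd d1 (complex_of_real c \<cdot>\<^sub>m \<sigma>1 - \<rho>1)"
  shows "\<exists>I. finite I \<and> (\<forall>(b,a)\<in>I. test_opt n b a \<and> 0 < b \<and> 0 < a) \<and>
    (\<forall>\<beta>>1. \<exists>(b,a)\<in>I. (sandQ \<beta> \<rho>1 \<sigma>1 ^ n) powr (1 / \<beta>) \<le>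
      2 * (real n + 1)^d1 * ((log 2 c + 2) * (real n + 1)) * (b * a powr (- ((\<beta> - 1) / \<beta>))))"
proof -
  obtain U e where U: "specdec d1 \<sigma>1 U e" using psd_obtain[OF psd_states(2)] by blast
  obtain V \<epsilon> where V: "specdec (d1^n) (tpow n \<sigma>1) V \<epsilon>" "card (\<epsilon> ` {..<d1^n}) \<le> (n+1)^d1"
    using specdec_tpow[OF U] by blast
  have K: "real (card (\<epsilon> ` {..<d1^n})) \<le> (real n + 1)^d1"
    using V(2) by (metis of_nat_1 of_nat_add of_nat_le_iff of_nat_power)
  \<comment> \<open>The likelihood ratio of \<open>n\<close> copies is at most \<open>c^n\<close>,
    so linearly many dyadic levels suffice.\<close>
  define J where "J = nat \<lceil>real n * log 2 c\<rceil>"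
  have lc: "log 2 c \<ge> 0" using c(1) by simp
  then have nl: "0 \<le> real n * log 2 c" by simp
  have J1: "real n * log 2 c \<le> real J" unfolding J_def by linarith
  have J2: "real J + 1 \<le> (log 2 c + 2) * (real n + 1)"
  proof -
    have "real J \<le> real n * log 2 c + 1" unfolding J_def using nl by linarith
    then show ?thesis using lc by (simp add: algebra_simps)
  qed
  have "c^n = 2 powr (real n * log 2 c)" using c(1) by (intro power_eq_powr_log) simp
  also have "\<dots> \<le> 2 powr real J" using J1 by simp
  finally have cJ: "c^n \<le> 2^J" by (simp add: powr_realpow)
  have "psd (d1^n) (complex_of_real (c^n) \<cdot>\<^sub>m tpow n \<sigma>1 - tpow n \<rho>1)"
    using c by (intro dominated_tpow[OF psd_states(1,2)]) auto
  from test_family[OF density_tpow[OF \<rho>1] density_tpow[OF \<sigma>1] this V(1) K cJ]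
  obtain I where I: "finite I"
    "\<forall>T\<in>I. psd (d1^n) T \<and> psd (d1^n) (1\<^sub>m (d1^n) - T) \<and> 0 < Re (mtrace (T * tpow n \<rho>1)) \<and> 0 < Re (mtrace (T * tpow n \<sigma>1))"
    "\<forall>\<beta>>1. \<exists>T\<in>I. (sandQ \<beta> \<rho>1 \<sigma>1 ^ n) powr (1 / \<beta>) \<le> 2 * (real n + 1)^d1 * (real J + 1) *
      (Re (mtrace (T * tpow n \<rho>1)) * Re (mtrace (T * tpow n \<sigma>1)) powr (- ((\<beta> - 1) / \<beta>)))"
    unfolding sandQ_tpow[OF psd_states(1,2)] by blast
  let ?f = "\<lambda>T. (Re (mtrace (T * tpow n \<rho>1)), Re (mtrace (T * tpow n \<sigma>1)))"
  show ?thesis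
  proof (intro exI[of _ "?f ` I"] conjI allI impI)
    show "finite (?f ` I)" using I(1) by simp
    show "\<forall>(b,a)\<in>?f ` I. test_opt n b a \<and> 0 < b \<and> 0 < a"
      using I(2) by (fastforce simp: test_opt_def)
    fix \<beta> :: real assume "\<beta> > 1"
    then obtain T where T: "T \<in> I" "(sandQ \<beta> \<rho>1 \<sigma>1 ^ n) powr (1 / \<beta>) \<le> 2 * (real n + 1)^d1 * (real J + 1) *
      (Re (mtrace (T * tpow n \<rho>1)) * Re (mtrace (T * tpow n \<sigma>1)) powr (- ((\<beta> - 1) / \<beta>)))"
      using I(3) by blast
    note T(2)
    also have "2 * (real n + 1)^d1 * (real J + 1) *
      (Re (mtrace (T * tpow n \<rho>1)) * Re (mtrace (T * tpow n \<sigma>1)) powr (- ((\<beta> - 1) / \<beta>)))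
      \<le> 2 * (real n + 1)^d1 * ((log 2 c + 2) * (real n + 1)) *
      (Re (mtrace (T * tpow n \<rho>1)) * Re (mtrace (T * tpow n \<sigma>1)) powr (- ((\<beta> - 1) / \<beta>)))"
      using J2 I(2) T(1) by (intro mult_right_mono mult_left_mono) (auto intro!: mult_nonneg_nonneg less_imp_le)
    finally show "\<exists>(b,a)\<in>?f ` I. (sandQ \<beta> \<rho>1 \<sigma>1 ^ n) powr (1 / \<beta>) \<le>
      2 * (real n + 1)^d1 * ((log 2 c + 2) * (real n + 1)) * (b * a powr (- ((\<beta> - 1) / \<beta>)))"
      using T(1) by (intro bexI[of _ "?f T"]) auto
  qed
qed

text \<open>All combinations of a test with an output state form the family, fixed before
  \<open>s\<close>. For given \<open>s\<close> the best test and the best output are chosen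
  independently; the product of their bounds is exactly the rate at
  \<open>\<beta> = 1 / (1 - s)\<close>, up to a polynomial factor.\<close>

lemma block_choices:
  assumes c: "c \<ge> 1" "psd d1 (complex_of_real c \<cdot>\<^sub>m \<sigma>1 - \<rho>1)" and r: "r > 0"
    and v: "\<And>s. 0 < s \<Longrightarrow> 0 < petzQ s" and E: "\<And>\<beta>. \<beta> > 1 \<Longrightarrow> rate r \<beta> \<le> E"
  shows "\<exists>C D. C > 0 \<and> (\<forall>n. \<exists>I. finite I \<and> (\<forall>(x,y)\<in>I. achieves n (outlen r n) x y) \<and>
    (\<forall>s. 0 < s \<longrightarrow> s < 1 \<longrightarrow> (\<exists>(x,y)\<in>I. - real n * E - log 2 (C * (real n + 1)^D) \<le> (1 - s) * x + s * y)))"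
proof -
  define C where "C = 2 * (log 2 c + 2) * (r + 1)^d2"
  define D where "D = d1 + 1 + d2"
  have lc: "log 2 c \<ge> 0" using c(1) by simp
  have C: "C > 0" unfolding C_def using lc r by (intro mult_pos_pos) auto
  have "\<exists>I. finite I \<and> (\<forall>(x,y)\<in>I. achieves n (outlen r n) x y) \<and>
    (\<forall>s. 0 < s \<longrightarrow> s < 1 \<longrightarrow> (\<exists>(x,y)\<in>I. - real n * E - log 2 (C * (real n + 1)^D) \<le> (1 - s) * x + s * y))" for n
  proof -
    define m where "m = outlen r n"
    note m = outlen_bounds[OF r, of n, folded m_def]
    obtain I1 where I1: "finite I1" "\<forall>(b,a)\<in>I1. test_opt n b a \<and> 0 < b \<and> 0 < a"
      "\<forall>\<beta>>1. \<exists>(b,a)\<in>I1. (sandQ \<beta> \<rho>1 \<sigma>1 ^ n) powr (1 / \<beta>) \<le>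
      2 * (real n + 1)^d1 * ((log 2 c + 2) * (real n + 1)) * (b * a powr (- ((\<beta> - 1) / \<beta>)))"
      using test_choices[OF c, of n] by blast
    obtain I2 where I2: "finite I2" "\<forall>(w,l)\<in>I2. out_opt m w l \<and> 0 < w \<and> 0 < l"
      "\<forall>s>0. 0 < petzQ s \<longrightarrow> (\<exists>(w,l)\<in>I2. petzQ s ^ m \<le> (real m + 1)^d2 * (w * l powr s))"
      using out_choices[of m] by blast
    let ?f = "\<lambda>((b,a),(w,l)). (log 2 (b * w), log 2 (b * w * l / a)) :: real \<times> real"
    show ?thesis
    proof (intro exI[of _ "?f ` (I1 \<times> I2)"] conjI allI impI)
      show "finite (?f ` (I1 \<times> I2))" using I1(1) I2(1) by simp
      show "\<forall>(x,y)\<in>?f ` (I1 \<times> I2). achieves n (outlen r n) x y"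
        unfolding achieves_def m_def[symmetric] using I1(2) I2(2) by fastforce
      fix s :: real assume s: "0 < s" "s < 1"
      define \<beta> where "\<beta> = 1 / (1 - s)"
      have \<beta>: "\<beta> > 1" "(\<beta> - 1) / \<beta> = s" using s by (auto simp: \<beta>_def field_simps)
      have v0: "petzQ s > 0" using v s by simp
      have v1: "petzQ s \<le> 1" by (rule petzQ_le_1[OF s(1)])
      let ?Q = "sandQ \<beta> \<rho>1 \<sigma>1"
      have Q1: "?Q \<ge> 1" by (rule sandQ_ge_1[OF \<rho>1 \<sigma>1 c(2) \<beta>(1)])
      obtain b a where ba: "(b,a) \<in> I1" "(?Q ^ n) powr (1 / \<beta>) \<le>
        2 * (real n + 1)^d1 * ((log 2 c + 2) * (real n + 1)) * (b * a powr (- s))"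
        using I1(3) \<beta> by fastforce
      obtain w l where wl: "(w,l) \<in> I2" "petzQ s ^ m \<le> (real m + 1)^d2 * (w * l powr s)"
        using I2(3) s(1) v0 by fastforce
      have pos: "0 < b" "0 < a" "0 < w" "0 < l" using I1(2) I2(2) ba(1) wl(1) by auto
      define x where "x = log 2 (b * w)"
      define y where "y = log 2 (b * w * l / a)"
      have "2 powr (- real n * E) \<le> 2 powr (- real n * rate r \<beta>)"
        using E[OF \<beta>(1)] by (simp add: mult_left_mono)
      also have "\<dots> = 2 powr (real n * (log 2 ?Q / \<beta>)) * 2 powr (real n * r * log 2 (petzQ s))"
        unfolding powr_add[symmetric] rate_def \<beta>(2) by (simp add: algebra_simps)
      also have "2 powr (real n * (log 2 ?Q / \<beta>)) = (?Q ^ n) powr (1 / \<beta>)"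
        using power_eq_powr_log[of ?Q n] Q1 by (simp add: powr_powr)
      also have "(?Q ^ n) powr (1 / \<beta>) * 2 powr (real n * r * log 2 (petzQ s)) \<le> (?Q ^ n) powr (1 / \<beta>) * petzQ s ^ m"
      proof (rule mult_left_mono)
        \<comment> \<open>Since \<open>petzQ s \<le> 1\<close>, rounding the output length down only
          helps here.\<close>
        have "log 2 (petzQ s) \<le> 0" using v0 v1 by simp
        then have "real n * r * log 2 (petzQ s) \<le> real m * log 2 (petzQ s)" using m(1) by (intro mult_right_mono_neg) auto
        then show "2 powr (real n * r * log 2 (petzQ s)) \<le> petzQ s ^ m" unfolding power_eq_powr_log[OF v0] by simp
      qed simp
      also have "(?Q ^ n) powr (1 / \<beta>) * petzQ s ^ m \<le>
        (2 * (real n + 1)^d1 * ((log 2 c + 2) * (real n + 1)) * (b * a powr (- s))) * ((real m + 1)^d2 * (w * l powr s))"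
        using ba(2) wl(2) v0 pos lc by (intro mult_mono) auto
      also have "\<dots> \<le> (2 * (real n + 1)^d1 * ((log 2 c + 2) * (real n + 1)) * (b * a powr (- s))) *
          (((r + 1) * (real n + 1))^d2 * (w * l powr s))"
        using m(3) pos lc by (intro mult_left_mono mult_right_mono power_mono) (auto intro!: mult_nonneg_nonneg)
      also have "\<dots> = C * (real n + 1)^D * (b * w * (l / a) powr s)"
      proof -
        have "(l / a) powr s = l powr s * a powr (- s)" using pos by (simp add: powr_divide powr_minus_divide)
        then show ?thesis
          unfolding C_def D_def power_add power_mult_distrib power_one_right by (simp only: mult_ac)
      qed
      finally have "log 2 (2 powr (- real n * E)) \<le> log 2 (C * (real n + 1)^D * (b * w * (l / a) powr s))"
        using C pos by (subst log_le_cancel_iff) auto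
      moreover have "log 2 (C * (real n + 1)^D * (b * w * (l / a) powr s))
        = log 2 (C * (real n + 1)^D) + ((1 - s) * x + s * y)"
      proof -
        have "log 2 (C * (real n + 1)^D * (b * w * (l / a) powr s))
          = log 2 (C * (real n + 1)^D) + log 2 (b * w * (l / a) powr s)"
          by (rule log_mult_pos) (use C pos in auto)
        also have "log 2 (b * w * (l / a) powr s) = x + s * log 2 (l / a)"
          unfolding x_def using pos by (simp add: log_mult log_powr)
        also have "log 2 (l / a) = y - x"
          unfolding x_def y_def using pos by (simp add: log_mult log_divide)
        finally show ?thesis by (simp add: algebra_simps)
      qed
      ultimately have "- real n * E - log 2 (C * (real n + 1)^D) \<le> (1 - s) * x + s * y" by simp
      moreover have "(x,y) \<in> ?f ` (I1 \<times> I2)" unfolding x_def y_def using ba(1) wl(1) by force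
      ultimately show "\<exists>(x,y)\<in>?f ` (I1 \<times> I2). - real n * E - log 2 (C * (real n + 1)^D) \<le> (1 - s) * x + s * y"
        by blast
    qed
  qed
  then show ?thesis using C by blast
qed

end

section \<open>Achievability and the main result\<close>

text \<open>Eigenvalues between 0 and 1 with sum 1 and sum of squares 1 are all 0 or 1, and both are
  fixed by a nonzero power.\<close>

lemma mpow_pure_state:
  assumes "pure_state n A" "a \<noteq> 0"
  shows "mpow a A = A"
proof -
  note Ap = pure_state_psd[OF assms(1)]
  obtain U d where U: "specdec n A U d" "\<forall>i<n. 0 \<le> d i" using psd_obtain[OF Ap(1)] by blast
  note UD = specdecD[OF U(1)]
  have s1: "(\<Sum>i<n. d i) = 1" using mtrace_specdec[OF U(1)] Ap(2) by (metis of_real_eq_1_iff)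
  have "mtrace (A * A) = (\<Sum>i<n. d i * (adj U * A * U) $$ (i,i))" by (rule mtrace_specdec_mult[OF U(1) UD(3)])
  also have "\<dots> = (\<Sum>i<n. complex_of_real (d i * d i))"
    by (intro sum.cong refl) (simp add: specdec_diag[OF U(1)] del: index_mult_mat(1))
  also have "\<dots> = complex_of_real (\<Sum>i<n. d i * d i)" by simp
  finally have s2: "(\<Sum>i<n. d i * d i) = 1" using Ap(3) by (metis of_real_eq_1_iff)
  have d1: "d i \<le> 1" if "i < n" for i
    using member_le_sum[of i "{..<n}" d] U(2) that s1 by auto
  have "(\<Sum>i<n. d i - d i * d i) = 0" using s1 s2 by (simp add: sum_subtractf)
  then have "d i - d i * d i = 0" if "i < n" for i
    using that U(2) d1 by (subst (asm) sum_nonneg_eq_0_iff) (auto simp: mult_left_le)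
  then have "d i = 0 \<or> d i = 1" if "i < n" for i
    using that by (metis eq_iff_diff_eq_0 mult_cancel_left2)
  then have "d i powr a = d i" if "i < n" for i using that assms(2) by fastforce
  then have "specdec n (mpow a A) U d" using specdec_cong[OF specdec_mpow[OF U(1), of a]] by blast
  then show ?thesis using UD(2) by (simp add: specdec_def)
qed

lemma supp_orth_mtrace:
  assumes "psd n \<rho>" "psd n \<sigma>" "supp_orth \<rho> \<sigma>"
  shows "mtrace (\<rho> * \<sigma>) = 0"
proof -
  note c = psdD(2)[OF assms(1)] psdD(2)[OF assms(2)]
  have "(\<rho> * \<sigma>) $$ (i,i) = 0" if i: "i < n" for i
  proof -
    let ?e = "unit_vec n i :: complex vec"
    have "(\<rho> * \<sigma>) $$ (i,i) = cinner ?e ((\<rho> * \<sigma>) *\<^sub>v ?e)"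
      by (rule cinner_unit_vec[OF mult_carrier_mat[OF c] i, symmetric])
    also have "(\<rho> * \<sigma>) *\<^sub>v ?e = \<rho> *\<^sub>v (\<sigma> *\<^sub>v ?e)" using c by (intro mat_vec_assoc) auto
    also have "cinner ?e (\<rho> *\<^sub>v (\<sigma> *\<^sub>v ?e)) = cinner (adj \<rho> *\<^sub>v ?e) (\<sigma> *\<^sub>v ?e)"
      by (rule cinner_adj[symmetric, OF c(1)]) (use c in \<open>auto intro!: carrier_vecI\<close>)
    also have "\<dots> = 0"
    proof -
      have "\<rho> *\<^sub>v ?e \<in> supp \<rho>" "\<sigma> *\<^sub>v ?e \<in> supp \<sigma>"
        unfolding supp_def using c by (auto intro!: exI[of _ ?e])
      then show ?thesis using assms(3) unfolding supp_orth_def psdD(5)[OF assms(1)] by blast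
    qed
    finally show ?thesis .
  qed
  then show ?thesis using mtrace_carrier[OF mult_carrier_mat[OF c]] by simp
qed

text \<open>If the trace vanishes, every index has \<open>q i = 0\<close> or a zero diagonal entry
  of the positive matrix \<open>?R\<close>, which removes its column; hence
  \<open>\<rho> * \<sigma> = 0\<close> and the supports are orthogonal. As
  \<open>0 powr s = 0\<close> for every \<open>s\<close>, the exponent is arbitrary.\<close>

lemma not_supp_orth_pos:
  assumes \<rho>: "psd n \<rho>" and \<sigma>: "psd n \<sigma>" and no: "\<not> supp_orth \<rho> \<sigma>"
  shows "0 < Re (mtrace (\<rho> * mpow s \<sigma>))"
proof (rule ccontr)
  assume neg: "\<not> 0 < Re (mtrace (\<rho> * mpow s \<sigma>))"
  note c = psdD(2)[OF \<rho>] psdD(2)[OF \<sigma>]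
  obtain U q where U: "specdec n \<sigma> U q" "\<forall>i<n. 0 \<le> q i" using psd_obtain[OF \<sigma>] by blast
  note UD = specdecD[OF U(1)] and M = specdec_mpow[OF U(1), of s]
  let ?R = "adj U * \<rho> * U"
  have R: "psd n ?R" by (rule psd_congruence[OF \<rho> UD(4)])
  have "Re (mtrace (\<rho> * mpow s \<sigma>)) = (\<Sum>i<n. q i powr s * Re (?R $$ (i,i)))"
    unfolding mtrace_comm[OF c(1) specdecD(3)[OF M]] mtrace_specdec_mult[OF M c(1)] Re_sum
    by (intro sum.cong refl) (simp del: index_mult_mat(1))
  moreover have nn: "0 \<le> q i powr s * Re (?R $$ (i,i))" if "i < n" for i
    using psd_diag(1)[OF R that] by simp
  ultimately have "(\<Sum>i<n. q i powr s * Re (?R $$ (i,i))) = 0"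
    using neg sum_nonneg[of "{..<n}" "\<lambda>i. q i powr s * Re (?R $$ (i,i))"] by simp
  then have z0: "q i = 0 \<or> Re (?R $$ (i,i)) = 0" if "i < n" for i
    using that nn by (subst (asm) sum_nonneg_eq_0_iff) auto
  have z: "q i = 0 \<or> ?R $$ (i,i) = 0" if "i < n" for i
    using z0[OF that] psd_diag(2)[OF R that] by (metis of_real_0)
  have Rc: "?R \<in> carrier_mat n n" by (rule psdD(2)[OF R])
  have RD: "?R * rdiag n q = 0\<^sub>m n n"
  proof (rule eq_matI)
    fix i j assume "i < dim_row (0\<^sub>m n n :: complex mat)" "j < dim_col (0\<^sub>m n n :: complex mat)"
    then have ij: "i < n" "j < n" by auto
    show "(?R * rdiag n q) $$ (i,j) = 0\<^sub>m n n $$ (i,j)"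
      unfolding mult_diag_of_index[OF Rc ij] using z[OF ij(2)] psd_zero_diag(2)[OF R ij(2) ij(1)] ij by auto
  qed (use Rc in auto)
  have "\<rho> * \<sigma> = U * (?R * rdiag n q) * adj U"
    using UD(7,8) c(1) by (simp add: UD(2) mat_assoc unitary_cancel[OF UD(1)])
  also have "\<dots> = 0\<^sub>m n n" unfolding RD using UD(7,8) by simp
  finally have zero: "\<rho> * \<sigma> = 0\<^sub>m n n" .
  have "supp_orth \<rho> \<sigma>"
    unfolding supp_orth_def
  proof (intro ballI)
    fix x y assume "x \<in> supp \<rho>" "y \<in> supp \<sigma>"
    then obtain v w where vw: "v \<in> carrier_vec n" "x = \<rho> *\<^sub>v v" "w \<in> carrier_vec n" "y = \<sigma> *\<^sub>v w"
      using c by (auto simp: supp_def)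
    have "cinner x y = cinner (adj \<rho> *\<^sub>v v) (\<sigma> *\<^sub>v w)" using vw psdD(5)[OF \<rho>] by simp
    also have "\<dots> = cinner v (\<rho> *\<^sub>v (\<sigma> *\<^sub>v w))"
      by (rule cinner_adj[OF c(1) vw(1)]) (use c vw in \<open>auto intro!: carrier_vecI\<close>)
    also have "\<rho> *\<^sub>v (\<sigma> *\<^sub>v w) = (\<rho> * \<sigma>) *\<^sub>v w" using c vw by (intro mat_vec_assoc[symmetric]) auto
    also have "\<dots> = 0\<^sub>v n" unfolding zero using vw(3) by (intro eq_vecI) auto
    also have "cinner v (0\<^sub>v n) = 0" using vw by (simp add: cinner_def)
    finally show "cinner x y = 0" .
  qed
  then show False using no by simp
qed

lemma kron_one_right: "kron A (1\<^sub>m 1) = A"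
  by (rule eq_matI) auto

context conversion begin

text \<open>The two test/output pairs provided by the minimax lemma for blocks of length \<open>l\<close> are used
  in the proportion \<open>\<lambda> : 1 - \<lambda>\<close>; the remaining outputs cost a factor that is exponential in
  \<open>n / l\<close> only.\<close>
lemma sc_eventually_le:
  assumes c: "c \<ge> 1" "psd d1 (complex_of_real c \<cdot>\<^sub>m \<sigma>1 - \<rho>1)" and r: "r > 0"
    and v: "\<And>s. 0 < s \<Longrightarrow> 0 < petzQ s" and E: "\<And>\<beta>. \<beta> > 1 \<Longrightarrow> rate r \<beta> \<le> E" and \<delta>: "\<delta> > 0"
  shows "eventually (\<lambda>n. sc_term d1 d2 \<rho>1 \<sigma>1 \<rho>2 \<sigma>2 r n \<le> ereal (E + \<delta>)) sequentially"
proof -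
  obtain C D where C: "C > 0" and blocks: "\<And>n. \<exists>I. finite I \<and> (\<forall>(x,y)\<in>I. achieves n (outlen r n) x y) \<and>
    (\<forall>s. 0 < s \<longrightarrow> s < 1 \<longrightarrow> (\<exists>(x,y)\<in>I. - real n * E - log 2 (C * (real n + 1)^D) \<le> (1 - s) * x + s * y))"
    using block_choices[OF c r v E] by blast
  \<comment> \<open>A pair for one output copy and no input, used to fill in outputs that the blocks
    leave missing.\<close>
  obtain x0 y0 where xy0: "achieves 0 1 x0 y0"
  proof -
    obtain I where I: "\<forall>(w,l)\<in>I. out_opt 1 w l \<and> 0 < w \<and> 0 < l"
      "\<forall>s>0. 0 < petzQ s \<longrightarrow> (\<exists>(w,l)\<in>I. petzQ s ^ 1 \<le> (real 1 + 1)^d2 * (w * l powr s))"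
      using out_choices[of 1] by blast
    have one: "(0::real) < 1" by simp
    obtain w l where "(w,l) \<in> I" using I(2)[rule_format, OF one v[OF one]] by blast
    then have "out_opt 1 w l" "0 < w" "0 < l" using I(1) by auto
    then have "achieves 0 1 (log 2 (1 * w)) (log 2 (1 * w * l / 1))"
      unfolding achieves_def using test_opt_trivial[of 0]
      by (intro exI[of _ 1] exI[of _ 1] exI[of _ w] exI[of _ l]) simp
    then show ?thesis using that by blast
  qed
  define Z where "Z = \<bar>x0\<bar> + \<bar>y0\<bar>"
  \<comment> \<open>The polynomial loss and the filling cost \<open>Z\<close> occur once per block,
    so a long block makes them negligible per copy.\<close>
  have "(\<lambda>l. (log 2 C + real D * log 2 (real l + 1) + Z) / real l) \<longlonglongrightarrow> 0" by real_asymp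
  then have "eventually (\<lambda>l. (log 2 C + real D * log 2 (real l + 1) + Z) / real l < \<delta> / 2) sequentially"
    using \<delta> by (intro order_tendstoD(2)) auto
  moreover have "eventually (\<lambda>l::nat. l > 0) sequentially" by (rule eventually_gt_at_top)
  ultimately have "eventually (\<lambda>l. (log 2 C + real D * log 2 (real l + 1) + Z) / real l < \<delta> / 2 \<and> l > 0) sequentially"
    by eventually_elim simp
  then obtain l where l: "(log 2 C + real D * log 2 (real l + 1) + Z) / real l < \<delta> / 2" "l > 0"
    by (auto dest: eventually_happens)
  define cl where "cl = - real l * E - log 2 (C * (real l + 1)^D)"
  define ml where "ml = outlen r l"
  obtain I where I: "finite I" "\<forall>(x,y)\<in>I. achieves l ml x y"
    "\<forall>s. 0 < s \<longrightarrow> s < 1 \<longrightarrow> (\<exists>(x,y)\<in>I. cl \<le> (1 - s) * x + s * y)"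
    using blocks[of l] unfolding cl_def ml_def by blast
  obtain p p' la where p: "p \<in> I" "p' \<in> I" "0 \<le> la" "la \<le> 1"
    "cl \<le> la * fst p + (1 - la) * fst p'" "cl \<le> la * snd p + (1 - la) * snd p'"
    using minimax_two_points[OF I(1), of cl] I(3) by blast
  have A: "achieves l ml (fst p) (snd p)" and A': "achieves l ml (fst p') (snd p')" using I(2) p(1,2) by auto
  \<comment> \<open>Costs that do not grow with \<open>n\<close>: the moduli pay for rounding
    \<open>la * k\<close>, the last summand for the outputs of the incomplete final block.\<close>
  define R where "R = \<bar>fst p\<bar> + \<bar>fst p'\<bar> + \<bar>snd p\<bar> + \<bar>snd p'\<bar> + real l * r * Z"
  \<comment> \<open>Cost per block: the guaranteed exponent \<open>- cl\<close>, plus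
    \<open>Z\<close> for the at most one output lost to rounding.\<close>
  define u where "u = Z - cl"
  have bound: "sc_term d1 d2 \<rho>1 \<sigma>1 \<rho>2 \<sigma>2 r n \<le> ereal (u / real l + (2 + R + \<bar>u\<bar>) / real n)" if n: "n > 0" for n
  proof -
    define k where "k = n div l"
    define k1 where "k1 = nat \<lfloor>la * real k\<rfloor>"
    define m where "m = outlen r n"
    note mb = outlen_bounds[OF r, of n, folded m_def] and mlb = outlen_bounds[OF r, of l, folded ml_def]
    have lk: "0 \<le> la * real k" "la * real k \<le> real k" using p(3,4) by (auto simp: mult_left_le_one_le)
    have k1: "real k1 \<le> la * real k" "la * real k - 1 \<le> real k1" unfolding k1_def using lk(1) by linarith+
    have k1k: "k1 \<le> k" using k1(1) lk(2) by linarith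
    have kl: "k * l \<le> n" by (simp add: k_def)
    have kml: "k * ml \<le> m"
    proof -
      have "real (k * ml) \<le> real n * r"
      proof -
        have "real k * real ml \<le> real k * (real l * r)" using mlb(1) by (intro mult_left_mono) auto
        also have "\<dots> = real (k * l) * r" by simp
        also have "\<dots> \<le> real n * r" using kl r by (intro mult_right_mono) (simp_all flip: of_nat_mult)
        finally show ?thesis by simp
      qed
      then show ?thesis unfolding m_def outlen_def by (rule le_nat_floor)
    qed
    define M where "M = m - k * ml"
    \<comment> \<open>At most one missing output per block from rounding \<open>l r\<close> down,
      and at most \<open>l r\<close> from the incomplete final block.\<close>
    have Mb: "real M \<le> real l * r + real k"
    proof -
      have "real n \<le> real k * real l + real l"
      proof -
        have "n \<le> k * l + l" unfolding k_def by (metis div_mult_mod_eq add_left_mono mod_less_divisor l(2) less_imp_le)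
        then show ?thesis by (metis of_nat_add of_nat_le_iff of_nat_mult)
      qed
      then have "real n * r \<le> (real k * real l + real l) * r" using r by (intro mult_right_mono) auto
      moreover have "real k * (real l * r - 1) \<le> real k * real ml" using mlb(2) by (intro mult_left_mono) auto
      moreover have "real M = real m - real k * real ml" unfolding M_def using kml by (simp add: of_nat_diff)
      ultimately show ?thesis using mb(1) by (simp add: algebra_simps)
    qed
    define X where "X = real k1 * fst p + (real (k - k1) * fst p' + real M * x0)"
    define Y where "Y = real k1 * snd p + (real (k - k1) * snd p' + real M * y0)"
    have achX: "achieves n m X Y"
    proof -
      have "achieves (k1 * l + ((k - k1) * l + (M * 0 + (n - k * l)))) (k1 * ml + ((k - k1) * ml + (M * 1 + 0)))
        (real k1 * fst p + (real (k - k1) * fst p' + (real M * x0 + 0)))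
        (real k1 * snd p + (real (k - k1) * snd p' + (real M * y0 + 0)))"
        by (intro achieves_add achieves_times A A' xy0 achieves_input)
      moreover have "k1 * l + ((k - k1) * l + (M * 0 + (n - k * l))) = n"
        using k1k kl by (simp add: add.assoc[symmetric] add_mult_distrib[symmetric])
      moreover have "k1 * ml + ((k - k1) * ml + (M * 1 + 0)) = m"
        using k1k kml by (simp add: M_def add.assoc[symmetric] add_mult_distrib[symmetric])
      ultimately show ?thesis by (simp only: X_def Y_def add_0_right)
    qed
    have low: "real k * cl - \<bar>f\<bar> - \<bar>f'\<bar> - (real l * r + real k) * Z \<le> real k1 * f + (real (k - k1) * f' + real M * z)"
      if "cl \<le> la * f + (1 - la) * f'" "\<bar>z\<bar> \<le> Z" for f f' z
    proof -
      define t where "t = la * real k - real k1"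
      have t: "0 \<le> t" "t \<le> 1" using k1 by (auto simp: t_def)
      have "real k1 * f + real (k - k1) * f' = real k * (la * f + (1 - la) * f') - t * f + t * f'"
        unfolding t_def using k1k by (simp add: of_nat_diff algebra_simps)
      moreover have "real k * cl \<le> real k * (la * f + (1 - la) * f')" using that(1) by (intro mult_left_mono) auto
      moreover have "t * f \<le> \<bar>f\<bar>" "- (t * f') \<le> \<bar>f'\<bar>"
      proof -
        have "\<bar>t * g\<bar> \<le> \<bar>g\<bar>" for g using t by (simp add: abs_mult mult_left_le_one_le)
        then show "t * f \<le> \<bar>f\<bar>" "- (t * f') \<le> \<bar>f'\<bar>" using abs_le_D1 abs_le_D2 by blast+
      qed
      moreover have "- ((real l * r + real k) * Z) \<le> real M * z"
      proof -
        have "\<bar>real M * z\<bar> \<le> (real l * r + real k) * Z"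
          unfolding abs_mult using Mb that(2) r by (intro mult_mono) auto
        then show ?thesis by linarith
      qed
      ultimately show ?thesis by linarith
    qed
    \<comment> \<open>The 2 stands for two halvings of the overlap: one from building the channel,
      one from passing to the trace distance.\<close>
    have "- (2 + R + real k * u) \<le> min X Y - 2"
    proof -
      have Z0: "\<bar>x0\<bar> \<le> Z" "\<bar>y0\<bar> \<le> Z" by (auto simp: Z_def)
      have lX: "real k * cl - \<bar>fst p\<bar> - \<bar>fst p'\<bar> - (real l * r + real k) * Z \<le> X"
        unfolding X_def by (rule low[OF p(5) Z0(1)])
      have lY: "real k * cl - \<bar>snd p\<bar> - \<bar>snd p'\<bar> - (real l * r + real k) * Z \<le> Y"
        unfolding Y_def by (rule low[OF p(6) Z0(2)])
      have e: "R + real k * u = \<bar>fst p\<bar> + \<bar>fst p'\<bar> + \<bar>snd p\<bar> + \<bar>snd p'\<bar> + (real l * r + real k) * Z - real k * cl"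
        unfolding R_def u_def by (simp add: algebra_simps)
      have "- (R + real k * u) \<le> X" "- (R + real k * u) \<le> Y" unfolding e using lX lY by linarith+
      then show ?thesis by simp
    qed
    \<comment> \<open>The sign of \<open>u\<close> is unknown, so replacing \<open>k\<close> by
      \<open>n / l\<close> costs its modulus.\<close>
    moreover have "real k * u \<le> real n / real l * u + \<bar>u\<bar>"
    proof -
      have "real k = of_int \<lfloor>real n / real l\<rfloor>" unfolding k_def by (simp add: floor_divide_of_nat_eq)
      then have "\<bar>real k - real n / real l\<bar> \<le> 1" by linarith
      then have "\<bar>(real k - real n / real l) * u\<bar> \<le> 1 * \<bar>u\<bar>" unfolding abs_mult by (intro mult_right_mono) auto
      then show ?thesis by (simp add: left_diff_distrib)
    qed
    ultimately have mn: "2 - min X Y \<le> 2 + R + \<bar>u\<bar> + real n / real l * u" by linarith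
    obtain \<Phi> where \<Phi>: "feasible n m \<Phi>" "2 powr (min X Y) / 2 \<le> overlap n m \<Phi>" using achieves_value[OF achX] by blast
    have "sc_term d1 d2 \<rho>1 \<sigma>1 \<rho>2 \<sigma>2 r n \<le> ereal (- (1 / real n) * log 2 (2 powr (min X Y) / 2 / 2))"
      by (rule sc_upper[of n r \<Phi>]) (use \<Phi> in \<open>auto simp: m_def\<close>)
    also have "- (1 / real n) * log 2 (2 powr (min X Y) / 2 / 2) = (2 - min X Y) / real n"
    proof -
      have "log 2 (4::real) = 2" using log_pow_cancel[of 2 2] by simp
      then have "log 2 (2 powr (min X Y) / 2 / 2) = min X Y - 2" by (simp add: log_divide)
      then show ?thesis using n by (simp only:) (simp add: field_simps)
    qed
    also have "\<dots> \<le> (2 + R + \<bar>u\<bar> + real n / real l * u) / real n"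
      using mn by (intro divide_right_mono) auto
    also have "\<dots> = u / real l + (2 + R + \<bar>u\<bar>) / real n"
      using n by (simp add: field_simps)
    finally show ?thesis by simp
  qed
  have u: "u / real l < E + \<delta> / 2"
  proof -
    have "log 2 (C * (real l + 1)^D) = log 2 C + real D * log 2 (real l + 1)"
      using C by (simp add: log_mult log_nat_power)
    then have "u / real l = E + (log 2 C + real D * log 2 (real l + 1) + Z) / real l"
      unfolding u_def cl_def using l(2) by (simp add: field_simps)
    then show ?thesis using l(1) by simp
  qed
  have "(\<lambda>n. (2 + R + \<bar>u\<bar>) / real n) \<longlonglongrightarrow> 0" by real_asymp
  then have "eventually (\<lambda>n. (2 + R + \<bar>u\<bar>) / real n < \<delta> / 2) sequentially"
    using \<delta> by (intro order_tendstoD(2)) auto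
  moreover have "eventually (\<lambda>n::nat. n > 0) sequentially" by (rule eventually_gt_at_top)
  ultimately show ?thesis
  proof eventually_elim
    case (elim n)
    have "u / real l + (2 + R + \<bar>u\<bar>) / real n \<le> E + \<delta>" using elim(1) u by linarith
    then have "ereal (u / real l + (2 + R + \<bar>u\<bar>) / real n) \<le> ereal (E + \<delta>)" by simp
    then show ?case using bound[OF elim(2)] by (rule order_trans[rotated])
  qed
qed

text \<open>Some eigenvector in the kernel of \<open>\<sigma>1\<close> carries weight
  \<open>b > 0\<close> under \<open>\<rho>1\<close>. Testing for it on a single copy never accepts
  \<open>\<sigma>1\<close>, so the target itself may be prepared on acceptance. The overlap is at
  least \<open>b\<close> for every \<open>n\<close>.\<close>

lemma sc_tendsto_0:
  assumes no: "\<not> supp \<rho>1 \<subseteq> supp \<sigma>1" and r: "r > 0"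
  shows "sc_term d1 d2 \<rho>1 \<sigma>1 \<rho>2 \<sigma>2 r \<longlonglongrightarrow> 0"
proof -
  obtain U q where U: "specdec d1 \<sigma>1 U q" using psd_obtain[OF psd_states(2)] by blast
  note UD = specdecD[OF U]
  let ?R = "adj U * \<rho>1 * U"
  have R: "psd d1 ?R" by (rule psd_congruence[OF psd_states(1) UD(4)])
  obtain i where i: "i < d1" "q i = 0" "?R $$ (i,i) \<noteq> 0" using no supp_subset_diag[OF psd_states(1) U] by blast
  define P where "P = U * rdiag d1 (\<lambda>j. if j = i then 1 else 0) * adj U"
  have Psd: "specdec d1 P U (\<lambda>j. if j = i then 1 else 0)" using UD(1) by (simp add: specdec_def P_def)
  have onesd: "specdec d1 (1\<^sub>m d1) U (\<lambda>_. 1)" using UD(1) unitaryD[OF UD(1)] by (simp add: specdec_def diag_of_one)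
  have P: "psd d1 P" "psd d1 (1\<^sub>m d1 - P)"
    using psd_specdec[OF Psd] psd_specdec[OF specdec_diff[OF onesd Psd]] by auto
  have sel: "(\<Sum>j<d1. complex_of_real (if j = i then 1 else 0) * h j) = h i" for h
  proof -
    have "(\<Sum>j<d1. complex_of_real (if j = i then 1 else 0) * h j) = (\<Sum>j<d1. if j = i then h i else 0)"
      by (intro sum.cong) auto
    then show ?thesis using i(1) by simp
  qed
  define b where "b = Re (?R $$ (i,i))"
  have b: "b > 0"
    using psd_diag[OF R i(1)] i(3) unfolding b_def by (metis less_eq_real_def of_real_0)
  have tb: "Re (mtrace (P * \<rho>1)) = b"
    unfolding mtrace_specdec_mult[OF Psd psdD(2)[OF psd_states(1)]] sel b_def ..
  have ta: "Re (mtrace (P * \<sigma>1)) = 0"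
    unfolding mtrace_specdec_mult[OF Psd UD(3)] sel specdec_diag[OF U i(1)] using i(2) by simp
  have t1: "tpow 1 A = A" for A using kron_one_right[of A] by simp
  have "test_opt 1 b 0" unfolding test_opt_def t1 using P ta tb by (intro exI[of _ P]) simp
  from test_opt_add[OF this test_opt_trivial] have to: "test_opt (Suc k) b 0" for k by simp
  have "sc_term d1 d2 \<rho>1 \<sigma>1 \<rho>2 \<sigma>2 r n \<le> ereal (- log 2 (b / 2) / real n)" if n: "n > 0" for n
  proof -
    obtain T where T: "psd (d1^n) T" "psd (d1^n) (1\<^sub>m (d1^n) - T)"
      "Re (mtrace (T * tpow n \<rho>1)) = b" "Re (mtrace (T * tpow n \<sigma>1)) = 0"
      using to[of "n - 1"] n by (auto simp: test_opt_def)
    define m where "m = outlen r n"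
    have pp: "pure_state (d2^m) (tpow m \<rho>2)" by (rule pure_state_tpow[OF pure])
    have "tpow m \<sigma>2 - complex_of_real 0 \<cdot>\<^sub>m tpow m \<rho>2 = tpow m \<sigma>2"
      by (rule eq_matI) (use psdD(3,4)[OF psd_states(3)] psdD(3,4)[OF psd_states(4)] in auto)
    then have "psd (d2^m) (tpow m \<sigma>2 - complex_of_real 0 \<cdot>\<^sub>m tpow m \<rho>2)" by (simp only: psd_tpow[OF psd_states(4)])
    moreover have "(0::real) < 1" by simp
    ultimately have "\<exists>\<Phi>. feasible n m \<Phi> \<and> b * Re (mtrace (tpow m \<rho>2 * tpow m \<rho>2)) \<le> overlap n m \<Phi>"
      using feasible_measure_prepare[OF T(1,2) density_tpow[OF \<rho>2], of m, unfolded T(3,4)] by blast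
    then
    obtain \<Phi> where "feasible n m \<Phi>" "b \<le> overlap n m \<Phi>" using pure_state_psd(3)[OF pp] by auto
    then have "sc_term d1 d2 \<rho>1 \<sigma>1 \<rho>2 \<sigma>2 r n \<le> ereal (- (1 / real n) * log 2 (b / 2))"
      using b by (intro sc_upper[of n r \<Phi>]) (auto simp: m_def)
    then show ?thesis by simp
  qed
  then have "eventually (\<lambda>n. sc_term d1 d2 \<rho>1 \<sigma>1 \<rho>2 \<sigma>2 r n \<le> ereal (- log 2 (b / 2) / real n)) sequentially"
    using eventually_gt_at_top[of 0] by (rule eventually_mono[rotated])
  moreover have "(\<lambda>n. - log 2 (b / 2) / real n) \<longlonglongrightarrow> 0" by real_asymp
  then have "(\<lambda>n. ereal (- log 2 (b / 2) / real n)) \<longlonglongrightarrow> 0" by (simp add: zero_ereal_def)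
  ultimately show ?thesis
    using sc_nonneg by (intro tendsto_sandwich[of "\<lambda>_. 0" "sc_term d1 d2 \<rho>1 \<sigma>1 \<rho>2 \<sigma>2 r" sequentially "\<lambda>n. ereal (- log 2 (b / 2) / real n)"]) auto
qed

text \<open>Needed in the orthogonal case, where the overlap bound contains a power of 0 that
  vanishes only for nonempty outputs.\<close>

lemma outlen_eventually_pos:
  assumes "r > 0" shows "eventually (\<lambda>n. outlen r n > 0) sequentially"
proof -
  have "filterlim (\<lambda>n. real n * r) at_top sequentially" using assms by real_asymp
  then have "eventually (\<lambda>n. real n * r > 1) sequentially" by (simp add: filterlim_at_top_dense)
  then show ?thesis
  proof eventually_elim
    case (elim n)
    then show ?case using outlen_bounds(2)[OF assms, of n] by linarith
  qed
qed

lemma sc_tendsto_infinity: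
  assumes c: "c \<ge> 1" "psd d1 (complex_of_real c \<cdot>\<^sub>m \<sigma>1 - \<rho>1)" and r: "r > 0" and o: "supp_orth \<rho>2 \<sigma>2"
  shows "sc_term d1 d2 \<rho>1 \<sigma>1 \<rho>2 \<sigma>2 r \<longlonglongrightarrow> \<infinity>"
proof -
  have "eventually (\<lambda>n. sc_term d1 d2 \<rho>1 \<sigma>1 \<rho>2 \<sigma>2 r n = \<infinity>) sequentially"
    using outlen_eventually_pos[OF r]
  proof eventually_elim
    case (elim n)
    have "overlap n (outlen r n) \<Phi> \<le> 0" if "feasible n (outlen r n) \<Phi>" for \<Phi>
      using overlap_dominated[OF _ c(2) that] c(1) elim supp_orth_mtrace[OF psd_states(3,4) o]
      by (simp add: zero_power)
    then show ?case by (rule sc_infinite)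
  qed
  then show ?thesis by (rule tendsto_eventually)
qed

text \<open>Both divergences are finite under these assumptions. The prefactor turns
  \<open>1 / (1 / \<beta> - 1)\<close> into -1 and \<open>1 / (\<beta> - 1)\<close> into
  \<open>1 / \<beta>\<close>.\<close>

lemma term_eq_rate:
  assumes sub: "supp \<rho>1 \<subseteq> supp \<sigma>1" and no: "\<not> supp_orth \<rho>2 \<sigma>2" and \<beta>: "\<beta> > 1"
  shows "ereal ((\<beta> - 1) / \<beta>) * (ereal r * petz (1 / \<beta>) \<rho>2 \<sigma>2 - sandwiched \<beta> \<rho>1 \<sigma>1) = ereal (rate r \<beta>)"
proof -
  have "1 / \<beta> \<noteq> 1" "1 / \<beta> \<noteq> 0" "1 - 1 / \<beta> = (\<beta> - 1) / \<beta>" using \<beta> by (auto simp: field_simps)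
  then have p: "petz (1 / \<beta>) \<rho>2 \<sigma>2 = ereal (1 / (1 / \<beta> - 1) * log 2 (petzQ ((\<beta> - 1) / \<beta>)))"
    using no by (simp add: petz_def petzQ_def mpow_pure_state[OF pure])
  have s: "sandwiched \<beta> \<rho>1 \<sigma>1 = ereal (1 / (\<beta> - 1) * log 2 (sandQ \<beta> \<rho>1 \<sigma>1))"
    using sub \<beta> by (simp add: sandwiched_def sandQ_def)
  have "(\<beta> - 1) / \<beta> * (r * (1 / (1 / \<beta> - 1) * L) - 1 / (\<beta> - 1) * S) = - r * L - S / \<beta>" for L S
  proof -
    have "1 / (1 / \<beta> - 1) = - \<beta> / (\<beta> - 1)" using \<beta> by (simp add: field_simps)
    moreover have "(\<beta> - 1) / \<beta> * (r * (- \<beta> / (\<beta> - 1) * L)) = - r * L" using \<beta> by simp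
    moreover have "(\<beta> - 1) / \<beta> * (1 / (\<beta> - 1) * S) = S / \<beta>" using \<beta> by simp
    ultimately show ?thesis by (simp only: right_diff_distrib)
  qed
  then show ?thesis unfolding p s rate_def by simp
qed

end

theorem mainTheorem2:
  fixes d1 d2 :: nat and \<rho>1 \<sigma>1 \<rho>2 \<sigma>2 :: "complex mat" and r :: real
  assumes "density d1 \<rho>1" and "density d1 \<sigma>1"
    and "density d2 \<rho>2" and "density d2 \<sigma>2"
    and "supp \<rho>1 \<subseteq> supp \<sigma>1 \<or> supp \<rho>2 \<subseteq> supp \<sigma>2"
    and "r > 0"
    and "pure_state d2 \<rho>2"
  shows "sc_term d1 d2 \<rho>1 \<sigma>1 \<rho>2 \<sigma>2 r \<longlonglongrightarrow>
    (SUP \<beta>\<in>{1..}. ereal ((\<beta> - 1) / \<beta>) *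
        (ereal r * petz (1 / \<beta>) \<rho>2 \<sigma>2 - sandwiched \<beta> \<rho>1 \<sigma>1))"
proof -
  interpret conversion d1 d2 \<rho>1 \<sigma>1 \<rho>2 \<sigma>2 by unfold_locales (use assms in auto)
  let ?t = "\<lambda>\<beta>. ereal ((\<beta> - 1) / \<beta>) * (ereal r * petz (1 / \<beta>) \<rho>2 \<sigma>2 - sandwiched \<beta> \<rho>1 \<sigma>1)"
  \<comment> \<open>The factor 0 wins even over infinite relative entropies, since
    \<open>0 * \<infinity> = 0\<close> in the extended reals.\<close>
  have t1: "?t 1 = 0" by (simp flip: zero_ereal_def)
  consider (B) "\<not> supp \<rho>1 \<subseteq> supp \<sigma>1" | (A) "supp \<rho>1 \<subseteq> supp \<sigma>1" "supp_orth \<rho>2 \<sigma>2"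
    | (C) "supp \<rho>1 \<subseteq> supp \<sigma>1" "\<not> supp_orth \<rho>2 \<sigma>2" by blast
  then show ?thesis
  proof cases
    case B
    \<comment> \<open>The support assumption rules out \<infinity> - \<infinity>: a pure
      \<open>\<rho>2\<close> dominated by \<open>c\<close> times \<open>\<sigma>2\<close> cannot be
      orthogonal to it, as its squared trace is 1.\<close>
    then have sub2: "supp \<rho>2 \<subseteq> supp \<sigma>2" using assms(5) by blast
    have no: "\<not> supp_orth \<rho>2 \<sigma>2"
    proof
      assume o: "supp_orth \<rho>2 \<sigma>2"
      obtain c where "c \<ge> 1" "psd d2 (complex_of_real c \<cdot>\<^sub>m \<sigma>2 - \<rho>2)"
        using supp_dominated[OF psd_states(3,4) sub2] by blast
      from psd_mtrace_mono[OF psd_states(3) this(2) psdD(2)[OF psd_states(3)]]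
      have "Re (mtrace (\<rho>2 * \<rho>2)) \<le> Re (mtrace (\<rho>2 * (complex_of_real c \<cdot>\<^sub>m \<sigma>2)))" using psdD(2)[OF psd_states(4)] by simp
      also have "mtrace (\<rho>2 * (complex_of_real c \<cdot>\<^sub>m \<sigma>2)) = 0"
        using mtrace_mult_smult[OF psdD(2)[OF psd_states(4)] psdD(2)[OF psd_states(3)]] supp_orth_mtrace[OF psd_states(3,4) o] by simp
      finally show False using pure_state_psd(3)[OF pure] by simp
    qed
    have "?t \<beta> \<le> 0" if "\<beta> \<in> {1..}" for \<beta>
    proof (cases "\<beta> = 1")
      case True
      show ?thesis unfolding True t1 by simp
    next
      case False
      then have \<beta>: "\<beta> > 1" using that by simp
      have "1 / \<beta> \<noteq> 1" using \<beta> by simp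
      then obtain p where "petz (1 / \<beta>) \<rho>2 \<sigma>2 = ereal p" using no by (auto simp: petz_def)
      moreover have "sandwiched \<beta> \<rho>1 \<sigma>1 = \<infinity>" using B \<beta> by (simp add: sandwiched_def)
      ultimately show ?thesis using \<beta> by simp
    qed
    then have "(SUP \<beta>\<in>{1..}. ?t \<beta>) \<le> 0" by (rule SUP_least)
    moreover have "?t 1 \<le> (SUP \<beta>\<in>{1..}. ?t \<beta>)" by (rule SUP_upper) simp
    then have "0 \<le> (SUP \<beta>\<in>{1..}. ?t \<beta>)" by (simp only: t1)
    ultimately have "(SUP \<beta>\<in>{1..}. ?t \<beta>) = 0" by (rule antisym)
    then show ?thesis using sc_tendsto_0[OF B assms(6)] by simp
  next
    case A
    obtain c where c: "c \<ge> 1" "psd d1 (complex_of_real c \<cdot>\<^sub>m \<sigma>1 - \<rho>1)"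
      using supp_dominated[OF psd_states(1,2) A(1)] by blast
    \<comment> \<open>The single order \<open>\<beta> = 2\<close> already makes the supremum
      infinite.\<close>
    have "petz (1 / 2) \<rho>2 \<sigma>2 = \<infinity>" using A(2) by (simp add: petz_def)
    moreover obtain q where "sandwiched 2 \<rho>1 \<sigma>1 = ereal q" using A(1) by (auto simp: sandwiched_def)
    ultimately have "?t 2 = \<infinity>" using assms(6) by simp
    moreover have "?t 2 \<le> (SUP \<beta>\<in>{1..}. ?t \<beta>)" by (rule SUP_upper) simp
    ultimately have "(SUP \<beta>\<in>{1..}. ?t \<beta>) = \<infinity>" by (simp only: ereal_infty_less_eq)
    then show ?thesis using sc_tendsto_infinity[OF c assms(6) A(2)] by simp
  next
    case C
    obtain c where c: "c \<ge> 1" "psd d1 (complex_of_real c \<cdot>\<^sub>m \<sigma>1 - \<rho>1)"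
      using supp_dominated[OF psd_states(1,2) C(1)] by blast
    have v: "0 < petzQ s" for s unfolding petzQ_def by (rule not_supp_orth_pos[OF psd_states(3,4) C(2)])
    note rate = term_eq_rate[OF C]
    define S where "S = (SUP \<beta>\<in>{1..}. ?t \<beta>)"
    have "?t 1 \<le> S" unfolding S_def by (rule SUP_upper) simp
    then have S0: "0 \<le> S" by (simp only: t1)
    have "sc_term d1 d2 \<rho>1 \<sigma>1 \<rho>2 \<sigma>2 r \<longlonglongrightarrow> S"
    proof (rule order_tendstoI)
      fix y assume "y < S"
      then obtain \<beta> where \<beta>: "\<beta> \<ge> 1" "y < ?t \<beta>" unfolding S_def less_SUP_iff by auto
      show "eventually (\<lambda>n. y < sc_term d1 d2 \<rho>1 \<sigma>1 \<rho>2 \<sigma>2 r n) sequentially"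
      proof (cases "\<beta> = 1")
        case True
        have "y < 0" using \<beta>(2) unfolding True t1 .
        then show ?thesis using sc_nonneg less_le_trans by (intro always_eventually) blast
      next
        case False
        then have b1: "\<beta> > 1" using \<beta>(1) by simp
        have "y < ereal (rate r \<beta>)" using \<beta>(2) rate[OF b1] by simp
        then obtain z where z: "y < ereal z" "z < rate r \<beta>" by (metis ereal_dense2 less_ereal.simps(1))
        show ?thesis
          using sc_eventually_gt[OF c b1 assms(6) v z(2)] by (rule eventually_mono) (use z(1) in \<open>auto intro: less_trans\<close>)
      qed
    next
      fix y assume y: "S < y"
      \<comment> \<open>\<open>y\<close> above \<open>S\<close> excludes \<infinity> and
        nonnegativity excludes the other end, so \<open>S\<close> is a real bound on all
        rates.\<close>
      then obtain E where E: "S = ereal E" using S0 by (cases S) auto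
      obtain z where z: "S < ereal z" "ereal z < y" using y ereal_dense2 by blast
      have "rate r \<beta> \<le> E" if "\<beta> > 1" for \<beta>
      proof -
        have "?t \<beta> \<le> S" unfolding S_def using that by (intro SUP_upper) auto
        then show ?thesis using rate[OF that] E by simp
      qed
      moreover have "z - E > 0" using z(1) E by simp
      ultimately have "eventually (\<lambda>n. sc_term d1 d2 \<rho>1 \<sigma>1 \<rho>2 \<sigma>2 r n \<le> ereal (E + (z - E))) sequentially"
        using sc_eventually_le[OF c assms(6) v] by blast
      then show "eventually (\<lambda>n. sc_term d1 d2 \<rho>1 \<sigma>1 \<rho>2 \<sigma>2 r n < y) sequentially"
        by (rule eventually_mono) (use z(2) in \<open>auto intro: le_less_trans\<close>)
    qed
    then show ?thesis unfolding S_def .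
  qed
qed

end
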